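(* Let $\mu$ be a probability measure on $S^2$ that has a bounded density with respect to the uniform measure. Fix $\alpha\in[0,1)$ and $\delta\in(0,1-\alpha)$. For every $N\ge1$, choose an integer $n(N)$ between $1$ and $N^\alpha$ and a collection of $n(N)$ points $\Xi_N\subseteq S^2\setminus S_\mu$ satisfying: there exists $\epsilon\in(0,1)$ so that for every $N$ and every pair of distinct points $\xi_1,\xi_2\in\Xi_N$ we have $|\xi_1-\xi_2|>N^{-1/2+\epsilon/2}$. Let $p_{N,\Xi_N}$ be the random degree $N$ polynomial that vanishes at each $\xi\in\Xi_N$ and whose other $N-n(N)$ zeros are chosen independently from $\mu$. Fix $r>0$ and, for each $N$ and every $\xi\in\Xi_N$, let $\Gamma_{N,\xi}$ be the geodesic circle of radius $rN^{-1}$ centered at $w_{N,\xi}$. If $\xi\notin\Gamma_{N,\xi}$ for all $N$ and all $\xi\in\Xi_N$, then there exists $C=C(\alpha,\delta,\epsilon,r)>0$ so that $$\mathbb P\left(\forall\,\xi\in\Xi_N\quad\exists!\ w\text{ inside }\Gamma_{N,\xi}\ \text{ such that }\ \frac{d}{dw}p_{N,\Xi_N}(w)=0\right)\ \geq\ 1-C\cdot N^{-\delta}$$ for all $N$. (Here $S_\mu$ and $w_{N,\xi}$ are as defined in the context.)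
   Context: Polynomials of degree at most $N$ in one complex variable are identified with meromorphic functions on the Riemann sphere $S^2$ having a pole at a distinguished point $\infty\in S^2$; $\underline{0}$ denotes the antipodal point to $\infty$. Throughout, $w$ is the usual holomorphic coordinate on $S^2$ centered at $\infty$ (so the point $\infty$ has coordinate $w=0$ and $\underline{0}$ corresponds to $w=\infty$), and points of $S^2$ are identified with their $w$-coordinates; $|\xi_1-\xi_2|$ is computed in this coordinate. $S^2$ carries its usual round metric with distance $d_{S^2}$; the "uniform measure" is the normalized rotation-invariant measure. "Inside $\Gamma_{N,\xi}$" means in the open geodesic disk bounded by $\Gamma_{N,\xi}$ that contains its center. A polynomial with zeros $\zeta_1,\dots,\zeta_N$ is, up to a non-zero constant, $w^{-N}\prod_{j=1}^N(w-\zeta_j)$ in the coordinate $w$. The random polynomial $p_{N,\Xi_N}$ is defined only up to a non-zero multiplicative constant, as an element of the projectivization $\mathbb P(\mathcal P_N)$ of the space $\mathcal P_N$ of polynomials of degree at most $N$; its zeros and critical points do not depend on the choice of representative. Exceptional set: put $$\phi_\mu(w)=\int_{\mathbb C}\frac{d\mu(\zeta)}{w-\zeta},\qquad S_\mu=\left\{w\ :\ -\frac1w+\phi_\mu(w)\in\{0,\infty\}\right\},$$ where $w$ ranges over all of $S^2$ including $\underline{0}$ (i.e. $w=\infty$, where the expression is $0$); thus $\underline{0},\infty\in S_\mu$. Averaged critical point: for $\xi\in S^2\setminus S_\mu$, let $$p_{N,\xi}(w)=\frac{1}{w^N}(w-\xi)\prod_{j=1}^{N-1}(w-\xi_j)$$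 with $\xi_1,\dots,\xi_{N-1}$ independent with law $\mu$. Then $w_{N,\xi}$ denotes the unique solution of $$\mathbb E\left[\partial_w\log|p_{N,\xi}(w)|^2\right]=0,\quad\text{i.e.}\quad -\frac{N}{w}+\frac{1}{w-\xi}+(N-1)\phi_\mu(w)=0,$$ whose distance from $\xi$ is on the order of $N^{-1}$. The points $w_{N,\xi}$, $\xi\in\Xi_N$, are understood to be defined for the $N$ under consideration.
   Formalization: "On the order of 1/N" is made precise as a/N ≤ |w_{N,ξ} − ξ| ≤ b/N (in the coordinate w) for arbitrary fixed 0 < a < b, and C may depend on a, b and μ as well as α, δ, ε, r; a constant independent of a, b does not exist. *)

theory Defs
  imports "HOL-Probability.Probability" "HOL-Computational_Algebra.Polynomial"
begin

text \<open>
  The Riemann sphere is the unit sphere of \<open>\<real>\<^sup>3\<close>. Stereographic projection from \<open>zero_pt\<close> is the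
  coordinate \<open>w\<close>, centred at the antipode \<open>infty_pt\<close>; so \<open>w = 0\<close> is \<open>infty_pt\<close>, the pole of
  polynomials, and \<open>w = \<infinity>\<close> is \<open>zero_pt\<close>.
\<close>

definition S2 :: "(real ^ 3) set" where
  "S2 = sphere 0 1"

definition zero_pt :: "real ^ 3" where
  "zero_pt = vector [0, 0, 1]"

definition infty_pt :: "real ^ 3" where
  "infty_pt = - zero_pt"

text \<open>Meaningful only away from \<open>zero_pt\<close>, where it returns \<open>0\<close> by the convention \<open>x / 0 = 0\<close>.\<close>

definition wcoord :: "real ^ 3 \<Rightarrow> complex" where
  "wcoord x = Complex (x $ 1) (x $ 2) / of_real (1 - x $ 3)"

definition dist_S2 :: "real ^ 3 \<Rightarrow> real ^ 3 \<Rightarrow> real" where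
  "dist_S2 x y = arccos (x \<bullet> y)"

definition geodesic_circle :: "real ^ 3 \<Rightarrow> real \<Rightarrow> (real ^ 3) set" where
  "geodesic_circle c \<rho> = {x \<in> S2. dist_S2 c x = \<rho>}"

definition geodesic_disk :: "real ^ 3 \<Rightarrow> real \<Rightarrow> (real ^ 3) set" where
  "geodesic_disk c \<rho> = {x \<in> S2. dist_S2 c x < \<rho>}"

text \<open>
  The rotation-invariant probability measure, as the law of \<open>x / \<bar>x\<bar>\<close> for \<open>x\<close> uniform in the unit
  ball of \<open>\<real>\<^sup>3\<close>; see \<open>prob_space_uniform_S2\<close> and \<open>uniform_S2_rotation_invariant\<close> below.
\<close>

definition uniform_S2 :: "(real ^ 3) measure" where
  "uniform_S2 = restrict_space (distr (uniform_measure lborel (ball 0 1)) borel sgn) S2"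

definition has_bounded_density :: "(real ^ 3) measure \<Rightarrow> bool" where
  "has_bounded_density \<mu> \<longleftrightarrow>
     (\<exists>f B. f \<in> borel_measurable uniform_S2 \<and> (\<forall>x\<in>S2. 0 \<le> f x \<and> f x \<le> B) \<and>
        \<mu> = density uniform_S2 (\<lambda>x. ennreal (f x)))"

definition \<phi> :: "(real ^ 3) measure \<Rightarrow> complex \<Rightarrow> complex" where
  "\<phi> \<mu> w = (LINT \<zeta>:S2 - {zero_pt}|\<mu>. 1 / (w - wcoord \<zeta>))"

text \<open>
  For \<open>\<mu>\<close> with bounded density the integral \<open>\<phi> \<mu> w\<close> converges at every finite \<open>w\<close>, so
  \<open>-1 / w + \<phi> \<mu> w\<close> is infinite only at \<open>w = 0\<close>; its value at \<open>w = \<infinity>\<close> is \<open>0\<close>.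
\<close>

definition S_exc :: "(real ^ 3) measure \<Rightarrow> (real ^ 3) set" where
  "S_exc \<mu> = {zero_pt, infty_pt} \<union>
     {x \<in> S2 - {zero_pt, infty_pt}. - (1 / wcoord x) + \<phi> \<mu> (wcoord x) = 0}"

text \<open>
  Averaged critical points of \<open>w\<^sup>-\<^sup>N (w - \<xi>) \<Prod>(w - \<xi>\<^sub>j)\<close> whose distance from \<open>\<xi>\<close>, in the coordinate
  \<open>w\<close>, is of order \<open>1 / N\<close>; \<open>a\<close> and \<open>b\<close> are the constants of that order of magnitude.
\<close>

definition is_avg_critical_pt ::
    "(real ^ 3) measure \<Rightarrow> real \<Rightarrow> real \<Rightarrow> nat \<Rightarrow> real ^ 3 \<Rightarrow> real ^ 3 \<Rightarrow> bool" where
  "is_avg_critical_pt \<mu> a b N \<xi> x \<longleftrightarrow>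
     x \<in> S2 - {zero_pt, infty_pt} \<and> x \<noteq> \<xi> \<and>
     - (of_nat N / wcoord x) + 1 / (wcoord x - wcoord \<xi>)
       + (of_nat N - 1) * \<phi> \<mu> (wcoord x) = 0 \<and>
     a / real N \<le> cmod (wcoord x - wcoord \<xi>) \<and> cmod (wcoord x - wcoord \<xi>) \<le> b / real N"

definition avg_critical_pt_defined ::
    "(real ^ 3) measure \<Rightarrow> real \<Rightarrow> real \<Rightarrow> nat \<Rightarrow> real ^ 3 \<Rightarrow> bool" where
  "avg_critical_pt_defined \<mu> a b N \<xi> \<longleftrightarrow> (\<exists>!x. is_avg_critical_pt \<mu> a b N \<xi> x)"

definition avg_critical_pt ::
    "(real ^ 3) measure \<Rightarrow> real \<Rightarrow> real \<Rightarrow> nat \<Rightarrow> real ^ 3 \<Rightarrow> real ^ 3" where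
  "avg_critical_pt \<mu> a b N \<xi> = (THE x. is_avg_critical_pt \<mu> a b N \<xi> x)"

text \<open>
  Polynomials are written in the variable \<open>z = 1 / w\<close>, in which they are genuine polynomials. The
  factor with zero \<open>x\<close> is \<open>1 - \<zeta> z = w\<^sup>-\<^sup>1 (w - \<zeta>)\<close> with \<open>\<zeta> = wcoord x\<close>, and \<open>z\<close> when \<open>x = zero_pt\<close>;
  compare \<open>in_wcoord_prod_linear_factor\<close>. This fixes one representative in projective space.
\<close>

definition linear_factor :: "real ^ 3 \<Rightarrow> complex poly" where
  "linear_factor x = (if x = zero_pt then [:0, 1:] else [:1, - wcoord x:])"

definition in_wcoord :: "complex poly \<Rightarrow> complex \<Rightarrow> complex" where
  "in_wcoord p w = poly p (1 / w)"

text \<open>At \<open>zero_pt\<close>, where \<open>w = \<infinity>\<close>, the derivative is taken in the local coordinate \<open>z = 1 / w\<close>.\<close>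

definition is_critical_pt :: "complex poly \<Rightarrow> real ^ 3 \<Rightarrow> bool" where
  "is_critical_pt p x \<longleftrightarrow> x \<in> S2 - {infty_pt} \<and>
     (if x = zero_pt then poly (pderiv p) 0 = 0 else deriv (in_wcoord p) (wcoord x) = 0)"

text \<open>The zeros are the elements of \<open>X\<close> and \<open>\<zeta> 0, \<dots>, \<zeta> (m - 1)\<close>.\<close>

definition poly_with_zeros :: "(real ^ 3) set \<Rightarrow> nat \<Rightarrow> (nat \<Rightarrow> real ^ 3) \<Rightarrow> complex poly" where
  "poly_with_zeros X m \<zeta> = (\<Prod>\<xi>\<in>X. linear_factor \<xi>) * (\<Prod>j<m. linear_factor (\<zeta> j))"

lemma in_wcoord_prod_linear_factor:
  assumes "w \<noteq> 0" "\<And>j. j < N \<Longrightarrow> \<zeta> j \<noteq> zero_pt"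
  shows "in_wcoord (\<Prod>j<N. linear_factor (\<zeta> j)) w = (\<Prod>j<N. w - wcoord (\<zeta> j)) / w ^ N"
proof -
  have "in_wcoord (\<Prod>j<N. linear_factor (\<zeta> j)) w = (\<Prod>j<N. (w - wcoord (\<zeta> j)) / w)"
    unfolding in_wcoord_def poly_prod using assms
    by (intro prod.cong) (auto simp: linear_factor_def field_simps)
  then show ?thesis by (simp add: prod_dividef)
qed

lemma uniform_ball_prob:
  "prob_space (uniform_measure lborel (ball 0 1 :: (real ^ 3) set))"
proof (rule prob_space_uniform_measure)
  show "emeasure lborel (ball 0 1 :: (real ^ 3) set) \<noteq> 0"
    using content_ball_pos[of 1 "0 :: real ^ 3"]
    by (metis measure_eq_emeasure_eq_ennreal less_irrefl ennreal_0 order_refl zero_less_one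
        measure_completion sets_lborel borel_open open_ball)
  show "emeasure lborel (ball 0 1 :: (real ^ 3) set) \<noteq> \<infinity>"
    using emeasure_lborel_ball_finite[of "0 :: real ^ 3" 1] by simp
qed

lemma S2_borel [measurable, simp]: "S2 \<in> sets borel"
  unfolding S2_def by simp

lemma measurable_sgn_ball [measurable]:
  "sgn \<in> measurable (uniform_measure lborel (ball 0 1 :: (real ^ 3) set)) borel"
proof -
  have "(\<lambda>x :: real ^ 3. x /\<^sub>R norm x) \<in> borel_measurable borel" by measurable
  then show ?thesis by (simp add: sgn_div_norm[abs_def])
qed

lemma sets_uniform_S2 [simp]: "sets uniform_S2 = sets (restrict_space borel S2)"
  unfolding uniform_S2_def by (rule sets_restrict_space_cong) simp

lemma space_uniform_S2 [simp]: "space uniform_S2 = S2"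
  unfolding uniform_S2_def by (simp add: space_restrict_space)

lemma emeasure_uniform_S2:
  assumes "A \<in> sets uniform_S2"
  shows "emeasure uniform_S2 A = emeasure (uniform_measure lborel (ball 0 1)) (sgn -` A)"
proof -
  from assms have A: "A \<subseteq> S2" "A \<in> sets borel"
    by (auto simp: sets_restrict_space_iff)
  then show ?thesis unfolding uniform_S2_def
    by (subst emeasure_restrict_space) (auto simp: emeasure_distr)
qed

lemma prob_space_uniform_S2: "prob_space uniform_S2"
proof
  let ?U = "uniform_measure lborel (ball 0 1 :: (real ^ 3) set)"
  interpret U: prob_space ?U by (rule uniform_ball_prob)
  have eq: "sgn -` S2 = UNIV - {0 :: real ^ 3}"
    by (auto simp: S2_def norm_sgn)
  have "emeasure ?U (sgn -` S2) = 1"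
    unfolding eq
  proof (subst U.emeasure_eq_1_AE)
    show "AE x in ?U. x \<in> UNIV - {0}"
      by (rule AE_uniform_measureI) (auto intro: AE_mp[OF AE_lborel_singleton[of 0]])
  qed auto
  then show "emeasure uniform_S2 (space uniform_S2) = 1"
    using emeasure_uniform_S2[OF sets.top] by simp
qed

lemma emeasure_lborel_orthogonal_vimage:
  fixes T :: "real ^ 3 \<Rightarrow> real ^ 3"
  assumes T: "orthogonal_transformation T" and A: "A \<in> sets borel" "A \<subseteq> ball 0 1"
  shows "emeasure lborel (T -` A) = emeasure lborel A"
proof -
  have "continuous_on UNIV T"
    using T by (simp add: linear_continuous_on linear_linear orthogonal_transformation_linear)
  then have "T \<in> borel_measurable borel" by (rule borel_measurable_continuous_onI)
  from measurable_sets[OF this A(1)] have B: "T -` A \<in> sets borel" by simp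
  have sub: "T -` A \<subseteq> ball 0 1"
    using A(2) T by (auto simp: orthogonal_transformation_norm[OF T] subset_eq)
  have fin: "C \<in> lmeasurable" if "C \<in> sets borel" "C \<subseteq> ball 0 1" for C :: "(real ^ 3) set"
    using that by (intro bounded_set_imp_lmeasurable) (auto intro: bounded_subset[OF bounded_ball])
  have im: "T ` (T -` A) = A"
    using orthogonal_transformation_surj[OF T] by (rule surj_image_vimage_eq)
  have "measure lebesgue A = measure lebesgue (T -` A)"
    using measure_orthogonal_image[OF T fin[OF B sub]] im by simp
  then have "emeasure lebesgue A = emeasure lebesgue (T -` A)"
    using fin[OF A] fin[OF B sub] by (simp add: emeasure_eq_measure2)
  then show ?thesis using A(1) B by simp
qed

lemma uniform_S2_rotation_invariant:
  assumes T: "orthogonal_transformation T"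
  shows "distr uniform_S2 uniform_S2 T = uniform_S2"
proof (rule measure_eqI)
  show "sets (distr uniform_S2 uniform_S2 T) = sets uniform_S2" by simp
next
  fix A assume "A \<in> sets (distr uniform_S2 uniform_S2 T)"
  then have A: "A \<in> sets uniform_S2" by simp
  then have A': "A \<subseteq> S2" "A \<in> sets borel"
    by (auto simp: sets_restrict_space_iff)
  have "continuous_on UNIV T"
    using T by (simp add: linear_continuous_on linear_linear orthogonal_transformation_linear)
  then have Tb: "T \<in> borel_measurable borel" by (rule borel_measurable_continuous_onI)
  have TS: "T x \<in> S2 \<longleftrightarrow> x \<in> S2" for x
    by (simp add: S2_def orthogonal_transformation_norm[OF T])
  have Tm: "T \<in> measurable uniform_S2 uniform_S2"
  proof -
    have "T \<in> measurable (restrict_space borel S2) (restrict_space borel S2)"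
      by (rule measurable_restrict_space3[OF Tb]) (auto simp: TS)
    then show ?thesis using measurable_cong_sets[OF sets_uniform_S2 sets_uniform_S2] by blast
  qed
  have lin: "T (sgn x) = sgn (T x)" for x
    using orthogonal_transformation_linear[OF T]
    by (simp add: sgn_div_norm linear_scale orthogonal_transformation_norm[OF T])
  have sm: "sgn -` A \<in> sets (borel :: (real ^ 3) measure)"
    using measurable_sets[OF measurable_sgn_ball A'(2)] by simp
  have TA: "T -` A \<inter> S2 = T -` A" using A'(1) TS by auto
  have TAs: "T -` A \<in> sets uniform_S2"
    using measurable_sets[OF Tm A] TA by simp
  have "T -` (ball 0 1 \<inter> sgn -` A) = ball 0 1 \<inter> sgn -` (T -` A)"
    by (auto simp: lin orthogonal_transformation_norm[OF T])
  then have *: "emeasure lborel (ball 0 1 \<inter> sgn -` (T -` A)) = emeasure lborel (ball 0 1 \<inter> sgn -` A)"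
    using emeasure_lborel_orthogonal_vimage[OF T, of "ball 0 1 \<inter> sgn -` A"] sm by simp
  have sm2: "sgn -` (T -` A) \<in> sets (borel :: (real ^ 3) measure)"
    using measurable_sets[OF measurable_sgn_ball, of "T -` A"] TAs
    by (simp add: sets_restrict_space_iff)
  have "emeasure (distr uniform_S2 uniform_S2 T) A = emeasure uniform_S2 (T -` A)"
    using A TA by (simp add: emeasure_distr[OF Tm])
  also have "\<dots> = emeasure uniform_S2 A"
    using * sm sm2 by (simp add: emeasure_uniform_S2[OF A] emeasure_uniform_S2[OF TAs])
  finally show "emeasure (distr uniform_S2 uniform_S2 T) A = emeasure uniform_S2 A" .
qed

end

theory Submission
  imports Defs
begin

text \<open>
  Put \<open>d = w\<^sub>N\<^sub>,\<^sub>\<xi> - \<xi>\<close>. Critical points \<open>w\<close> near \<open>\<xi>\<close> are the zeros of \<open>1 + (w - \<xi>) H(w)\<close>, where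
  \<open>H(w) = - N / w + \<Sum> 1 / (w - \<zeta>)\<close> runs over all zeros other than \<open>\<xi>\<close>, and \<open>- 1 / d\<close> is the mean of
  \<open>H\<close> at \<open>w\<^sub>N\<^sub>,\<^sub>\<xi>\<close>, up to a relative error that tends to \<open>0\<close>. So these zeros are the fixed points of
  \<open>w \<mapsto> w\<^sub>N\<^sub>,\<^sub>\<xi> + d (w - \<xi>) (H(w) + 1 / d)\<close>, which is a contraction of the disk into itself as soon as
  \<open>H + 1 / d\<close> is at most \<open>\<eta> N\<close> there, with Lipschitz constant at most \<open>\<eta> N\<^sup>2\<close>, for a small \<open>\<eta>\<close>.
  Since the difference of two terms \<open>1 / (w - \<zeta>)\<close> is controlled by \<open>1 / |w\<^sub>N\<^sub>,\<^sub>\<xi> - \<zeta>|\<^sup>2\<close>, this only requires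
  estimates at the single point \<open>w\<^sub>N\<^sub>,\<^sub>\<xi>\<close>. The density bound makes \<open>|w - \<zeta>|\<^sup>-\<^sup>p\<close> integrable for \<open>p < 2\<close>,
  uniformly in \<open>w\<close>, so by the Chebyshev and Markov inequalities the estimates fail with probability
  \<open>O(N\<^sup>\<kappa>\<^sup>-\<^sup>1)\<close> for every \<open>\<kappa> > 0\<close>; a union bound over at most \<open>N\<^sup>\<alpha>\<close> points \<open>\<xi>\<close> with
  \<open>\<kappa> = 1 - \<alpha> - \<delta>\<close> concludes. The other points of \<open>\<Xi>\<^sub>N\<close> contribute \<open>O(\<surd>n / s) = o(N)\<close> by packing, where
  \<open>s\<close> is their separation.
\<close>

section \<open>Stereographic projection\<close>

definition inv_stereo :: "complex \<Rightarrow> real ^ 3" where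
  "inv_stereo w = (1 / (1 + (cmod w)\<^sup>2)) *\<^sub>R vector [2 * Re w, 2 * Im w, (cmod w)\<^sup>2 - 1]"

lemma inner_real_3: "(x :: real ^ 3) \<bullet> y = x $ 1 * y $ 1 + x $ 2 * y $ 2 + x $ 3 * y $ 3"
  by (simp add: inner_vec_def sum_3)

lemma S2_iff: "x \<in> S2 \<longleftrightarrow> (x $ 1)\<^sup>2 + (x $ 2)\<^sup>2 + (x $ 3)\<^sup>2 = 1"
  by (simp add: S2_def norm_eq_1 inner_real_3 power2_eq_square)

lemma zero_pt_S2: "zero_pt \<in> S2"
  by (simp add: S2_iff zero_pt_def)

lemma S2_third_coord_less_1:
  assumes "x \<in> S2" "x \<noteq> zero_pt"
  shows "x $ 3 < 1"
proof -
  have 1: "(x $ 1)\<^sup>2 + (x $ 2)\<^sup>2 + (x $ 3)\<^sup>2 = 1" using assms by (simp add: S2_iff)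
  then have "(x $ 3)\<^sup>2 \<le> 1"
    using zero_le_power2[of "x $ 1"] zero_le_power2[of "x $ 2"] by linarith
  then have "x $ 3 \<le> 1" using abs_le_square_iff[of "x $ 3" 1] by simp
  moreover have "x $ 3 \<noteq> 1"
  proof
    assume a: "x $ 3 = 1"
    with 1 have "(x $ 1)\<^sup>2 + (x $ 2)\<^sup>2 = 0" by simp
    then have "x $ 1 = 0" "x $ 2 = 0" by (simp_all add: sum_power2_eq_zero_iff)
    with a have "x = zero_pt" by (simp add: vec_eq_iff zero_pt_def forall_3)
    with assms show False by simp
  qed
  ultimately show ?thesis by simp
qed

lemma S2_third_coord_ge: "x \<in> S2 \<Longrightarrow> -1 \<le> x $ 3"
  using component_le_norm_cart[of x 3] by (auto simp: S2_def)

lemma cmod_wcoord: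
  assumes "x \<in> S2" "x \<noteq> zero_pt"
  shows "1 + (cmod (wcoord x))\<^sup>2 = 2 / (1 - x $ 3)"
proof -
  have 1: "(x $ 1)\<^sup>2 + (x $ 2)\<^sup>2 = (1 - x $ 3) * (1 + x $ 3)"
    using assms by (simp add: S2_iff power2_eq_square algebra_simps)
  have 2: "1 - x $ 3 > 0" using S2_third_coord_less_1[OF assms] by simp
  have "(cmod (wcoord x))\<^sup>2 = ((x $ 1)\<^sup>2 + (x $ 2)\<^sup>2) / (1 - x $ 3)\<^sup>2"
    by (simp add: wcoord_def norm_divide power_divide cmod_power2)
  also have "\<dots> = (1 + x $ 3) / (1 - x $ 3)"
    unfolding 1 using 2 by (simp add: power2_eq_square)
  finally show ?thesis using 2 by (simp add: field_simps)
qed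

text \<open>Chordal distance in stereographic coordinates: \<open>1 - x $ 3\<close> equals
  \<open>2 / (1 + |w|^2)\<close>, the conformal factor at \<open>x\<close>. Both sides reduce to the
  same polynomial in \<open>p\<close>, \<open>q\<close> and the horizontal inner product
  \<open>c\<close>.\<close>

lemma norm_diff_stereographic:
  assumes x: "x \<in> S2" "x \<noteq> zero_pt" and y: "y \<in> S2" "y \<noteq> zero_pt"
  shows "(norm (x - y))\<^sup>2 = (cmod (wcoord x - wcoord y))\<^sup>2 * ((1 - x $ 3) * (1 - y $ 3))"
proof -
  define p where "p = 1 - x $ 3"
  define q where "q = 1 - y $ 3"
  have p: "p > 0" using S2_third_coord_less_1[OF x] by (simp add: p_def)
  have q: "q > 0" using S2_third_coord_less_1[OF y] by (simp add: q_def)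
  have x1: "(x $ 1)\<^sup>2 + (x $ 2)\<^sup>2 = p * (2 - p)"
    using x by (simp add: S2_iff p_def power2_eq_square algebra_simps)
  have y1: "(y $ 1)\<^sup>2 + (y $ 2)\<^sup>2 = q * (2 - q)"
    using y by (simp add: S2_iff q_def power2_eq_square algebra_simps)
  define c where "c = x $ 1 * y $ 1 + x $ 2 * y $ 2"
  have "(norm (x - y))\<^sup>2 = (x - y) \<bullet> (x - y)" by (simp add: power2_norm_eq_inner)
  also have "\<dots> = ((x $ 1)\<^sup>2 + (x $ 2)\<^sup>2) + ((y $ 1)\<^sup>2 + (y $ 2)\<^sup>2) - 2 * c + (p - q)\<^sup>2"
    by (simp add: inner_real_3 p_def q_def c_def power2_eq_square algebra_simps)
  also have "\<dots> = 2 * p + 2 * q - 2 * c - 2 * p * q"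
    unfolding x1 y1 by (simp add: power2_eq_square algebra_simps)
  finally have L: "(norm (x - y))\<^sup>2 = 2 * p + 2 * q - 2 * c - 2 * p * q" .
  have "(cmod (wcoord x - wcoord y))\<^sup>2 = (x $ 1 / p - y $ 1 / q)\<^sup>2 + (x $ 2 / p - y $ 2 / q)\<^sup>2"
    by (simp add: wcoord_def p_def q_def cmod_power2)
  also have "\<dots> = ((x $ 1)\<^sup>2 + (x $ 2)\<^sup>2) / p\<^sup>2 + ((y $ 1)\<^sup>2 + (y $ 2)\<^sup>2) / q\<^sup>2 - 2 * c / (p * q)"
    using p q by (simp add: c_def power2_eq_square field_simps)
  also have "\<dots> = (2 - p) / p + (2 - q) / q - 2 * c / (p * q)"
    unfolding x1 y1 using p q by (simp add: power2_eq_square)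
  finally have R: "(cmod (wcoord x - wcoord y))\<^sup>2 = (2 - p) / p + (2 - q) / q - 2 * c / (p * q)" .
  have "(cmod (wcoord x - wcoord y))\<^sup>2 * (p * q) = 2 * p + 2 * q - 2 * c - 2 * p * q"
    unfolding R using p q by (simp add: field_simps)
  with L show ?thesis by (simp add: p_def q_def)
qed

text \<open>Both conformal factors are at most 2. Hence \<open>1 / |w - \<zeta>|\<close> is at most
  twice the inverse chord, uniformly in \<open>w\<close>, so integrals over the sphere control those
  in the coordinate.\<close>

lemma norm_diff_le_wcoord:
  assumes "x \<in> S2" "x \<noteq> zero_pt" "y \<in> S2" "y \<noteq> zero_pt"
  shows "norm (x - y) \<le> 2 * cmod (wcoord x - wcoord y)"
proof -
  have "(1 - x $ 3) * (1 - y $ 3) \<le> 2 * 2"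
    using assms S2_third_coord_less_1 S2_third_coord_ge[of x] S2_third_coord_ge[of y] by (intro mult_mono) (auto simp: less_imp_le)
  then have "(norm (x - y))\<^sup>2 \<le> (cmod (wcoord x - wcoord y))\<^sup>2 * 4"
    unfolding norm_diff_stereographic[OF assms] by (intro mult_left_mono) auto
  then have "(norm (x - y))\<^sup>2 \<le> (2 * cmod (wcoord x - wcoord y))\<^sup>2"
    by (simp add: power_mult_distrib)
  then show ?thesis by (rule power2_le_imp_le) simp
qed

lemma inv_stereo_nth:
  "inv_stereo w $ 1 = 2 * Re w / (1 + (cmod w)\<^sup>2)"
  "inv_stereo w $ 2 = 2 * Im w / (1 + (cmod w)\<^sup>2)"
  "inv_stereo w $ 3 = ((cmod w)\<^sup>2 - 1) / (1 + (cmod w)\<^sup>2)"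
  by (simp_all add: inv_stereo_def)

lemma one_plus_cmod_sq_pos: "1 + (cmod w)\<^sup>2 > 0"
  by (simp add: add_pos_nonneg)

lemma one_minus_inv_stereo_3: "1 - inv_stereo w $ 3 = 2 / (1 + (cmod w)\<^sup>2)"
  using one_plus_cmod_sq_pos[of w] by (simp add: inv_stereo_nth field_simps)

lemma inv_stereo_S2: "inv_stereo w \<in> S2"
proof -
  define m where "m = (cmod w)\<^sup>2"
  have m: "1 + m > 0" using one_plus_cmod_sq_pos[of w] by (simp add: m_def)
  have "(inv_stereo w $ 1)\<^sup>2 + (inv_stereo w $ 2)\<^sup>2 = 4 * ((Re w)\<^sup>2 + (Im w)\<^sup>2) / (1 + m)\<^sup>2"
    by (simp add: inv_stereo_nth m_def power_divide power_mult_distrib add_divide_distrib)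
  also have "\<dots> = 4 * m / (1 + m)\<^sup>2" by (simp add: m_def cmod_power2)
  finally have "(inv_stereo w $ 1)\<^sup>2 + (inv_stereo w $ 2)\<^sup>2 + (inv_stereo w $ 3)\<^sup>2
      = (4 * m + (m - 1)\<^sup>2) / (1 + m)\<^sup>2"
    by (simp add: inv_stereo_nth(3) m_def power_divide add_divide_distrib)
  also have "4 * m + (m - 1)\<^sup>2 = (1 + m)\<^sup>2" by (simp add: power2_eq_square algebra_simps)
  finally show ?thesis using m by (simp add: S2_iff)
qed

lemma inv_stereo_neq_zero_pt: "inv_stereo w \<noteq> zero_pt"
proof
  assume "inv_stereo w = zero_pt"
  then have "1 - inv_stereo w $ 3 = 0" by (simp add: zero_pt_def)
  then show False using one_plus_cmod_sq_pos[of w] unfolding one_minus_inv_stereo_3 by simp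
qed

lemma wcoord_inv_stereo [simp]: "wcoord (inv_stereo w) = w"
  unfolding wcoord_def one_minus_inv_stereo_3 using one_plus_cmod_sq_pos[of w]
  by (simp add: inv_stereo_nth complex_eq_iff del: of_real_add of_real_divide)

lemma wcoord_eq_iff:
  assumes "x \<in> S2" "x \<noteq> zero_pt" "y \<in> S2" "y \<noteq> zero_pt"
  shows "wcoord x = wcoord y \<longleftrightarrow> x = y"
  using norm_diff_stereographic[OF assms] by auto

lemma inv_stereo_wcoord: "x \<in> S2 \<Longrightarrow> x \<noteq> zero_pt \<Longrightarrow> inv_stereo (wcoord x) = x"
  using wcoord_eq_iff[of "inv_stereo (wcoord x)" x] by (simp add: inv_stereo_S2 inv_stereo_neq_zero_pt)

lemma wcoord_eq_0_iff:
  assumes "x \<in> S2" "x \<noteq> zero_pt"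
  shows "wcoord x = 0 \<longleftrightarrow> x = infty_pt"
proof -
  have i: "infty_pt \<in> S2" "infty_pt \<noteq> zero_pt" "wcoord infty_pt = 0"
    by (simp_all add: S2_iff infty_pt_def zero_pt_def wcoord_def vec_eq_iff forall_3 complex_eq_iff)
  show ?thesis using wcoord_eq_iff[OF assms i(1,2)] i(3) by simp
qed

lemma continuous_on_inv_stereo: "continuous_on A inv_stereo"
proof -
  have "continuous_on A (\<lambda>w. inv_stereo w $ i)" for i
  proof -
    have ne: "1 + (cmod w)\<^sup>2 \<noteq> 0" for w using one_plus_cmod_sq_pos[of w] by simp
    have "i = 1 \<or> i = 2 \<or> i = 3" using exhaust_3 by blast
    then show ?thesis
      by (elim disjE) (auto simp: inv_stereo_nth ne intro!: continuous_intros)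
  qed
  then have "continuous_on A (\<lambda>w. \<chi> i. inv_stereo w $ i)" by (intro continuous_on_vec_lambda)
  then show ?thesis by simp
qed

section \<open>Geodesic disks in the coordinate \<open>w\<close>\<close>

lemma dist_S2_less_iff:
  assumes "c \<in> S2" "x \<in> S2" "0 \<le> \<rho>" "\<rho> \<le> pi"
  shows "dist_S2 c x < \<rho> \<longleftrightarrow> cos \<rho> < c \<bullet> x"
proof -
  have "\<bar>c \<bullet> x\<bar> \<le> 1"
    using Cauchy_Schwarz_ineq2[of c x] assms(1,2) by (simp add: S2_def)
  then have b: "-1 \<le> c \<bullet> x" "c \<bullet> x \<le> 1" by auto
  have "dist_S2 c x < \<rho> \<longleftrightarrow> cos \<rho> < cos (arccos (c \<bullet> x))"
    unfolding dist_S2_def using assms arccos_lbound[OF b] arccos_ubound[OF b]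
    by (intro cos_mono_less_eq[symmetric]) auto
  then show ?thesis using b by simp
qed

lemma norm_diff_S2: 
  assumes "c \<in> S2" "x \<in> S2"
  shows "(norm (c - x))\<^sup>2 = 2 - 2 * (c \<bullet> x)"
proof -
  have "c \<bullet> c = 1" "x \<bullet> x = 1" using assms by (simp_all add: S2_def dot_square_norm)
  then show ?thesis by (simp add: power2_norm_eq_inner inner_diff inner_commute)
qed

lemma open_wcoord_geodesic_disk:
  assumes "c \<in> S2" "0 \<le> \<rho>" "\<rho> \<le> pi"
  shows "open {w. inv_stereo w \<in> geodesic_disk c \<rho>}"
proof -
  have "{w. inv_stereo w \<in> geodesic_disk c \<rho>} = {w. cos \<rho> < c \<bullet> inv_stereo w}"
    using assms by (auto simp: geodesic_disk_def inv_stereo_S2 dist_S2_less_iff)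
  moreover have "open {w. cos \<rho> < c \<bullet> inv_stereo w}"
    by (intro open_Collect_less continuous_intros continuous_on_inv_stereo)
  ultimately show ?thesis by simp
qed

lemma cos_ge_one_minus: "1 - x\<^sup>2 / 2 \<le> cos (x :: real)"
proof -
  have "\<bar>sin (x/2)\<bar> \<le> \<bar>x/2\<bar>" by (rule abs_sin_x_le_abs_x) 
  then have "(sin (x/2))\<^sup>2 \<le> (x/2)\<^sup>2" by (simp only: abs_le_square_iff)
  moreover have "cos x = 1 - 2 * (sin (x/2))\<^sup>2" using cos_double_sin[of "x/2"] by simp
  ultimately show ?thesis by (simp add: power_divide)
qed

lemma cos_le_one_minus: 
  assumes "0 \<le> x" "x \<le> (1::real)"
  shows "cos x \<le> 1 - x\<^sup>2 / 8"
proof -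
  \<comment> \<open>The derivative \<open>cos y - 1 / 2\<close> is nonnegative on
    \<open>[0, 1 / 2]\<close>, which gives \<open>sin (x / 2) \<ge> x / 4\<close>.\<close>
  have "(\<lambda>y. sin y - y / 2) 0 \<le> (\<lambda>y. sin y - y / 2) (x / 2)"
  proof (rule DERIV_nonneg_imp_nondecreasing[of 0 "x / 2"])
    fix y :: real assume y: "0 \<le> y" "y \<le> x / 2"
    have "y\<^sup>2 \<le> 1\<^sup>2" using y assms by (intro power_mono) auto
    then have "cos y - 1 / 2 \<ge> 0" using cos_ge_one_minus[of y] by simp
    moreover have "((\<lambda>y. sin y - y / 2) has_real_derivative cos y - 1 / 2) (at y)"
      by (auto intro!: derivative_eq_intros)
    ultimately show "\<exists>d. ((\<lambda>y::real. sin y - y / 2) has_real_derivative d) (at y) \<and> d \<ge> 0" by blast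
  qed (use assms in auto)
  then have "x / 4 \<le> sin (x/2)" by simp
  then have "(x/4)\<^sup>2 \<le> (sin (x/2))\<^sup>2" using assms by (intro power_mono) auto
  moreover have "cos x = 1 - 2 * (sin (x/2))\<^sup>2" using cos_double_sin[of "x/2"] by simp
  ultimately show ?thesis by (simp add: power_divide)
qed

text \<open>A planar distance below \<open>\<rho> / 4\<close> gives a chord below
  \<open>\<rho> / 2\<close>, hence an inner product above \<open>1 - \<rho>^2 / 8\<close>, which
  dominates \<open>cos \<rho>\<close>. This supplies the inner ball for the contraction.\<close>

lemma ball_subset_geodesic_disk:
  assumes c: "c \<in> S2" "c \<noteq> zero_pt" and \<rho>: "0 < \<rho>" "\<rho> \<le> 1"
    and w: "cmod (w - wcoord c) < \<rho> / 4"
  shows "inv_stereo w \<in> geodesic_disk c \<rho>"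
proof -
  let ?x = "inv_stereo w"
  have "norm (c - ?x) \<le> 2 * cmod (w - wcoord c)"
    using norm_diff_le_wcoord[OF c inv_stereo_S2[of w] inv_stereo_neq_zero_pt[of w]]
    by (simp add: norm_minus_commute)
  then have "norm (c - ?x) < \<rho> / 2" using w by simp
  then have "(norm (c - ?x))\<^sup>2 < (\<rho> / 2)\<^sup>2" by (intro power_strict_mono) auto
  then have "c \<bullet> ?x > 1 - \<rho>\<^sup>2 / 8"
    unfolding norm_diff_S2[OF c(1) inv_stereo_S2] by (simp add: power_divide)
  with cos_le_one_minus[of \<rho>] \<rho> have "cos \<rho> < c \<bullet> ?x" by simp
  then show ?thesis using \<rho> pi_gt3 c
    by (simp add: geodesic_disk_def inv_stereo_S2 dist_S2_less_iff)
qed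

text \<open>The opposite inclusion, for the outer ball of the contraction. A bound \<open>A\<close>
  on the centre enters because the coordinate stretches the sphere without limit near
  \<open>zero_pt\<close>; \<open>\<rho> * A \<le> 1\<close> keeps the disk away from that
  point.\<close>

lemma geodesic_disk_wcoord:
  assumes c: "c \<in> S2" "c \<noteq> zero_pt" and A: "0 < A" "1 + (cmod (wcoord c))\<^sup>2 \<le> A\<^sup>2"
    and \<rho>: "0 < \<rho>" "\<rho> \<le> 1" "\<rho> * A \<le> 1" and x: "x \<in> geodesic_disk c \<rho>"
  shows "x \<in> S2 \<and> x \<noteq> zero_pt \<and> cmod (wcoord x - wcoord c) < \<rho> * A\<^sup>2"
proof -
  have xS: "x \<in> S2" and "cos \<rho> < c \<bullet> x"
    using x \<rho> pi_gt3 c by (auto simp: geodesic_disk_def dist_S2_less_iff)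
  then have n: "(norm (c - x))\<^sup>2 < \<rho>\<^sup>2"
    using cos_ge_one_minus[of \<rho>] unfolding norm_diff_S2[OF c(1) xS] by simp
  have c3: "1 - c $ 3 = 2 / (1 + (cmod (wcoord c))\<^sup>2)"
    using cmod_wcoord[OF c] S2_third_coord_less_1[OF c] one_plus_cmod_sq_pos[of "wcoord c"] by (simp add: field_simps)
  have A2: "0 < A\<^sup>2" using A by simp
  have c3': "2 / A\<^sup>2 \<le> 1 - c $ 3"
    unfolding c3 using A A2 one_plus_cmod_sq_pos[of "wcoord c"] by (intro divide_left_mono) auto
  have rA: "\<rho>\<^sup>2 * A\<^sup>2 \<le> 1"
    using \<rho> A by (simp add: power_mult_distrib[symmetric] power_le_one)
  \<comment> \<open>The squared chord from \<open>c\<close> to \<open>zero_pt\<close> is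
    \<open>2 * (1 - c $ 3) \<ge> 4 / A^2\<close>, too long for the disk.\<close>
  have nz: "x \<noteq> zero_pt"
  proof
    assume "x = zero_pt"
    then have "(norm (c - x))\<^sup>2 = 2 * (1 - c $ 3)"
      unfolding norm_diff_S2[OF c(1) xS] by (simp add: zero_pt_def inner_real_3)
    with c3' n have "4 / A\<^sup>2 < \<rho>\<^sup>2" by simp
    then have "4 < \<rho>\<^sup>2 * A\<^sup>2" using A2 by (simp add: field_simps)
    with rA show False by simp
  qed
  define D where "D = (cmod (wcoord x - wcoord c))\<^sup>2"
  define m where "m = 1 + (cmod (wcoord x))\<^sup>2"
  have m: "m > 0" unfolding m_def by (rule one_plus_cmod_sq_pos)
  have x3: "1 - x $ 3 = 2 / m"
    using cmod_wcoord[OF xS nz] S2_third_coord_less_1[OF xS nz] m by (simp add: m_def field_simps)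
  have "D * ((2 / m) * (2 / A\<^sup>2)) \<le> D * ((1 - x $ 3) * (1 - c $ 3))"
    unfolding x3 using c3' m by (intro mult_left_mono) (auto simp: D_def)
  also have "\<dots> < \<rho>\<^sup>2"
    using n norm_diff_stereographic[OF xS nz c] by (simp add: D_def norm_minus_commute)
  finally have 1: "D * 4 < \<rho>\<^sup>2 * A\<^sup>2 * m" using m A2 by (simp add: field_simps)
  \<comment> \<open>The factor \<open>m\<close> at the unknown point \<open>x\<close> is itself
    bounded through \<open>D\<close>. Since \<open>\<rho>^2 * A^2 \<le> 1\<close>, the resulting
    \<open>2 * D\<close> is absorbed into the \<open>D * 4\<close> of fact \<open>1\<close>.\<close>
  have "cmod (wcoord x) \<le> cmod (wcoord x - wcoord c) + cmod (wcoord c)"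
    using norm_triangle_sub[of "wcoord x" "wcoord c"] by simp
  then have "(cmod (wcoord x))\<^sup>2 \<le> (cmod (wcoord x - wcoord c) + cmod (wcoord c))\<^sup>2"
    by (intro power_mono) auto
  also have "\<dots> \<le> 2 * D + 2 * (cmod (wcoord c))\<^sup>2"
    unfolding D_def using sum_squares_bound[of "cmod (wcoord x - wcoord c)" "cmod (wcoord c)"] by (simp add: power2_sum)
  finally have m2: "m \<le> 2 * D + 2 * A\<^sup>2" using A by (simp add: m_def)
  have D0: "D \<ge> 0" by (simp add: D_def)
  have "\<rho>\<^sup>2 * A\<^sup>2 * m \<le> \<rho>\<^sup>2 * A\<^sup>2 * (2 * D + 2 * A\<^sup>2)" using m2 by (intro mult_left_mono) auto
  also have "\<dots> = 2 * ((\<rho>\<^sup>2 * A\<^sup>2) * D) + 2 * (\<rho>\<^sup>2 * A\<^sup>2 * A\<^sup>2)" by (simp add: algebra_simps)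
  also have "\<dots> \<le> 2 * (1 * D) + 2 * (\<rho>\<^sup>2 * A\<^sup>2 * A\<^sup>2)" using rA D0 by (intro add_mono mult_left_mono mult_right_mono) auto
  finally have "D < \<rho>\<^sup>2 * A\<^sup>2 * A\<^sup>2" using 1 by simp
  then have "(cmod (wcoord x - wcoord c))\<^sup>2 < (\<rho> * A\<^sup>2)\<^sup>2"
    by (simp add: D_def power2_eq_square mult_ac)
  then have "cmod (wcoord x - wcoord c) < \<rho> * A\<^sup>2"
    by (rule power2_less_imp_less) (use \<rho> in auto)
  with xS nz show ?thesis by simp
qed

section \<open>Masses of spherical caps\<close>

definition cap :: "real ^ 3 \<Rightarrow> real \<Rightarrow> (real ^ 3) set" where
  "cap x t = {z \<in> S2. norm (x - z) \<le> t}"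

lemma cap_sets [measurable]: "cap x t \<in> sets uniform_S2"
proof -
  have "cap x t = S2 \<inter> cball x t" by (auto simp: cap_def dist_norm)
  then show ?thesis by (auto simp: sets_restrict_space)
qed

text \<open>By rotation invariance the cap may be centred at \<open>zero_pt\<close>. The part of the
  unit ball that projects radially to it then lies in a box with sides \<open>2 * t\<close>,
  \<open>2 * t\<close> and 2, of volume \<open>8 * t^2\<close>.\<close>

lemma emeasure_uniform_S2_cap:
  assumes x: "x \<in> S2" and t: "0 \<le> t"
  shows "emeasure uniform_S2 (cap x t) \<le> ennreal (8 / measure lborel (ball 0 1 :: (real ^ 3) set) * t\<^sup>2)"
proof -
  let ?V = "measure lborel (ball 0 1 :: (real ^ 3) set)"
  have V: "emeasure lborel (ball 0 1 :: (real ^ 3) set) = ennreal ?V"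
    by (intro emeasure_eq_ennreal_measure) (use emeasure_lborel_ball_finite[of "0 :: real ^ 3" 1] in auto)
  have V0: "?V > 0" using content_ball_pos[of 1 "0 :: real ^ 3"] by simp
  obtain T :: "real ^ 3 \<Rightarrow> real ^ 3" where T: "orthogonal_transformation T" "T zero_pt = x"
    using orthogonal_transformation_exists_1[of zero_pt x] x zero_pt_S2 by (auto simp: S2_def)
  have "continuous_on UNIV T"
    using T by (simp add: linear_continuous_on linear_linear orthogonal_transformation_linear)
  then have Tb: "T \<in> borel_measurable borel" by (rule borel_measurable_continuous_onI)
  have TS: "T y \<in> S2 \<longleftrightarrow> y \<in> S2" for y
    by (simp add: S2_def orthogonal_transformation_norm[OF T(1)])
  have "T \<in> measurable (restrict_space borel S2) (restrict_space borel S2)"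
    by (rule measurable_restrict_space3[OF Tb]) (auto simp: TS)
  then have Tm: "T \<in> measurable uniform_S2 uniform_S2"
    using measurable_cong_sets[OF sets_uniform_S2 sets_uniform_S2] by blast
  have Tn: "norm (x - T y) = norm (zero_pt - y)" for y
    using orthogonal_transformation_linear[OF T(1)] orthogonal_transformation_norm[OF T(1), of "zero_pt - y"]
    by (simp add: T(2)[symmetric] linear_diff)
  have pre: "T -` cap x t \<inter> space uniform_S2 = cap zero_pt t"
    by (auto simp: cap_def TS Tn)
  have "emeasure uniform_S2 (cap x t) = emeasure (distr uniform_S2 uniform_S2 T) (cap x t)"
    by (simp add: uniform_S2_rotation_invariant[OF T(1)])
  also have "\<dots> = emeasure uniform_S2 (cap zero_pt t)"
    by (subst emeasure_distr[OF Tm cap_sets]) (simp only: pre)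
  also have "\<dots> = emeasure (uniform_measure lborel (ball 0 1)) (sgn -` cap zero_pt t)"
    by (rule emeasure_uniform_S2[OF cap_sets])
  also have "\<dots> = emeasure lborel (ball 0 1 \<inter> sgn -` cap zero_pt t) / emeasure lborel (ball 0 1 :: (real ^ 3) set)"
  proof (rule emeasure_uniform_measure)
    have "cap zero_pt t \<in> sets borel" using cap_sets[of zero_pt t] by (auto simp: sets_restrict_space_iff)
    from measurable_sets[OF measurable_sgn_ball this]
    show "sgn -` cap zero_pt t \<in> sets lborel" by simp
  qed auto
  also have "\<dots> \<le> ennreal (8 * t\<^sup>2) / ennreal ?V"
  proof -
    \<comment> \<open>The horizontal components of \<open>sgn y\<close> are at most \<open>t\<close>
      because \<open>zero_pt\<close> has none, and scaling by \<open>norm y \<le> 1\<close> does not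
      enlarge them.\<close>
    have sub: "ball 0 1 \<inter> sgn -` cap zero_pt t \<subseteq> cbox (vector [-t, -t, -1]) (vector [t, t, 1])"
    proof
      fix y :: "real ^ 3" assume y: "y \<in> ball 0 1 \<inter> sgn -` cap zero_pt t"
      then have n: "norm y \<le> 1" "norm (zero_pt - sgn y) \<le> t" by (auto simp: cap_def)
      have ys: "y $ i = norm y * sgn y $ i" for i
        by (cases "y = 0") (auto simp: sgn_div_norm)
      have s: "\<bar>sgn y $ 1\<bar> \<le> t" "\<bar>sgn y $ 2\<bar> \<le> t"
        using component_le_norm_cart[of "zero_pt - sgn y" 1] component_le_norm_cart[of "zero_pt - sgn y" 2] n(2)
        by (auto simp: zero_pt_def)
      have "norm y * \<bar>sgn y $ 1\<bar> \<le> 1 * t" "norm y * \<bar>sgn y $ 2\<bar> \<le> 1 * t"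
        using mult_mono[OF n(1) s(1)] mult_mono[OF n(1) s(2)] by simp_all
      then have "\<bar>y $ 1\<bar> \<le> t" "\<bar>y $ 2\<bar> \<le> t"
        unfolding ys[of 1] ys[of 2] abs_mult by simp_all
      moreover have "\<bar>y $ 3\<bar> \<le> 1" using component_le_norm_cart[of y 3] n(1) by linarith
      ultimately show "y \<in> cbox (vector [-t, -t, -1]) (vector [t, t, 1])"
        by (auto simp: mem_box_cart forall_3)
    qed
    have "emeasure lborel (cbox (vector [-t, -t, -1]) (vector [t, t, 1]) :: (real ^ 3) set)
        = ennreal (measure lborel (cbox (vector [-t, -t, -1]) (vector [t, t, 1]) :: (real ^ 3) set))"
      by (intro emeasure_eq_ennreal_measure) (simp add: emeasure_lborel_cbox_eq)
    also have "measure lborel (cbox (vector [-t, -t, -1]) (vector [t, t, 1]) :: (real ^ 3) set) = 8 * t\<^sup>2"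
    proof -
      have "(vector [0, 0, 0] :: real ^ 3) \<in> cbox (vector [-t, -t, -1]) (vector [t, t, 1])"
        using t by (auto simp: mem_box_cart forall_3)
      then have "cbox (vector [-t, -t, -1]) (vector [t, t, 1]) \<noteq> ({} :: (real ^ 3) set)" by blast
      from content_cbox_cart[OF this] show ?thesis unfolding UNIV_3 by (simp add: power2_eq_square)
    qed
    finally have "emeasure lborel (ball 0 1 \<inter> sgn -` cap zero_pt t) \<le> ennreal (8 * t\<^sup>2)"
      using emeasure_mono[OF sub, of lborel] by simp
    then show ?thesis unfolding V by (rule divide_right_mono_ennreal)
  qed
  also have "\<dots> = ennreal (8 / ?V * t\<^sup>2)" using V0 by (simp add: divide_ennreal)
  finally show ?thesis .
qed

lemma measurable_wcoord [measurable]: "wcoord \<in> borel_measurable borel"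
proof -
  have "wcoord = (\<lambda>x. (complex_of_real (x $ 1) + \<i> * complex_of_real (x $ 2)) / of_real (1 - x $ 3))"
    by (auto simp: wcoord_def fun_eq_iff complex_eq_iff)
  also have "\<dots> \<in> borel_measurable borel" by measurable
  finally show ?thesis .
qed

text \<open>The Cauchy kernel \<open>1 / (w - \<zeta>)\<close> as a function on the whole sphere.
  The value 0 at \<open>zero_pt\<close> is its limit as \<open>\<zeta>\<close> tends to infinity,
  and makes the logarithmic derivative of \<open>linear_factor\<close> uniform in the zero.\<close>

definition recip :: "complex \<Rightarrow> real ^ 3 \<Rightarrow> complex" where
  "recip w z = (if z = zero_pt then 0 else 1 / (w - wcoord z))"

lemma measurable_recip [measurable]: "recip w \<in> borel_measurable borel"
  unfolding recip_def[abs_def] by measurable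

lemma cmod_recip: "cmod (recip w z) = (if z = zero_pt then 0 else 1 / cmod (w - wcoord z))"
  by (simp add: recip_def norm_divide)

section \<open>Moments of the Cauchy kernel\<close>

locale bounded_density = prob_space \<mu> for \<mu> :: "(real ^ 3) measure" +
  assumes bounded_density: "has_bounded_density \<mu>"
begin

lemma sets_\<mu> [simp, measurable_cong]: "sets \<mu> = sets (restrict_space borel S2)"
  using bounded_density by (auto simp: has_bounded_density_def)

lemma space_\<mu> [simp]: "space \<mu> = S2"
  using sets_eq_imp_space_eq[OF sets_\<mu>] by (simp add: space_restrict_space)

lemma borel_measurable_\<mu>: "f \<in> borel_measurable borel \<Longrightarrow> f \<in> borel_measurable \<mu>"
  using measurable_cong_sets[OF sets_\<mu> refl] measurable_restrict_space1 by blast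

lemma recip_measurable_\<mu> [measurable]: "recip w \<in> borel_measurable \<mu>"
  and wcoord_measurable_\<mu> [measurable]: "wcoord \<in> borel_measurable \<mu>"
  and ident_measurable_\<mu> [measurable]: "(\<lambda>z. z) \<in> borel_measurable \<mu>"
  by (intro borel_measurable_\<mu>; measurable)+

lemma cap_measure:
  obtains C where "C > 0" "\<And>x t. x \<in> S2 \<Longrightarrow> 0 \<le> t \<Longrightarrow> emeasure \<mu> (cap x t) \<le> ennreal (C * t\<^sup>2)"
proof -
  obtain f B where f: "f \<in> borel_measurable uniform_S2" "\<forall>x\<in>S2. 0 \<le> f x \<and> f x \<le> B"
    "\<mu> = density uniform_S2 (\<lambda>x. ennreal (f x))"
    using bounded_density by (auto simp: has_bounded_density_def)
  note [measurable] = f(1)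
  define D where "D = 8 / measure lborel (ball 0 1 :: (real ^ 3) set)"
  have D: "D > 0" using content_ball_pos[of 1 "0 :: real ^ 3"] by (simp add: D_def)
  define B' where "B' = max B 1"
  have B': "B' > 0" "\<And>x. x \<in> S2 \<Longrightarrow> f x \<le> B'" using f(2) by (auto simp: B'_def max.coboundedI1)
  show thesis
  proof
    show "B' * D > 0" using D B' by simp
    fix x t assume x: "x \<in> S2" and t: "0 \<le> (t :: real)"
    have "emeasure \<mu> (cap x t) = (\<integral>\<^sup>+z. ennreal (f z) * indicator (cap x t) z \<partial>uniform_S2)"
      unfolding f(3) by (rule emeasure_density) (use cap_sets in auto)
    also have "\<dots> \<le> (\<integral>\<^sup>+z. ennreal B' * indicator (cap x t) z \<partial>uniform_S2)"
      using B' by (intro nn_integral_mono mult_right_mono ennreal_leI) auto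
    also have "\<dots> = ennreal B' * emeasure uniform_S2 (cap x t)"
      by (rule nn_integral_cmult_indicator) (rule cap_sets)
    also have "\<dots> \<le> ennreal B' * ennreal (D * t\<^sup>2)"
      unfolding D_def using emeasure_uniform_S2_cap[OF x t] by (intro mult_left_mono) auto
    also have "\<dots> = ennreal (B' * D * t\<^sup>2)" using B' D by (simp add: ennreal_mult[symmetric] mult_ac)
    finally show "emeasure \<mu> (cap x t) \<le> ennreal (B' * D * t\<^sup>2)" .
  qed
qed

text \<open>Locates \<open>d\<close> in a dyadic shell: \<open>m\<close> is the first exponent with
  \<open>(1/2) ^ m < d\<close>, and \<open>k = m - 1\<close>.\<close>

lemma dyadic_bound:
  fixes d p :: real
  assumes "0 < d" "d \<le> 1" "0 < p"
  obtains k :: nat where "d \<le> (1/2) ^ k" "d powr - p \<le> 2 powr (p * (real k + 1))"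
proof -
  obtain n where n: "(1/2) ^ n < d" using real_arch_pow_inv[of d "1/2"] assms by auto
  define m where "m = (LEAST n. (1/2) ^ n < d)"
  have m: "(1/2) ^ m < d" unfolding m_def using n by (rule LeastI)
  have "m \<noteq> 0" using m assms by (cases m) auto
  then obtain k where k: "m = Suc k" by (cases m) auto
  have "\<not> (1/2) ^ k < d" using not_less_Least[of k "\<lambda>n. (1/2) ^ n < d"] k by (auto simp: m_def)
  moreover have "d powr - p \<le> 2 powr (p * (real k + 1))"
  proof -
    have "d powr - p \<le> ((1/2) ^ m) powr - p"
      using m assms by (intro powr_mono2') auto
    also have "(1/2 :: real) ^ m = 2 powr - real m" by (simp add: powr_minus powr_realpow power_one_over inverse_eq_divide)
    also have "(2 powr - real m :: real) powr - p = 2 powr (p * (real k + 1))"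
      unfolding powr_powr by (rule arg_cong[of _ _ "\<lambda>x. 2 powr x"]) (simp add: k algebra_simps)
    finally show ?thesis .
  qed
  ultimately show thesis using that[of k] by simp
qed

text \<open>The singularity is dominated by a sum over dyadic caps: height
  \<open>2 powr (p * (k + 1))\<close> against mass \<open>O(4^-k)\<close> gives a geometric series
  of ratio \<open>q = 2 powr (p - 2)\<close>, which is below 1 because \<open>p < 2\<close>. The
  summand 1 covers chords longer than 1.\<close>

lemma chordal_moment:
  assumes p: "0 < p" "p < 2"
  obtains M where "M > 0" "\<And>x. x \<in> S2 \<Longrightarrow> (\<integral>\<^sup>+z. ennreal (norm (x - z) powr - p) \<partial>\<mu>) \<le> ennreal M"
proof -
  obtain C where C: "C > 0" "\<And>x t. x \<in> S2 \<Longrightarrow> 0 \<le> t \<Longrightarrow> emeasure \<mu> (cap x t) \<le> ennreal (C * t\<^sup>2)"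
    using cap_measure by blast
  define q where "q = (2 :: real) powr (p - 2)"
  have q: "0 < q" "q < 1" using p by (auto simp: q_def powr_less_one)
  define M where "M = 1 + C * 2 powr p * (1 / (1 - q))"
  have M: "M > 0" using C q by (auto simp: M_def intro!: add_pos_nonneg)
  show thesis
  proof (rule that[OF M])
    fix x :: "real ^ 3" assume x: "x \<in> S2"
    let ?g = "\<lambda>k z. ennreal (2 powr (p * (real k + 1))) * indicator (cap x ((1/2) ^ k)) z"
    have "ennreal (norm (x - z) powr - p) \<le> 1 + (\<Sum>k. ?g k z)" if z: "z \<in> space \<mu>" for z
    proof -
      consider "norm (x - z) = 0" | "norm (x - z) > 1" | "0 < norm (x - z)" "norm (x - z) \<le> 1"
        using norm_ge_zero[of "x - z"] by linarith
      then show ?thesis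
      proof cases
        \<comment> \<open>Here \<open>0 powr - p = 0\<close>, so the singular point costs
          nothing.\<close>
        case 1 then show ?thesis by simp
      next
        case 2
        then have "norm (x - z) powr - p \<le> norm (x - z) powr 0" using p by (intro powr_mono) auto
        then have "norm (x - z) powr - p \<le> 1" using 2 by (auto split: if_splits)
        then have "ennreal (norm (x - z) powr - p) \<le> 1" by simp
        then show ?thesis by (simp add: add_increasing2)
      next
        case 3
        from dyadic_bound[OF 3 p(1)] obtain k :: nat where k: "norm (x - z) \<le> (1/2) ^ k"
          "norm (x - z) powr - p \<le> 2 powr (p * (real k + 1))" by blast
        then have "ennreal (norm (x - z) powr - p) \<le> ?g k z"
          using z by (auto simp: cap_def)
        also have "\<dots> \<le> (\<Sum>k. ?g k z)"
        proof -
          define g where "g = (\<lambda>k. ?g k z)"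
          have "sum g {k} \<le> suminf g" by (intro sum_le_suminf summableI) auto
          then have "g k \<le> suminf g" by simp
          then show ?thesis by (simp only: g_def)
        qed
        also have "\<dots> \<le> 1 + (\<Sum>k. ?g k z)" by (simp add: add_increasing)
        finally show ?thesis .
      qed
    qed
    then have "(\<integral>\<^sup>+z. ennreal (norm (x - z) powr - p) \<partial>\<mu>) \<le> (\<integral>\<^sup>+z. 1 + (\<Sum>k. ?g k z) \<partial>\<mu>)"
      by (rule nn_integral_mono)
    have capm [measurable]: "cap x t \<in> sets \<mu>" for t
      using cap_sets[of x t] by simp
    note \<open>(\<integral>\<^sup>+z. ennreal (norm (x - z) powr - p) \<partial>\<mu>) \<le> (\<integral>\<^sup>+z. 1 + (\<Sum>k. ?g k z) \<partial>\<mu>)\<close>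
    also have "(\<integral>\<^sup>+z. 1 + (\<Sum>k. ?g k z) \<partial>\<mu>) = 1 + (\<integral>\<^sup>+z. (\<Sum>k. ?g k z) \<partial>\<mu>)"
      by (subst nn_integral_add) (use emeasure_space_1 in auto)
    also have "(\<integral>\<^sup>+z. (\<Sum>k. ?g k z) \<partial>\<mu>) = (\<Sum>k. \<integral>\<^sup>+z. ?g k z \<partial>\<mu>)"
      by (rule nn_integral_suminf) measurable
    also have "\<dots> = (\<Sum>k. ennreal (2 powr (p * (real k + 1))) * emeasure \<mu> (cap x ((1/2) ^ k)))"
      by (intro suminf_cong nn_integral_cmult_indicator capm)
    also have "\<dots> \<le> (\<Sum>k. ennreal (C * 2 powr p * q ^ k))"
    proof (rule suminf_le)
      fix k :: nat
      have "ennreal (2 powr (p * (real k + 1))) * emeasure \<mu> (cap x ((1/2) ^ k))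
          \<le> ennreal (2 powr (p * (real k + 1))) * ennreal (C * ((1/2) ^ k)\<^sup>2)"
        using C(2)[OF x, of "(1/2) ^ k"] by (intro mult_left_mono) auto
      also have "\<dots> = ennreal (2 powr (p * (real k + 1)) * (C * ((1/2) ^ k)\<^sup>2))"
        using C by (simp add: ennreal_mult)
      also have "2 powr (p * (real k + 1)) * (C * ((1/2) ^ k)\<^sup>2) = C * 2 powr p * q ^ k"
      proof -
        have "((1/2 :: real) ^ k)\<^sup>2 = 1 / 2 ^ (2 * k)"
          by (simp only: power_one_over power_mult mult.commute[of 2 k])
        also have "\<dots> = 2 powr (- real (2 * k))"
          by (simp only: powr_minus powr_realpow[OF zero_less_numeral] inverse_eq_divide)
        finally have "((1/2 :: real) ^ k)\<^sup>2 = 2 powr (- 2 * real k)" by simp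
        moreover have "q ^ k = 2 powr ((p - 2) * real k)"
          unfolding powr_realpow[OF q(1), of k, symmetric] by (simp only: q_def powr_powr)
        moreover have "2 powr (p * (real k + 1)) * (2 :: real) powr (- 2 * real k) = 2 powr p * 2 powr ((p - 2) * real k)"
          unfolding powr_add[symmetric] by (rule arg_cong[of _ _ "\<lambda>x. 2 powr x"]) (simp add: algebra_simps)
        ultimately show ?thesis by (simp only: mult.assoc mult.left_commute[of _ C])
      qed
      finally show "ennreal (2 powr (p * (real k + 1))) * emeasure \<mu> (cap x ((1/2) ^ k)) \<le> ennreal (C * 2 powr p * q ^ k)" .
    qed auto
    also have "\<dots> = ennreal (C * 2 powr p * (1 / (1 - q)))"
    proof (rule suminf_ennreal_eq)
      show "(\<lambda>k. C * 2 powr p * q ^ k) sums (C * 2 powr p * (1 / (1 - q)))"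
        using q by (intro sums_mult geometric_sums) auto
    qed (use C q in auto)
    also have "1 + \<dots> = ennreal M"
      unfolding M_def using C q by (subst ennreal_plus) auto
    finally show "(\<integral>\<^sup>+z. ennreal (norm (x - z) powr - p) \<partial>\<mu>) \<le> ennreal M"
      by (auto intro: add_left_mono)
  qed
qed

text \<open>Planar distance is at least half the chord, so the chordal moment controls this one. The
  bound is uniform in \<open>w\<close>, which matters because it is later used at points that vary
  with \<open>N\<close> and \<open>\<xi>\<close>.\<close>

lemma recip_moment:
  assumes p: "0 < p" "p < 2"
  obtains M where "M > 0" "\<And>w. integrable \<mu> (\<lambda>z. cmod (recip w z) powr p)"
    "\<And>w. (\<integral>z. cmod (recip w z) powr p \<partial>\<mu>) \<le> M"
proof -
  obtain M where M: "M > 0" "\<And>x. x \<in> S2 \<Longrightarrow> (\<integral>\<^sup>+z. ennreal (norm (x - z) powr - p) \<partial>\<mu>) \<le> ennreal M"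
    using chordal_moment[OF p] by blast
  have le: "(\<integral>\<^sup>+z. ennreal (cmod (recip w z) powr p) \<partial>\<mu>) \<le> ennreal (2 powr p * M)" for w
  proof -
    let ?x = "inv_stereo w"
    have "cmod (recip w z) powr p \<le> 2 powr p * norm (?x - z) powr - p" if "z \<in> S2" for z
    proof (cases "z = zero_pt \<or> wcoord z = w")
      case True then show ?thesis by (auto simp: cmod_recip)
    next
      case False
      have n: "norm (?x - z) \<le> 2 * cmod (w - wcoord z)"
        using norm_diff_le_wcoord[OF inv_stereo_S2[of w] inv_stereo_neq_zero_pt[of w], of z] that False by simp
      have "?x \<noteq> z" using False by auto
      then have n0: "norm (?x - z) > 0" by simp
      have "cmod (recip w z) powr p = 1 / cmod (w - wcoord z) powr p"
        using False by (simp add: cmod_recip powr_divide)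
      also have "\<dots> = 2 powr p * (2 * cmod (w - wcoord z)) powr - p"
        by (simp add: powr_mult powr_minus field_simps)
      also have "\<dots> \<le> 2 powr p * norm (?x - z) powr - p"
        using n n0 p by (intro mult_left_mono powr_mono2') auto
      finally show ?thesis .
    qed
    then have "(\<integral>\<^sup>+z. ennreal (cmod (recip w z) powr p) \<partial>\<mu>)
        \<le> (\<integral>\<^sup>+z. ennreal (2 powr p * norm (?x - z) powr - p) \<partial>\<mu>)"
      by (intro nn_integral_mono ennreal_leI) auto
    also have "\<dots> = (\<integral>\<^sup>+z. ennreal (2 powr p) * ennreal (norm (?x - z) powr - p) \<partial>\<mu>)"
      by (simp add: ennreal_mult)
    also have "\<dots> = ennreal (2 powr p) * (\<integral>\<^sup>+z. ennreal (norm (?x - z) powr - p) \<partial>\<mu>)"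
      by (rule nn_integral_cmult) measurable
    also have "\<dots> \<le> ennreal (2 powr p) * ennreal M"
      using M(2)[OF inv_stereo_S2] by (intro mult_left_mono) auto
    also have "\<dots> = ennreal (2 powr p * M)" using M by (simp add: ennreal_mult)
    finally show ?thesis .
  qed
  have int: "integrable \<mu> (\<lambda>z. cmod (recip w z) powr p)" for w
  proof (rule integrableI_bounded)
    show "(\<integral>\<^sup>+z. ennreal (norm (cmod (recip w z) powr p)) \<partial>\<mu>) < \<infinity>"
      using le[of w] by (simp add: order.strict_trans1[OF _ ennreal_less_top])
  qed measurable
  have "(\<integral>z. cmod (recip w z) powr p \<partial>\<mu>) \<le> 2 powr p * M" for w
  proof -
    have "ennreal (\<integral>z. cmod (recip w z) powr p \<partial>\<mu>) \<le> ennreal (2 powr p * M)"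
      using le[of w] nn_integral_eq_integral[OF int[of w]] by simp
    then show ?thesis using M by (simp add: ennreal_le_iff)
  qed
  then show thesis using that[of "2 powr p * M"] int M by simp
qed

end

section \<open>The mean field \<open>\<phi> \<mu>\<close>: boundedness and decay at infinity\<close>

context bounded_density
begin

lemma integrable_recip: "integrable \<mu> (recip w)"
proof -
  obtain M where "\<And>w. integrable \<mu> (\<lambda>z. cmod (recip w z) powr 1)"
    using recip_moment[of 1] by auto
  then have "integrable \<mu> (\<lambda>z. cmod (recip w z))" by (simp add: powr_one')
  then show ?thesis by (rule integrable_norm_cancel) measurable
qed

lemma \<phi>_eq_expectation: "\<phi> \<mu> w = (\<integral>z. recip w z \<partial>\<mu>)"
  unfolding \<phi>_def set_lebesgue_integral_def
  by (rule Bochner_Integration.integral_cong) (auto simp: recip_def)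

lemma \<phi>_bounded: obtains M where "M > 0" "\<And>w. cmod (\<phi> \<mu> w) \<le> M"
proof -
  obtain M where M: "M > 0" "\<And>w. (\<integral>z. cmod (recip w z) powr 1 \<partial>\<mu>) \<le> M"
    by (rule recip_moment[of 1]) auto
  have "cmod (\<phi> \<mu> w) \<le> M" for w
    unfolding \<phi>_eq_expectation
    using order_trans[OF integral_norm_bound, of \<mu> "recip w" M] M(2)[of w] by (simp add: powr_one')
  with M show thesis using that by blast
qed

text \<open>Mass of \<open>\<mu>\<close> near \<open>zero_pt\<close> is small; elsewhere \<open>1 / (w - \<zeta>)\<close> is uniformly small for large \<open>w\<close>.\<close>

lemma \<phi>_tendsto_0:
  assumes e: "e > 0"
  obtains R where "R > 0" "\<And>w. R \<le> cmod w \<Longrightarrow> cmod (\<phi> \<mu> w) < e"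
proof -
  obtain M where M: "M > 0" "\<And>w. integrable \<mu> (\<lambda>z. cmod (recip w z) powr (3/2))"
    "\<And>w. (\<integral>z. cmod (recip w z) powr (3/2) \<partial>\<mu>) \<le> M"
    using recip_moment[of "3/2"] by auto
  \<comment> \<open>A truncation level: kernel values above \<open>s\<close> contribute at most
    \<open>M * s powr (-1/2) = e / 4\<close> to the integral.\<close>
  define s where "s = (4 * M / e)\<^sup>2"
  have s: "s > 0" "M * s powr (-1/2) = e / 4"
  proof -
    show "s > 0" using M e by (simp add: s_def)
    have "s powr (1/2) = 4 * M / e" using M e by (simp add: s_def powr_half_sqrt)
    moreover have "s powr (-1/2) = inverse (s powr (1/2))" using powr_minus[of s "1/2"] by simp
    ultimately show "M * s powr (-1/2) = e / 4" using M e by simp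
  qed
  define A where "A n = {z \<in> S2. z \<noteq> zero_pt \<and> real n \<le> cmod (wcoord z)}" for n :: nat
  have Am [measurable]: "A n \<in> sets \<mu>" for n
  proof -
    have "{z \<in> space \<mu>. z \<noteq> zero_pt \<and> real n \<le> cmod (wcoord z)} \<in> sets \<mu>" by measurable
    then show ?thesis by (simp add: A_def)
  qed
  have "(\<lambda>n. prob (A n)) \<longlonglongrightarrow> prob (\<Inter>n. A n)"
    by (rule finite_Lim_measure_decseq) (use Am in \<open>auto simp: decseq_def A_def\<close>)
  moreover have "(\<Inter>n. A n) = {}"
  proof -
    have "z \<notin> (\<Inter>n. A n)" for z
      using reals_Archimedean2[of "cmod (wcoord z)"] by (auto simp: A_def not_le)
    then show ?thesis by auto
  qed
  ultimately have "(\<lambda>n. prob (A n)) \<longlonglongrightarrow> 0" by simp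
  then have "\<forall>\<^sub>F n in sequentially. prob (A n) < e / (4 * s)"
    using e s by (intro order_tendstoD) auto
  then obtain n where n: "prob (A n) < e / (4 * s)"
    by (auto simp: eventually_sequentially)
  show thesis
  proof (rule that[of "real n + 4 / e"])
    show "real n + 4 / e > 0" using e by (simp add: add_nonneg_pos)
    fix w assume w: "real n + 4 / e \<le> cmod w"
    \<comment> \<open>The three summands treat, in turn, points of \<open>A n\<close> where the
      kernel is at most \<open>s\<close>, points where it exceeds \<open>s\<close>, and points
      outside \<open>A n\<close>, at distance at least \<open>4 / e\<close> from
      \<open>w\<close>.\<close>
    have pt: "cmod (recip w z) \<le> s * indicator (A n) z + s powr (-1/2) * cmod (recip w z) powr (3/2) + e / 4"
      if z: "z \<in> space \<mu>" for z
    proof (cases "z \<in> A n \<or> z = zero_pt")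
      case False
      then have "cmod (wcoord z) < real n" using z by (auto simp: A_def)
      then have d: "4 / e \<le> cmod (w - wcoord z)" using w norm_triangle_ineq2[of w "wcoord z"] by linarith
      have "1 / cmod (w - wcoord z) \<le> 1 / (4 / e)"
        using d e less_le_trans[OF _ d, of 0] by (intro divide_left_mono) auto
      then have "cmod (recip w z) \<le> e / 4" using False by (simp add: cmod_recip)
      moreover have "0 \<le> s * indicator (A n) z + s powr (-1/2) * cmod (recip w z) powr (3/2)"
        using s by (intro add_nonneg_nonneg mult_nonneg_nonneg) auto
      ultimately show ?thesis by linarith
    next
      case True
      show ?thesis
      proof (cases "cmod (recip w z) \<le> s")
        case le: True
        show ?thesis
        proof (cases "z = zero_pt")
          case zp: True
          have "recip w zero_pt = 0" by (simp add: recip_def)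
          then show ?thesis using s e unfolding zp by simp
        next
          case False
          then have "z \<in> A n" using True by simp
          then show ?thesis using le s e by (simp add: add_increasing2)
        qed
      next
        case False
        then have r: "cmod (recip w z) > s" by simp
        have "cmod (recip w z) = cmod (recip w z) powr (-1/2) * cmod (recip w z) powr (3/2)"
          using r s by (simp add: powr_add[symmetric])
        also have "\<dots> \<le> s powr (-1/2) * cmod (recip w z) powr (3/2)"
          using r s by (intro mult_right_mono powr_mono2') auto
        finally show ?thesis using s e by (simp add: add_increasing add_increasing2)
      qed
    qed
    have ind: "integrable \<mu> (\<lambda>z. indicat_real (A n) z)"
      by (rule integrable_const_bound[of _ 1]) (auto simp: indicator_def)
    have "cmod (\<phi> \<mu> w) \<le> (\<integral>z. cmod (recip w z) \<partial>\<mu>)"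
      unfolding \<phi>_eq_expectation by (rule integral_norm_bound)
    also have "\<dots> \<le> (\<integral>z. s * indicator (A n) z + s powr (-1/2) * cmod (recip w z) powr (3/2) + e / 4 \<partial>\<mu>)"
      using integrable_recip M(2) ind pt
      by (intro integral_mono Bochner_Integration.integrable_add integrable_mult_right) auto
    also have "\<dots> = s * prob (A n) + s powr (-1/2) * (\<integral>z. cmod (recip w z) powr (3/2) \<partial>\<mu>) + e / 4"
    proof -
      have "A n \<inter> S2 = A n" by (auto simp: A_def)
      then show ?thesis using M(2) ind prob_space by simp
    qed
    also have "\<dots> < e / 4 + e / 4 + e / 4"
    proof -
      have "s * prob (A n) < e / 4" using n s e by (simp add: field_simps)
      moreover have "s powr (-1/2) * (\<integral>z. cmod (recip w z) powr (3/2) \<partial>\<mu>) \<le> s powr (-1/2) * M"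
        using M by (intro mult_left_mono) auto
      ultimately show ?thesis using s(2) e unfolding mult.commute[of M] by linarith
    qed
    finally show "cmod (\<phi> \<mu> w) < e" using e by simp
  qed
qed

text \<open>A planar disk of radius \<open>t\<close> lies in a cap of chordal radius
  \<open>2 * t\<close>. With \<open>t\<close> of order \<open>1 / N\<close> and at most
  \<open>N\<close> samples, some sample comes this close with probability only
  \<open>O(1 / N)\<close>.\<close>

lemma prob_close:
  obtains C where "C > 0"
    "\<And>w t. 0 \<le> t \<Longrightarrow> prob {z \<in> space \<mu>. z \<noteq> zero_pt \<and> cmod (w - wcoord z) < t} \<le> C * t\<^sup>2"
proof -
  obtain C where C: "C > 0" "\<And>x t. x \<in> S2 \<Longrightarrow> 0 \<le> t \<Longrightarrow> emeasure \<mu> (cap x t) \<le> ennreal (C * t\<^sup>2)"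
    using cap_measure by blast
  show thesis
  proof
    show "C * 4 > 0" using C by simp
    fix w and t :: real assume t: "0 \<le> t"
    have "{z \<in> space \<mu>. z \<noteq> zero_pt \<and> cmod (w - wcoord z) < t} \<subseteq> cap (inv_stereo w) (2 * t)"
      using norm_diff_le_wcoord[OF inv_stereo_S2[of w] inv_stereo_neq_zero_pt[of w]]
      by (force simp: cap_def)
    then have "prob {z \<in> space \<mu>. z \<noteq> zero_pt \<and> cmod (w - wcoord z) < t} \<le> prob (cap (inv_stereo w) (2 * t))"
      by (rule finite_measure_mono) (use cap_sets in simp)
    also have "\<dots> \<le> C * (2 * t)\<^sup>2"
      using C(2)[OF inv_stereo_S2, of "2 * t" w] t C(1)
      by (simp add: emeasure_eq_measure)
    finally show "prob {z \<in> space \<mu>. z \<noteq> zero_pt \<and> cmod (w - wcoord z) < t} \<le> C * 4 * t\<^sup>2"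
      by (simp add: power_mult_distrib)
  qed
qed

end

section \<open>The truncated Cauchy kernel\<close>

definition recip_far :: "complex \<Rightarrow> real \<Rightarrow> real ^ 3 \<Rightarrow> complex" where
  "recip_far w \<tau> z = (if cmod (w - wcoord z) < \<tau> then 0 else recip w z)"

lemma measurable_recip_far [measurable]: "recip_far w \<tau> \<in> borel_measurable borel"
  unfolding recip_far_def[abs_def] by measurable

text \<open>The purpose of the truncation: \<open>recip w\<close> has in general no second moment,
  the critical exponent being 2, whereas a bounded kernel admits Chebyshev's inequality.\<close>

lemma cmod_recip_far_le:
  assumes "\<tau> > 0"
  shows "cmod (recip_far w \<tau> z) \<le> 1 / \<tau>"
  using assms by (auto simp: recip_far_def cmod_recip intro!: divide_left_mono mult_pos_pos)

context bounded_density
begin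

lemma recip_far_measurable_\<mu> [measurable]: "recip_far w \<tau> \<in> borel_measurable \<mu>"
  by (intro borel_measurable_\<mu>) measurable

lemma integrable_recip_far:
  assumes "\<tau> > 0" shows "integrable \<mu> (recip_far w \<tau>)"
  by (rule integrable_const_bound[of _ "1 / \<tau>"]) (use cmod_recip_far_le[OF assms] in auto)

text \<open>Both bounds trade powers against the moment of order \<open>2 - \<kappa>\<close>. Where
  the kernel is kept it is at most \<open>1 / \<tau>\<close>, so its square gains
  \<open>\<tau> powr - \<kappa>\<close>; where a nonzero value is discarded it is at least
  \<open>1 / \<tau>\<close>, so the bias gains \<open>\<tau> powr (1 - \<kappa>)\<close>.\<close>

lemma recip_far_moments:
  assumes \<kappa>: "0 < \<kappa>" "\<kappa> < 1"
  obtains M where "M > 0"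
    "\<And>w \<tau>. 0 < \<tau> \<Longrightarrow> (\<integral>z. (cmod (recip_far w \<tau> z))\<^sup>2 \<partial>\<mu>) \<le> M * \<tau> powr - \<kappa>"
    "\<And>w \<tau>. 0 < \<tau> \<Longrightarrow> cmod (\<phi> \<mu> w - (\<integral>z. recip_far w \<tau> z \<partial>\<mu>)) \<le> M * \<tau> powr (1 - \<kappa>)"
proof -
  obtain M where M: "M > 0" "\<And>w. integrable \<mu> (\<lambda>z. cmod (recip w z) powr (2 - \<kappa>))"
    "\<And>w. (\<integral>z. cmod (recip w z) powr (2 - \<kappa>) \<partial>\<mu>) \<le> M"
    using recip_moment[of "2 - \<kappa>"] \<kappa> by auto
  show thesis
  proof (rule that[OF M(1)])
    fix w and \<tau> :: real assume \<tau>: "0 < \<tau>"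
    have "(cmod (recip_far w \<tau> z))\<^sup>2 \<le> \<tau> powr - \<kappa> * cmod (recip w z) powr (2 - \<kappa>)" for z
    proof (cases "recip_far w \<tau> z = 0")
      case False
      then have eq: "recip_far w \<tau> z = recip w z" by (auto simp: recip_far_def)
      then have r: "cmod (recip w z) > 0" using False by simp
      have "(cmod (recip w z))\<^sup>2 = cmod (recip w z) powr \<kappa> * cmod (recip w z) powr (2 - \<kappa>)"
        using r by (simp add: powr_add[symmetric])
      also have "\<dots> \<le> (1 / \<tau>) powr \<kappa> * cmod (recip w z) powr (2 - \<kappa>)"
        using cmod_recip_far_le[OF \<tau>, of w z] \<kappa> unfolding eq
        by (intro mult_right_mono powr_mono2) auto
      also have "(1 / \<tau>) powr \<kappa> = \<tau> powr - \<kappa>" using \<tau> by (simp add: powr_divide powr_minus field_simps)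
      finally show ?thesis unfolding eq .
    qed simp
    then have "(\<integral>z. (cmod (recip_far w \<tau> z))\<^sup>2 \<partial>\<mu>) \<le> (\<integral>z. \<tau> powr - \<kappa> * cmod (recip w z) powr (2 - \<kappa>) \<partial>\<mu>)"
      using M(2) by (intro integral_mono' integrable_mult_right) auto
    also have "\<dots> \<le> \<tau> powr - \<kappa> * M" using M by (simp add: mult_left_mono)
    finally show "(\<integral>z. (cmod (recip_far w \<tau> z))\<^sup>2 \<partial>\<mu>) \<le> M * \<tau> powr - \<kappa>" by (simp add: mult.commute)
    have b: "cmod (recip w z - recip_far w \<tau> z) \<le> \<tau> powr (1 - \<kappa>) * cmod (recip w z) powr (2 - \<kappa>)" for z
    proof (cases "recip w z = recip_far w \<tau> z")
      case False
      then have d: "cmod (w - wcoord z) < \<tau>" "recip w z \<noteq> 0" "recip_far w \<tau> z = 0"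
        by (auto simp: recip_far_def split: if_splits)
      then have dpos: "cmod (w - wcoord z) > 0" "cmod (recip w z) = 1 / cmod (w - wcoord z)"
        by (auto simp: recip_def norm_divide split: if_splits)
      have r: "1 / \<tau> \<le> cmod (recip w z)"
        unfolding dpos(2) using d dpos(1) \<tau> by (intro divide_left_mono) auto
      have r0: "cmod (recip w z) > 0" using d(2) by simp
      have "cmod (recip w z) = cmod (recip w z) powr - (1 - \<kappa>) * cmod (recip w z) powr (2 - \<kappa>)"
        using r0 by (simp add: powr_add[symmetric])
      also have "\<dots> \<le> (1 / \<tau>) powr - (1 - \<kappa>) * cmod (recip w z) powr (2 - \<kappa>)"
        using r \<tau> \<kappa> by (intro mult_right_mono powr_mono2') auto
      also have "(1 / \<tau>) powr - (1 - \<kappa>) = \<tau> powr (1 - \<kappa>)"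
        using \<tau> by (simp only: powr_divide powr_minus powr_one_eq_one) simp
      finally show ?thesis using d(3) by simp
    qed simp
    have "\<phi> \<mu> w - (\<integral>z. recip_far w \<tau> z \<partial>\<mu>) = (\<integral>z. recip w z - recip_far w \<tau> z \<partial>\<mu>)"
      unfolding \<phi>_eq_expectation using integrable_recip integrable_recip_far[OF \<tau>] by simp
    also have "cmod \<dots> \<le> (\<integral>z. cmod (recip w z - recip_far w \<tau> z) \<partial>\<mu>)" by (rule integral_norm_bound)
    also have "\<dots> \<le> (\<integral>z. \<tau> powr (1 - \<kappa>) * cmod (recip w z) powr (2 - \<kappa>) \<partial>\<mu>)"
      using M(2) b by (intro integral_mono' integrable_mult_right) auto
    also have "\<dots> \<le> \<tau> powr (1 - \<kappa>) * M" using M by (simp add: mult_left_mono)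
    finally show "cmod (\<phi> \<mu> w - (\<integral>z. recip_far w \<tau> z \<partial>\<mu>)) \<le> M * \<tau> powr (1 - \<kappa>)" by (simp add: mult.commute)
  qed
qed

end

section \<open>Separated points and the contraction\<close>

text \<open>Packing: the balls of radius \<open>s / 2\<close> about the points are disjoint and lie
  in the ball of radius \<open>2 * d\<close> about \<open>w\<close>; areas are compared.\<close>

lemma card_separated_le:
  fixes v :: "'a \<Rightarrow> complex"
  assumes A: "finite A" and s: "0 < s"
    and sep: "\<And>x y. x \<in> A \<Longrightarrow> y \<in> A \<Longrightarrow> x \<noteq> y \<Longrightarrow> s < cmod (v x - v y)"
    and d: "\<And>x. x \<in> A \<Longrightarrow> cmod (w - v x) \<le> d" "s / 2 \<le> d"
  shows "real (card A) \<le> (4 * d / s)\<^sup>2"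
proof -
  have dis: "disjoint_family_on (\<lambda>x. ball (v x) (s / 2)) A"
    unfolding disjoint_family_on_def
  proof (intro ballI impI)
    fix x y assume "x \<in> A" "y \<in> A" "x \<noteq> y"
    then have "s < dist (v x) (v y)" using sep by (simp add: dist_norm)
    then show "ball (v x) (s / 2) \<inter> ball (v y) (s / 2) = {}"
      by (intro disjoint_ballI) simp
  qed
  have "(\<Sum>x\<in>A. measure lborel (ball (v x) (s / 2))) = measure lborel (\<Union>x\<in>A. ball (v x) (s / 2))"
    using dis A emeasure_lborel_ball_finite[of "v x" "s / 2" for x]
    by (intro measure_finite_Union[symmetric]) (auto simp: less_top)
  also have "\<dots> \<le> measure lborel (ball w (2 * d))"
  proof (rule measure_mono_fmeasurable)
    show "(\<Union>x\<in>A. ball (v x) (s / 2)) \<subseteq> ball w (2 * d)"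
    proof safe
      fix x u assume x: "x \<in> A" and u: "u \<in> ball (v x) (s / 2)"
      have "dist w u \<le> dist w (v x) + dist (v x) u" by (rule dist_triangle)
      also have "\<dots> < d + s / 2" using d(1)[OF x] u by (simp add: dist_norm)
      finally show "u \<in> ball w (2 * d)" using d(2) by simp
    qed
  qed (use A emeasure_lborel_ball_finite[of w "2 * d"] in
      \<open>auto simp: fmeasurable_def intro!: sets.finite_UN\<close>)
  finally have "real (card A) * (s\<^sup>2 / 4) \<le> (2 * d)\<^sup>2"
    using s d(2) content_ball[of "s / 2" "v x" for x] content_ball[of "2 * d" w] unit_ball_vol_2
    by (simp add: power_divide)
  then show ?thesis using s by (simp add: power_divide power_mult_distrib field_simps)
qed

text \<open>Induction removing a point farthest from \<open>w\<close>: the \<open>n\<close>-th point is at distance \<open>\<ge> s \<surd>n / 4\<close>.\<close>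

lemma sum_inverse_separated_le:
  fixes v :: "'a \<Rightarrow> complex"
  assumes "finite A" and s: "0 < s"
    and "\<And>x y. x \<in> A \<Longrightarrow> y \<in> A \<Longrightarrow> x \<noteq> y \<Longrightarrow> s < cmod (v x - v y)"
    and "\<And>x. x \<in> A \<Longrightarrow> s / 2 \<le> cmod (w - v x)"
  shows "(\<Sum>x\<in>A. 1 / cmod (w - v x)) \<le> 8 * sqrt (card A) / s"
  using assms(1,3,4)
proof (induction "card A" arbitrary: A)
  case 0 then show ?case by simp
next
  case (Suc n)
  from Suc.hyps(2) have "A \<noteq> {}" by auto
  with Suc.prems(1) obtain x where x: "x \<in> A" "\<And>y. y \<in> A \<Longrightarrow> cmod (w - v y) \<le> cmod (w - v x)"
    using Max_in[of "(\<lambda>y. cmod (w - v y)) ` A"] Max_ge[of "(\<lambda>y. cmod (w - v y)) ` A"] by fastforce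
  let ?d = "cmod (w - v x)"
  have d: "0 < ?d" using Suc.prems(3)[OF x(1)] s by linarith
  have "real (card A) \<le> (4 * ?d / s)\<^sup>2"
    using Suc.prems x s by (intro card_separated_le[where v = v and w = w]) auto
  then have "sqrt (card A) \<le> 4 * ?d / s" using s d by (intro real_le_lsqrt) auto
  then have d2: "1 / ?d \<le> 4 / s * (1 / sqrt (Suc n))"
    using s d Suc.hyps(2) by (simp add: field_simps)
  have "card (A - {x}) = n" using Suc.hyps(2) x(1) Suc.prems(1) by simp
  then have "(\<Sum>x\<in>A - {x}. 1 / cmod (w - v x)) \<le> 8 * sqrt n / s"
    using Suc.hyps(1)[of "A - {x}"] Suc.prems by auto
  then have "(\<Sum>x\<in>A. 1 / cmod (w - v x)) \<le> 8 * sqrt n / s + 4 / s * (1 / sqrt (Suc n))"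
    using d2 x(1) Suc.prems(1) by (simp add: sum.remove)
  also have "\<dots> = 4 / s * (2 * sqrt n + 1 / sqrt (Suc n))" by (simp add: distrib_left)
  \<comment> \<open>The discrete form of comparing the sum of \<open>1 / sqrt k\<close> with the
    integral \<open>2 * sqrt n\<close>; it follows from the inequality of arithmetic and geometric
    means.\<close>
  also have "2 * sqrt n + 1 / sqrt (Suc n) \<le> 2 * sqrt (Suc n)"
  proof -
    have "2 * (sqrt n * sqrt (Suc n)) \<le> (sqrt n)\<^sup>2 + (sqrt (Suc n))\<^sup>2"
      using sum_squares_bound[of "sqrt n" "sqrt (Suc n)"] by simp
    then have "2 * (sqrt n * sqrt (Suc n)) + 1 \<le> 2 * (sqrt (Suc n))\<^sup>2" by simp
    then show ?thesis by (simp add: field_simps power2_eq_square)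
  qed
  then have "4 / s * (2 * sqrt n + 1 / sqrt (Suc n)) \<le> 4 / s * (2 * sqrt (Suc n))"
    using s by (intro mult_left_mono) auto
  finally show ?case using Suc.hyps(2) by simp
qed

text \<open>Both \<open>u\<close> and \<open>u'\<close> lie within half of \<open>|w - v|\<close>
  from \<open>w\<close>, so each denominator is at least \<open>|w - v| / 2\<close>. Lipschitz
  bounds on a whole disk thus reduce to a sum of squares at its centre.\<close>

lemma inverse_diff_le:
  fixes u w v :: complex
  assumes "2 * cmod (u - w) \<le> cmod (w - v)" and "w \<noteq> v" 
    and "2 * cmod (u' - w) \<le> cmod (w - v)"
  shows "cmod (1 / (u - v) - 1 / (u' - v)) \<le> 4 * cmod (u - u') * (1 / cmod (w - v))\<^sup>2"
proof -
  have pos: "cmod (w - v) > 0" using assms by simp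
  have *: "cmod (w - v) / 2 \<le> cmod (y - v)" if "2 * cmod (y - w) \<le> cmod (w - v)" for y
    using that norm_triangle_ineq2[of "w - v" "w - y"] by (simp add: norm_minus_commute)
  note u = *[OF assms(1)] and u' = *[OF assms(3)]
  have ne: "u - v \<noteq> 0" "u' - v \<noteq> 0" using u u' pos by auto
  have "1 / (u - v) - 1 / (u' - v) = (u' - u) / ((u - v) * (u' - v))"
    using ne by (simp add: field_simps)
  then have "cmod (1 / (u - v) - 1 / (u' - v)) = cmod (u - u') / (cmod (u - v) * cmod (u' - v))"
    by (simp add: norm_divide norm_mult norm_minus_commute)
  also have "\<dots> \<le> cmod (u - u') / ((cmod (w - v) / 2) * (cmod (w - v) / 2))"
    using pos u u' by (intro divide_left_mono mult_mono mult_pos_pos) auto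
  also have "\<dots> = 4 * cmod (u - u') * (1 / cmod (w - v))\<^sup>2"
    by (simp add: power2_eq_square)
  finally show ?thesis .
qed

lemma recip_diff_le:
  assumes "z = zero_pt \<or> (0 < cmod (w - wcoord z) \<and> 2 * t \<le> cmod (w - wcoord z))"
    and "cmod (u - w) \<le> t" "cmod (u' - w) \<le> t"
  shows "cmod (recip u z - recip u' z) \<le> 4 * cmod (u - u') * (cmod (recip w z))\<^sup>2"
proof (cases "z = zero_pt")
  case False
  then show ?thesis using assms inverse_diff_le[of u w "wcoord z" u'] by (simp add: recip_def norm_divide)
qed (simp add: recip_def)

text \<open>
  If \<open>H\<close> is nearly constant, with value close to \<open>- 1 / (w\<^sub>0 - \<xi>)\<close>, then \<open>1 + (w - \<xi>) H w\<close> vanishes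
  exactly at the fixed points of a contraction.
\<close>

lemma contraction_unique_zero:
  fixes H :: "complex \<Rightarrow> complex"
  assumes D: "ball w\<^sub>0 r\<^sub>1 \<subseteq> D" "D \<subseteq> ball w\<^sub>0 r\<^sub>2" and r: "0 < r\<^sub>1" "r\<^sub>1 \<le> r\<^sub>2"
    and d: "w\<^sub>0 \<noteq> \<xi>" "cmod (w\<^sub>0 - \<xi>) \<le> \<beta>"
    and H0: "cmod (H w\<^sub>0 + 1 / (w\<^sub>0 - \<xi>)) \<le> e"
    and L: "\<And>u u'. u \<in> ball w\<^sub>0 r\<^sub>2 \<Longrightarrow> u' \<in> ball w\<^sub>0 r\<^sub>2 \<Longrightarrow> cmod (H u - H u') \<le> L * cmod (u - u')"
    and small: "\<beta> * (\<beta> + r\<^sub>2) * (e + L * r\<^sub>2) \<le> r\<^sub>1 / 2" "\<beta> * (e + L * r\<^sub>2 + (\<beta> + r\<^sub>2) * L) \<le> 1 / 2"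
    and nn: "0 \<le> L"
  shows "\<exists>!w. w \<in> D \<and> 1 + (w - \<xi>) * H w = 0"
proof -
  define d where "d = w\<^sub>0 - \<xi>"
  have d0: "d \<noteq> 0" and db: "cmod d \<le> \<beta>" using d by (auto simp: d_def)
  have b0: "0 \<le> \<beta>" using db norm_ge_zero[of d] by linarith
  have r2: "0 < r\<^sub>2" using r by linarith
  define err where "err w = H w + 1 / d" for w
  define T where "T w = w\<^sub>0 + d * (w - \<xi>) * err w" for w
  have fix_iff: "1 + (w - \<xi>) * H w = 0 \<longleftrightarrow> T w = w" for w
  proof -
    have "d * (w - \<xi>) * err w = d * (w - \<xi>) * H w + (w - \<xi>)"
      using d0 by (simp add: err_def distrib_left)
    then have "d * (1 + (w - \<xi>) * H w) = T w - w"
      by (simp add: T_def d_def algebra_simps)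
    then show ?thesis using d0 by (metis eq_iff_diff_eq_0 mult_eq_0_iff)
  qed
  have e0: "0 \<le> e" using H0 norm_ge_zero order_trans by blast
  have errL: "cmod (err u - err u') \<le> L * cmod (u - u')" if "u \<in> ball w\<^sub>0 r\<^sub>2" "u' \<in> ball w\<^sub>0 r\<^sub>2" for u u'
    using L[OF that] by (simp add: err_def)
  have errB: "cmod (err u) \<le> e + L * r\<^sub>2" if u: "u \<in> ball w\<^sub>0 r\<^sub>2" for u
  proof -
    have "cmod (err u) \<le> cmod (err w\<^sub>0) + cmod (err u - err w\<^sub>0)"
      using norm_triangle_sub[of "err u" "err w\<^sub>0"] by simp
    also have "\<dots> \<le> e + L * cmod (u - w\<^sub>0)"
      using H0 errL[OF u, of w\<^sub>0] r2 by (intro add_mono) (auto simp: err_def d_def)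
    also have "\<dots> \<le> e + L * r\<^sub>2"
      using u nn by (intro add_left_mono mult_left_mono) (auto simp: dist_norm norm_minus_commute)
    finally show ?thesis .
  qed
  have far: "cmod (u - \<xi>) \<le> \<beta> + r\<^sub>2" if "u \<in> ball w\<^sub>0 r\<^sub>2" for u
  proof -
    have "cmod (u - \<xi>) \<le> cmod (u - w\<^sub>0) + cmod d"
      using norm_triangle_ineq[of "u - w\<^sub>0" d] by (simp add: d_def)
    then show ?thesis using that db by (simp add: dist_norm norm_minus_commute)
  qed
  have TB: "cmod (T u - w\<^sub>0) \<le> r\<^sub>1 / 2" if u: "u \<in> ball w\<^sub>0 r\<^sub>2" for u
  proof -
    have "cmod (T u - w\<^sub>0) = cmod d * cmod (u - \<xi>) * cmod (err u)"
      by (simp add: T_def norm_mult)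
    also have "\<dots> \<le> \<beta> * (\<beta> + r\<^sub>2) * (e + L * r\<^sub>2)"
      using db far[OF u] errB[OF u] b0 r2 by (intro mult_mono) auto
    finally show ?thesis using small(1) by linarith
  qed
  have TL: "cmod (T u - T u') \<le> 1 / 2 * cmod (u - u')"
    if u: "u \<in> ball w\<^sub>0 r\<^sub>2" and u': "u' \<in> ball w\<^sub>0 r\<^sub>2" for u u'
  proof -
    have "T u - T u' = d * ((u - u') * err u + (u' - \<xi>) * (err u - err u'))"
      by (simp add: T_def algebra_simps)
    then have "cmod (T u - T u') = cmod d * cmod ((u - u') * err u + (u' - \<xi>) * (err u - err u'))"
      by (simp add: norm_mult)
    also have "\<dots> \<le> \<beta> * (cmod (u - u') * (e + L * r\<^sub>2) + (\<beta> + r\<^sub>2) * (L * cmod (u - u')))"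
      using db b0 r2
      by (intro mult_mono order_trans[OF norm_triangle_ineq] add_mono)
        (auto simp: norm_mult intro!: mult_mono errB[OF u] far[OF u'] errL[OF u u'])
    also have "\<dots> = \<beta> * (e + L * r\<^sub>2 + (\<beta> + r\<^sub>2) * L) * cmod (u - u')" by (simp add: algebra_simps)
    also have "\<dots> \<le> 1 / 2 * cmod (u - u')" using small(2) by (intro mult_right_mono) auto
    finally show ?thesis .
  qed
  \<comment> \<open>\<open>T\<close> sends the whole outer ball into this closed disk, which lies in
    \<open>D\<close>, so Banach's theorem finds the fixed point inside \<open>D\<close>. Uniqueness
    comes from the contraction estimate on the outer ball; the shape of \<open>D\<close> between the
    two balls does not matter.\<close>
  have sub: "cball w\<^sub>0 (r\<^sub>1 / 2) \<subseteq> ball w\<^sub>0 r\<^sub>1" "ball w\<^sub>0 r\<^sub>1 \<subseteq> ball w\<^sub>0 r\<^sub>2" using r by auto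
  have "\<exists>!x\<in>cball w\<^sub>0 (r\<^sub>1 / 2). T x = x"
  proof (rule Banach_fix[OF compact_imp_complete])
    show "compact (cball w\<^sub>0 (r\<^sub>1 / 2))" by (rule compact_cball)
    show "T ` cball w\<^sub>0 (r\<^sub>1 / 2) \<subseteq> cball w\<^sub>0 (r\<^sub>1 / 2)"
      using TB sub by (auto simp: dist_norm norm_minus_commute subset_eq)
    show "dist (T x) (T y) \<le> 1 / 2 * dist x y" if "x \<in> cball w\<^sub>0 (r\<^sub>1 / 2)" "y \<in> cball w\<^sub>0 (r\<^sub>1 / 2)" for x y
      using TL[of x y] that sub unfolding dist_norm by blast
  qed (use r in auto)
  then obtain x where x: "x \<in> cball w\<^sub>0 (r\<^sub>1 / 2)" "T x = x" by blast
  show ?thesis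
  proof (rule ex1I[of _ x])
    show "x \<in> D \<and> 1 + (x - \<xi>) * H x = 0" using x D sub fix_iff by blast
    fix y assume y: "y \<in> D \<and> 1 + (y - \<xi>) * H y = 0"
    then have "T y = y" "y \<in> ball w\<^sub>0 r\<^sub>2" using D fix_iff by auto
    moreover have "x \<in> ball w\<^sub>0 r\<^sub>2" using x sub by blast
    ultimately have "cmod (y - x) \<le> 1 / 2 * cmod (y - x)" using TL[of y x] x by simp
    then show "y = x" by simp
  qed
qed

section \<open>Measurability of the critical point event\<close>

text \<open>On a compact set a continuous function has a zero exactly if \<open>|f|\<close> takes
  arbitrarily small values, and these can be sought in a countable dense subset. The event becomes a
  countable combination of measurable ones.\<close>

lemma exists_zero_compact_measurable:
  fixes f :: "'a \<Rightarrow> 'b::euclidean_space \<Rightarrow> real"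
  assumes K: "compact K" and cont: "\<And>x. x \<in> space M \<Longrightarrow> continuous_on K (f x)"
    and meas: "\<And>y. y \<in> K \<Longrightarrow> (\<lambda>x. f x y) \<in> borel_measurable M"
  shows "{x \<in> space M. \<exists>y\<in>K. f x y = 0} \<in> sets M"
proof -
  obtain D where D: "countable D" "D \<subseteq> K" "K \<subseteq> closure D" using separable[of K] by blast
  have "{x \<in> space M. \<exists>y\<in>K. f x y = 0} = {x \<in> space M. \<forall>n::nat. \<exists>y\<in>D. \<bar>f x y\<bar> < 1 / real (Suc n)}"
  proof (intro Collect_cong conj_cong refl iffI)
    fix x assume x: "x \<in> space M"
    {
      assume "\<exists>y\<in>K. f x y = 0"
      then obtain y where y: "y \<in> K" "f x y = 0" by blast
      show "\<forall>n::nat. \<exists>y\<in>D. \<bar>f x y\<bar> < 1 / real (Suc n)"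
      proof
        fix n :: nat
        have "1 / real (Suc n) > 0" by simp
        with cont[OF x] y(1) obtain d where d: "d > 0"
          "\<And>y'. y' \<in> K \<Longrightarrow> dist y' y < d \<Longrightarrow> dist (f x y') (f x y) < 1 / real (Suc n)"
          unfolding continuous_on_iff by metis
        have "y \<in> closure D" using y(1) D(3) by auto
        then obtain y' where "y' \<in> D" "dist y' y < d" using d(1) unfolding closure_approachable by blast
        then show "\<exists>y\<in>D. \<bar>f x y\<bar> < 1 / real (Suc n)" using d(2)[of y'] D(2) y(2) by (auto simp: dist_real_def)
      qed
    }
    {
      assume n: "\<forall>n::nat. \<exists>y\<in>D. \<bar>f x y\<bar> < 1 / real (Suc n)"
      have "D \<noteq> {}" using n by blast
      then have "K \<noteq> {}" using D(2) by blast
      then obtain y where y: "y \<in> K" "\<And>y'. y' \<in> K \<Longrightarrow> \<bar>f x y\<bar> \<le> \<bar>f x y'\<bar>"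
        using continuous_attains_inf[OF K _ continuous_on_rabs[OF cont[OF x]]] by blast
      have "f x y = 0"
      proof (rule ccontr)
        assume "f x y \<noteq> 0"
        then have "\<bar>f x y\<bar> > 0" by simp
        then obtain m :: nat where "inverse (real (Suc m)) < \<bar>f x y\<bar>" using reals_Archimedean by blast
        moreover obtain y' where "y' \<in> D" "\<bar>f x y'\<bar> < inverse (real (Suc m))"
          using n unfolding inverse_eq_divide by blast
        ultimately show False using y(2)[of y'] D(2) by force
      qed
      then show "\<exists>y\<in>K. f x y = 0" using y(1) by blast
    }
  qed
  also have "\<dots> \<in> sets M"
  proof (rule sets.sets_Collect_countable_All)
    fix n :: nat
    have "{x \<in> space M. \<exists>y\<in>D. \<bar>f x y\<bar> < 1 / real (Suc n)} = (\<Union>y\<in>D. {x \<in> space M. \<bar>f x y\<bar> < 1 / real (Suc n)})"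
      by blast
    also have "\<dots> \<in> sets M"
    proof (intro sets.countable_UN'' D(1))
      fix y assume "y \<in> D"
      then have [measurable]: "(\<lambda>x. f x y) \<in> borel_measurable M" using meas D(2) by blast
      show "{x \<in> space M. \<bar>f x y\<bar> < 1 / real (Suc n)} \<in> sets M" by measurable
    qed
    finally show "{x \<in> space M. \<exists>y\<in>D. \<bar>f x y\<bar> < 1 / real (Suc n)} \<in> sets M" .
  qed
  finally show ?thesis .
qed

text \<open>Exhausts the open set by countably many compact ones.\<close>

lemma exists_zero_open_measurable:
  fixes f :: "'a \<Rightarrow> 'b::euclidean_space \<Rightarrow> real"
  assumes U: "open U" and cont: "\<And>x. x \<in> space M \<Longrightarrow> continuous_on U (f x)"
    and meas: "\<And>y. y \<in> U \<Longrightarrow> (\<lambda>x. f x y) \<in> borel_measurable M"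
  shows "{x \<in> space M. \<exists>y\<in>U. f x y = 0} \<in> sets M"
proof -
  obtain C :: "nat \<Rightarrow> 'b set" where C: "\<And>n. compact (C n)" "\<And>n. C n \<subseteq> U" "\<Union>(range C) = U"
    using open_Union_compact_subsets[OF U] by metis
  have "{x \<in> space M. \<exists>y\<in>U. f x y = 0} = (\<Union>n. {x \<in> space M. \<exists>y\<in>C n. f x y = 0})"
    unfolding C(3)[symmetric] by auto
  also have "\<dots> \<in> sets M"
  proof (intro sets.countable_UN'' exists_zero_compact_measurable C(1))
    fix n
    show "continuous_on (C n) (f x)" if "x \<in> space M" for x
      using continuous_on_subset[OF cont[OF that] C(2)] .
    show "(\<lambda>x. f x y) \<in> borel_measurable M" if "y \<in> C n" for y
      using meas C(2) that by blast
  qed simp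
  finally show ?thesis .
qed

text \<open>Uniqueness fails exactly if the pair map has a zero off the diagonal of
  \<open>U \<times> U\<close>. That region \<open>V\<close> is again open, so the existence result
  applies to it as well.\<close>

lemma unique_zero_measurable:
  fixes F :: "'a \<Rightarrow> complex \<Rightarrow> complex"
  assumes U: "open U" and cont: "\<And>x. x \<in> space M \<Longrightarrow> continuous_on U (F x)"
    and meas: "\<And>y. y \<in> U \<Longrightarrow> (\<lambda>x. F x y) \<in> borel_measurable M"
  shows "{x \<in> space M. \<exists>!y. y \<in> U \<and> F x y = 0} \<in> sets M"
proof -
  define V where "V = U \<times> U \<inter> {p. fst p \<noteq> snd p}"
  have V: "open V" unfolding V_def using U
    by (intro open_Int open_Times open_Collect_neq continuous_intros) auto
  have "{x \<in> space M. \<exists>!y. y \<in> U \<and> F x y = 0} = {x \<in> space M. \<exists>y\<in>U. cmod (F x y) = 0}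
     - {x \<in> space M. \<exists>p\<in>V. cmod (F x (fst p)) + cmod (F x (snd p)) = 0}"
  proof -
    have "cmod (F x (fst p)) + cmod (F x (snd p)) = 0 \<longleftrightarrow> F x (fst p) = 0 \<and> F x (snd p) = 0" for x p
      by (simp add: add_nonneg_eq_0_iff)
    then have "(\<exists>p\<in>V. cmod (F x (fst p)) + cmod (F x (snd p)) = 0) \<longleftrightarrow>
        (\<exists>y y'. y \<in> U \<and> y' \<in> U \<and> y \<noteq> y' \<and> F x y = 0 \<and> F x y' = 0)" (is "?l \<longleftrightarrow> ?r") for x
    proof -
      have "(y, y') \<in> V \<longleftrightarrow> y \<in> U \<and> y' \<in> U \<and> y \<noteq> y'" for y y' by (simp add: V_def)
      moreover have "?l \<longleftrightarrow> (\<exists>y y'. (y, y') \<in> V \<and> F x y = 0 \<and> F x y' = 0)"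
        using \<open>\<And>x p. cmod (F x (fst p)) + cmod (F x (snd p)) = 0 \<longleftrightarrow> F x (fst p) = 0 \<and> F x (snd p) = 0\<close>
        by (simp only: Bex_def split_paired_Ex fst_conv snd_conv) 
      ultimately show ?thesis by simp
    qed
    then show ?thesis unfolding norm_eq_zero by blast
  qed
  also have "\<dots> \<in> sets M"
  proof (intro sets.Diff exists_zero_open_measurable U V)
    show "continuous_on V (\<lambda>p. cmod (F x (fst p)) + cmod (F x (snd p)))" if "x \<in> space M" for x
      by (intro continuous_intros continuous_on_compose2[OF cont[OF that]]) (auto simp: V_def)
    show "(\<lambda>x. cmod (F x (fst p)) + cmod (F x (snd p))) \<in> borel_measurable M" if "p \<in> V" for p
    proof -
      have [measurable]: "(\<lambda>x. F x (fst p)) \<in> borel_measurable M" "(\<lambda>x. F x (snd p)) \<in> borel_measurable M"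
        using meas that by (auto simp: V_def)
      show ?thesis by measurable
    qed
    show "(\<lambda>x. cmod (F x y)) \<in> borel_measurable M" if "y \<in> U" for y
      by (rule measurable_compose[OF meas[OF that] borel_measurable_norm])
  qed (auto intro!: continuous_intros cont)
  finally show ?thesis .
qed

section \<open>Logarithmic derivatives of the random polynomials\<close>

lemma poly_linear_factor:
  "poly (linear_factor z) u = (if z = zero_pt then u else 1 - wcoord z * u)"
  "poly (pderiv (linear_factor z)) u = (if z = zero_pt then 1 else - wcoord z)"
  by (auto simp: linear_factor_def pderiv_pCons)

lemma deriv_in_wcoord:
  assumes "w \<noteq> 0"
  shows "deriv (in_wcoord p) w = poly (pderiv p) (1 / w) * (- 1 / w\<^sup>2)"
proof (rule DERIV_imp_deriv)
  have "((\<lambda>w. 1 / w) has_field_derivative - 1 / w\<^sup>2) (at w)"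
    using assms by (auto intro!: derivative_eq_intros simp: power2_eq_square field_simps)
  from DERIV_chain2[OF poly_DERIV this]
  show "(in_wcoord p has_field_derivative poly (pderiv p) (1 / w) * (- 1 / w\<^sup>2)) (at w)"
    unfolding in_wcoord_def[abs_def] .
qed

text \<open>The logarithmic derivative of a factor \<open>(w - \<zeta>) / w\<close> is
  \<open>1 / (w - \<zeta>) - 1 / w\<close>, and that of the factor \<open>1 / w\<close> at
  \<open>zero_pt\<close> is \<open>- 1 / w\<close>; \<open>recip\<close> covers both.\<close>

lemma in_wcoord_linear_factor_deriv:
  assumes w: "w \<noteq> 0"
  shows "z = zero_pt \<or> w \<noteq> wcoord z \<Longrightarrow> in_wcoord (linear_factor z) w \<noteq> 0" (is "?a \<Longrightarrow> ?b")
    and "z = zero_pt \<or> w \<noteq> wcoord z \<Longrightarrow>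
      (in_wcoord (linear_factor z) has_field_derivative
        in_wcoord (linear_factor z) w * (- (1 / w) + recip w z)) (at w)"
proof -
  show "?a \<Longrightarrow> ?b" using w by (auto simp: in_wcoord_def poly_linear_factor)
  assume a: ?a
  have "(in_wcoord (linear_factor z) has_field_derivative
      poly (pderiv (linear_factor z)) (1 / w) * (- 1 / w\<^sup>2)) (at w)"
  proof -
    have "((\<lambda>w. 1 / w) has_field_derivative - 1 / w\<^sup>2) (at w)"
      using w by (auto intro!: derivative_eq_intros simp: power2_eq_square field_simps)
    from DERIV_chain2[OF poly_DERIV this] show ?thesis unfolding in_wcoord_def[abs_def] .
  qed
  moreover have "poly (pderiv (linear_factor z)) (1 / w) * (- 1 / w\<^sup>2)
      = in_wcoord (linear_factor z) w * (- (1 / w) + recip w z)"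
  proof (cases "z = zero_pt")
    case True
    then show ?thesis using w by (simp add: poly_linear_factor in_wcoord_def recip_def power2_eq_square)
  next
    case False
    then have "w - wcoord z \<noteq> 0" using a by simp
    then show ?thesis using w False
      by (simp add: poly_linear_factor in_wcoord_def recip_def power2_eq_square divide_simps)
  qed
  ultimately show "(in_wcoord (linear_factor z) has_field_derivative
        in_wcoord (linear_factor z) w * (- (1 / w) + recip w z)) (at w)" by simp
qed

lemma in_wcoord_poly_with_zeros:
  "in_wcoord (poly_with_zeros X m \<zeta>) w =
     (\<Prod>z\<in>X. in_wcoord (linear_factor z) w) * (\<Prod>j<m. in_wcoord (linear_factor (\<zeta> j)) w)"
  by (simp add: in_wcoord_def poly_with_zeros_def poly_prod)

text \<open>
  The logarithmic derivative multiplied by \<open>w - \<xi>\<close>, so that the zero at \<open>\<xi>\<close> contributes no pole.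
\<close>

lemma deriv_poly_with_zeros:
  assumes w: "w \<noteq> 0" and X: "finite X" "\<xi> \<in> X" "\<xi> \<noteq> zero_pt"
    and oth: "\<And>z. z \<in> X - {\<xi>} \<Longrightarrow> z = zero_pt \<or> w \<noteq> wcoord z"
      "\<And>j. j < m \<Longrightarrow> \<zeta> j = zero_pt \<or> w \<noteq> wcoord (\<zeta> j)"
  shows "deriv (in_wcoord (poly_with_zeros X m \<zeta>)) w = 0 \<longleftrightarrow>
    1 + (w - wcoord \<xi>) * (- (of_nat (card X + m) / w)
      + (\<Sum>z\<in>X - {\<xi>}. recip w z) + (\<Sum>j<m. recip w (\<zeta> j))) = 0"
proof -
  \<comment> \<open>The factor at \<open>\<xi>\<close> is kept out of \<open>q\<close> since it may
    vanish at \<open>w\<close>; all the others are nonzero there, so only \<open>q\<close> is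
    differentiated logarithmically.\<close>
  define q where "q = (\<lambda>w. (\<Prod>z\<in>X - {\<xi>}. in_wcoord (linear_factor z) w) *
    (\<Prod>j<m. in_wcoord (linear_factor (\<zeta> j)) w))"
  define S where "S = (\<Sum>z\<in>X - {\<xi>}. - (1 / w) + recip w z) + (\<Sum>j<m. - (1 / w) + recip w (\<zeta> j))"
  have q0: "q w \<noteq> 0"
    using in_wcoord_linear_factor_deriv(1)[OF w] oth X(1) by (auto simp: q_def)
  have "(q has_field_derivative q w * S) (at w)"
  proof -
    have 1: "((\<lambda>w. \<Prod>z\<in>X - {\<xi>}. in_wcoord (linear_factor z) w) has_field_derivative
      (\<Prod>z\<in>X - {\<xi>}. in_wcoord (linear_factor z) w) * (\<Sum>z\<in>X - {\<xi>}. - (1 / w) + recip w z)) (at w)"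
    proof -
      have "(\<Sum>z\<in>X - {\<xi>}. in_wcoord (linear_factor z) w * (- (1 / w) + recip w z) / in_wcoord (linear_factor z) w)
        = (\<Sum>z\<in>X - {\<xi>}. - (1 / w) + recip w z)"
        using in_wcoord_linear_factor_deriv(1)[OF w] oth by (intro sum.cong) auto
      then show ?thesis
        using has_field_derivative_prod'[of "X - {\<xi>}" "\<lambda>z. in_wcoord (linear_factor z)" w
            "\<lambda>z. in_wcoord (linear_factor z) w * (- (1 / w) + recip w z)"]
          in_wcoord_linear_factor_deriv[OF w] oth by auto
    qed
    have 2: "((\<lambda>w. \<Prod>j<m. in_wcoord (linear_factor (\<zeta> j)) w) has_field_derivative
      (\<Prod>j<m. in_wcoord (linear_factor (\<zeta> j)) w) * (\<Sum>j<m. - (1 / w) + recip w (\<zeta> j))) (at w)"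
    proof -
      have "(\<Sum>j<m. in_wcoord (linear_factor (\<zeta> j)) w * (- (1 / w) + recip w (\<zeta> j)) / in_wcoord (linear_factor (\<zeta> j)) w)
        = (\<Sum>j<m. - (1 / w) + recip w (\<zeta> j))"
        using in_wcoord_linear_factor_deriv(1)[OF w] oth by (intro sum.cong) auto
      then show ?thesis
        using has_field_derivative_prod'[of "{..<m}" "\<lambda>j. in_wcoord (linear_factor (\<zeta> j))" w
            "\<lambda>j. in_wcoord (linear_factor (\<zeta> j)) w * (- (1 / w) + recip w (\<zeta> j))"]
          in_wcoord_linear_factor_deriv[OF w] oth by auto
    qed
    show ?thesis unfolding q_def S_def
      by (rule DERIV_cong[OF DERIV_mult[OF 1 2]]) (simp add: algebra_simps)
  qed
  moreover have "(in_wcoord (linear_factor \<xi>) has_field_derivative wcoord \<xi> / w\<^sup>2) (at w)"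
  proof -
    have "((\<lambda>w. 1 - wcoord \<xi> * (1 / w)) has_field_derivative wcoord \<xi> / w\<^sup>2) (at w)"
      using w by (auto intro!: derivative_eq_intros simp: power2_eq_square)
    moreover have "in_wcoord (linear_factor \<xi>) = (\<lambda>w. 1 - wcoord \<xi> * (1 / w))"
      using X(3) by (auto simp: in_wcoord_def poly_linear_factor)
    ultimately show ?thesis by simp
  qed
  ultimately have "((\<lambda>w. in_wcoord (linear_factor \<xi>) w * q w) has_field_derivative
      wcoord \<xi> / w\<^sup>2 * q w + q w * S * in_wcoord (linear_factor \<xi>) w) (at w)"
    using DERIV_mult by blast
  moreover have "in_wcoord (poly_with_zeros X m \<zeta>) = (\<lambda>w. in_wcoord (linear_factor \<xi>) w * q w)"
    using X by (simp add: in_wcoord_poly_with_zeros q_def fun_eq_iff prod.remove mult.assoc)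
  ultimately have "deriv (in_wcoord (poly_with_zeros X m \<zeta>)) w
      = wcoord \<xi> / w\<^sup>2 * q w + q w * S * in_wcoord (linear_factor \<xi>) w"
    by (simp add: DERIV_imp_deriv)
  also have "\<dots> = q w / w * (1 + (w - wcoord \<xi>) * (S - 1 / w))"
    using w X(3) by (simp add: in_wcoord_def poly_linear_factor power2_eq_square divide_simps) (simp add: algebra_simps)
  \<comment> \<open>\<open>S\<close> runs over \<open>card X - 1 + m\<close> zeros; the additional
    \<open>- 1 / w\<close> is the share of \<open>\<xi>\<close>.\<close>
  also have "S - 1 / w = - (of_nat (card X + m) / w) + (\<Sum>z\<in>X - {\<xi>}. recip w z) + (\<Sum>j<m. recip w (\<zeta> j))"
  proof -
    have "of_nat (card X) = 1 + of_nat (card (X - {\<xi>})) * (1 :: complex)"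
      using X card.remove[OF X(1,2)] by simp
    then show ?thesis
      by (simp add: S_def sum.distrib sum_subtractf sum_negf add_divide_distrib)
  qed
  finally show ?thesis using q0 w by simp
qed

context bounded_density
begin

text \<open>Away from \<open>w = 0\<close> the critical points are the zeros of the formal
  derivative at \<open>1 / w\<close>. This is continuous in \<open>w\<close> and, by the product
  rule, a finite expression in measurable functions of the coordinates of the sample.\<close>

lemma unique_critical_measurable:
  fixes X :: "(real ^ 3) set" and m :: nat
  defines "M \<equiv> PiM {..<m} (\<lambda>_. \<mu>)"
  assumes U: "open U" "0 \<notin> U"
  shows "{\<zeta> \<in> space M. \<exists>!w. w \<in> U \<and> deriv (in_wcoord (poly_with_zeros X m \<zeta>)) w = 0} \<in> sets M"
proof -
  have "{\<zeta> \<in> space M. \<exists>!w. w \<in> U \<and> deriv (in_wcoord (poly_with_zeros X m \<zeta>)) w = 0}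
    = {\<zeta> \<in> space M. \<exists>!w. w \<in> U \<and> poly (pderiv (poly_with_zeros X m \<zeta>)) (1 / w) = 0}"
  proof (intro Collect_cong conj_cong refl)
    fix \<zeta>
    have "w \<in> U \<and> deriv (in_wcoord (poly_with_zeros X m \<zeta>)) w = 0 \<longleftrightarrow>
      w \<in> U \<and> poly (pderiv (poly_with_zeros X m \<zeta>)) (1 / w) = 0" for w
      using U(2) deriv_in_wcoord[of w] by (cases "w = 0") auto
    then show "(\<exists>!w. w \<in> U \<and> deriv (in_wcoord (poly_with_zeros X m \<zeta>)) w = 0) \<longleftrightarrow>
      (\<exists>!w. w \<in> U \<and> poly (pderiv (poly_with_zeros X m \<zeta>)) (1 / w) = 0)" by simp
  qed
  also have "\<dots> \<in> sets M"
  proof (rule unique_zero_measurable[OF U(1)])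
    show "continuous_on U (\<lambda>w. poly (pderiv (poly_with_zeros X m \<zeta>)) (1 / w))" for \<zeta>
      using U(2) by (intro continuous_intros) auto
  next
    fix w
    have lf [measurable]: "(\<lambda>z. poly (linear_factor z) u) \<in> borel_measurable \<mu>"
      "(\<lambda>z. poly (pderiv (linear_factor z)) u) \<in> borel_measurable \<mu>" for u
      unfolding poly_linear_factor by measurable
    show "(\<lambda>\<zeta>. poly (pderiv (poly_with_zeros X m \<zeta>)) (1 / w)) \<in> borel_measurable M"
      unfolding poly_with_zeros_def pderiv_mult pderiv_prod[of _ "{..<m}"] poly_add poly_mult poly_sum poly_prod M_def
      by measurable
  qed
  finally show ?thesis .
qed

end

section \<open>Sums of independent samples\<close>

context prob_space
begin

lemma integral_PiM_component:
  fixes f :: "'a \<Rightarrow> real" and m :: nat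
  assumes [measurable]: "f \<in> borel_measurable M" and i: "i < m"
  shows "(\<integral>z. f (z i) \<partial>PiM {..<m} (\<lambda>_. M)) = expectation f"
proof -
  have "expectation f = integral\<^sup>L (distr (PiM {..<m} (\<lambda>_. M)) M (\<lambda>z. z i)) f"
    using i by (subst distr_PiM_component) (auto intro: prob_space_axioms)
  also have "\<dots> = (\<integral>z. f (z i) \<partial>PiM {..<m} (\<lambda>_. M))"
    using i by (intro integral_distr) auto
  finally show ?thesis by simp
qed

lemma prob_space_PiM_lessThan: "prob_space (PiM {..<m::nat} (\<lambda>_. M))"
  by (intro prob_space_PiM prob_space_axioms)

lemma integrable_PiM_component:
  fixes f :: "'a \<Rightarrow> 'b :: {second_countable_topology, banach}" and m :: nat
  assumes [measurable]: "f \<in> borel_measurable M" and b: "\<And>x. norm (f x) \<le> B" and i: "i < m"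
  shows "integrable (PiM {..<m} (\<lambda>_. M)) (\<lambda>z. f (z i))"
proof -
  interpret P: prob_space "PiM {..<m} (\<lambda>_. M)" by (rule prob_space_PiM_lessThan)
  show ?thesis by (rule P.integrable_const_bound[of _ B]) (use b i in auto)
qed

lemma integral_PiM_mult_eq_0:
  fixes f :: "'a \<Rightarrow> real" and m :: nat
  assumes f: "integrable M f" "expectation f = 0" and ij: "i < m" "j < m" "i \<noteq> j"
  shows "(\<integral>z. f (z i) * f (z j) \<partial>PiM {..<m} (\<lambda>_. M)) = 0"
proof -
  interpret product_prob_space "\<lambda>_. M" "{..<m}" by unfold_locales
  \<comment> \<open>Padding with factors 1 turns the product of two terms into one over all
    coordinates, whose integral factorizes.\<close>
  let ?F = "\<lambda>k x. if k \<in> {i, j} then f x else 1"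
  have "(\<integral>z. f (z i) * f (z j) \<partial>PiM {..<m} (\<lambda>_. M)) = (\<integral>z. (\<Prod>k<m. ?F k (z k)) \<partial>PiM {..<m} (\<lambda>_. M))"
  proof (intro Bochner_Integration.integral_cong refl)
    fix z
    have "(\<Prod>k<m. ?F k (z k)) = (\<Prod>k\<in>{i, j}. f (z k))"
      using ij by (intro prod.mono_neutral_cong_right) auto
    then show "f (z i) * f (z j) = (\<Prod>k<m. ?F k (z k))" using ij by simp
  qed
  also have "\<dots> = (\<Prod>k<m. integral\<^sup>L M (?F k))"
  proof (rule product_integral_prod)
    show "integrable M (?F k)" for k using f by (cases "k \<in> {i, j}") auto
  qed simp
  also have "\<dots> = 0"
    using f ij by (intro prod_zero bexI[of _ i]) auto
  finally show ?thesis .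
qed

text \<open>Centred independent terms are orthogonal, so only the diagonal of the expanded square
  survives.\<close>

lemma expectation_sum_square:
  fixes f :: "'a \<Rightarrow> real" and m :: nat
  assumes f [measurable]: "f \<in> borel_measurable M" and b: "\<And>x. \<bar>f x\<bar> \<le> B" and f0: "expectation f = 0"
  shows "(\<integral>z. (\<Sum>j<m. f (z j))\<^sup>2 \<partial>PiM {..<m} (\<lambda>_. M)) = real m * expectation (\<lambda>x. (f x)\<^sup>2)"
proof -
  let ?N = "PiM {..<m} (\<lambda>_. M)"
  interpret P: prob_space ?N by (rule prob_space_PiM_lessThan)
  have int: "integrable M f" by (rule integrable_const_bound[of _ B]) (use b in auto)
  have B0: "0 \<le> B" using b order_trans abs_ge_zero by blast
  have intp: "integrable ?N (\<lambda>z. f (z i) * f (z j))" if "i < m" "j < m" for i j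
    using that b B0 by (intro P.integrable_const_bound[of _ "B * B"]) (auto simp: abs_mult intro!: mult_mono)
  have val: "(\<integral>z. f (z i) * f (z j) \<partial>?N) = (if i = j then expectation (\<lambda>x. (f x)\<^sup>2) else 0)"
    if "i < m" "j < m" for i j
  proof (cases "i = j")
    case True
    then show ?thesis
      using that integral_PiM_component[of "\<lambda>x. (f x)\<^sup>2" j m] by (simp add: power2_eq_square)
  qed (use integral_PiM_mult_eq_0[OF int f0 that] in simp)
  have "(\<integral>z. (\<Sum>j<m. f (z j))\<^sup>2 \<partial>?N) = (\<integral>z. (\<Sum>i<m. \<Sum>j<m. f (z i) * f (z j)) \<partial>?N)"
    by (simp add: power2_eq_square sum_product)
  also have "\<dots> = (\<Sum>i<m. \<integral>z. (\<Sum>j<m. f (z i) * f (z j)) \<partial>?N)"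
    by (rule Bochner_Integration.integral_sum) (auto intro!: Bochner_Integration.integrable_sum intp)
  also have "\<dots> = (\<Sum>i<m. \<Sum>j<m. (\<integral>z. f (z i) * f (z j) \<partial>?N))"
    by (intro sum.cong refl Bochner_Integration.integral_sum) (auto intro: intp)
  also have "\<dots> = (\<Sum>i<m. \<Sum>j<m. if i = j then expectation (\<lambda>x. (f x)\<^sup>2) else 0)"
    using val by (intro sum.cong refl) auto
  also have "\<dots> = real m * expectation (\<lambda>x. (f x)\<^sup>2)" by (simp add: sum.delta)
  finally show ?thesis .
qed

text \<open>Chebyshev's inequality for the centred summands, with the variance bounded by the second
  moment.\<close>

lemma prob_sum_deviation_real:
  fixes g :: "'a \<Rightarrow> real" and m :: nat
  assumes g [measurable]: "g \<in> borel_measurable M" and b: "\<And>x. \<bar>g x\<bar> \<le> B" and t: "0 < t"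
  shows "measure (PiM {..<m} (\<lambda>_. M))
     {z \<in> space (PiM {..<m} (\<lambda>_. M)). t \<le> \<bar>(\<Sum>j<m. g (z j)) - real m * expectation g\<bar>}
     \<le> real m * expectation (\<lambda>x. (g x)\<^sup>2) / t\<^sup>2"
proof -
  let ?N = "PiM {..<m} (\<lambda>_. M)"
  interpret P: prob_space ?N by (rule prob_space_PiM_lessThan)
  have int: "integrable M g" by (rule integrable_const_bound[of _ B]) (use b in auto)
  have B0: "0 \<le> B" using b order_trans abs_ge_zero by blast
  have int2: "integrable M (\<lambda>x. (g x)\<^sup>2)"
    by (rule integrable_const_bound[of _ "B\<^sup>2"]) (use b B0 in \<open>auto simp: abs_le_square_iff[symmetric]\<close>)
  define f where "f x = g x - expectation g" for x
  have [measurable]: "f \<in> borel_measurable M" unfolding f_def[abs_def] by measurable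
  have fb: "\<bar>f x\<bar> \<le> B + \<bar>expectation g\<bar>" for x using b[of x] unfolding f_def by linarith
  have f0: "expectation f = 0" unfolding f_def[abs_def] using int by (simp add: prob_space)
  have eq: "(\<Sum>j<m. g (z j)) - real m * expectation g = (\<Sum>j<m. f (z j))" for z
    by (simp add: f_def sum_subtractf)
  have "integrable ?N (\<lambda>z. (\<Sum>j<m. f (z j))\<^sup>2)"
  proof (rule P.integrable_const_bound[of _ "(real m * (B + \<bar>expectation g\<bar>))\<^sup>2"])
    have "\<bar>\<Sum>j<m. f (z j)\<bar> \<le> real m * (B + \<bar>expectation g\<bar>)" for z
      using sum_norm_bound[of "{..<m}" "\<lambda>j. f (z j)"] fb by simp
    then show "AE z in ?N. norm ((\<Sum>j<m. f (z j))\<^sup>2) \<le> (real m * (B + \<bar>expectation g\<bar>))\<^sup>2"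
      by (intro AE_I2) (metis norm_power real_norm_def power_mono abs_ge_zero)
  qed measurable
  then have "P.prob {z \<in> space ?N. t\<^sup>2 \<le> (\<Sum>j<m. f (z j))\<^sup>2} \<le> (\<integral>z. (\<Sum>j<m. f (z j))\<^sup>2 \<partial>?N) / t\<^sup>2"
    using t by (intro integral_Markov_inequality_measure[where A = "{}"]) auto
  also have "\<dots> = real m * expectation (\<lambda>x. (f x)\<^sup>2) / t\<^sup>2"
    by (subst expectation_sum_square[OF _ fb f0]) auto
  also have "expectation (\<lambda>x. (f x)\<^sup>2) \<le> expectation (\<lambda>x. (g x)\<^sup>2)"
    unfolding f_def using variance_eq[OF int int2] by simp
  then have "real m * expectation (\<lambda>x. (f x)\<^sup>2) / t\<^sup>2 \<le> real m * expectation (\<lambda>x. (g x)\<^sup>2) / t\<^sup>2"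
    by (intro divide_right_mono mult_left_mono) auto
  finally show ?thesis unfolding eq using t by (simp add: abs_le_square_iff[symmetric])
qed

text \<open>A large modulus forces the real or the imaginary part to reach \<open>t / 2\<close>,
  whence the factor 4.\<close>

lemma prob_sum_deviation:
  fixes g :: "'a \<Rightarrow> complex" and m :: nat
  assumes g [measurable]: "g \<in> borel_measurable M" and b: "\<And>x. cmod (g x) \<le> B" and t: "0 < t"
  shows "measure (PiM {..<m} (\<lambda>_. M))
     {z \<in> space (PiM {..<m} (\<lambda>_. M)). t \<le> cmod ((\<Sum>j<m. g (z j)) - of_nat m * expectation g)}
     \<le> 4 * real m * expectation (\<lambda>x. (cmod (g x))\<^sup>2) / t\<^sup>2"
proof -
  let ?N = "PiM {..<m} (\<lambda>_. M)"
  interpret P: prob_space ?N by (rule prob_space_PiM_lessThan)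
  have int: "integrable M g" by (rule integrable_const_bound[of _ B]) (use b in auto)
  have B0: "0 \<le> B" using b order_trans norm_ge_zero by blast
  have RI: "\<bar>Re (g x)\<bar> \<le> B" "\<bar>Im (g x)\<bar> \<le> B" for x
    using order_trans[OF abs_Re_le_cmod b] order_trans[OF abs_Im_le_cmod b] by auto
  have intR: "integrable M (\<lambda>x. (Re (g x))\<^sup>2)"
    by (rule integrable_const_bound[of _ "B\<^sup>2"]) (use B0 RI in \<open>auto simp: abs_le_square_iff[symmetric]\<close>)
  have intI: "integrable M (\<lambda>x. (Im (g x))\<^sup>2)"
    by (rule integrable_const_bound[of _ "B\<^sup>2"]) (use B0 RI in \<open>auto simp: abs_le_square_iff[symmetric]\<close>)
  let ?D = "\<lambda>z. (\<Sum>j<m. g (z j)) - of_nat m * expectation g"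
  let ?R = "{z \<in> space ?N. t / 2 \<le> \<bar>(\<Sum>j<m. Re (g (z j))) - real m * expectation (\<lambda>x. Re (g x))\<bar>}"
  let ?I = "{z \<in> space ?N. t / 2 \<le> \<bar>(\<Sum>j<m. Im (g (z j))) - real m * expectation (\<lambda>x. Im (g x))\<bar>}"
  have Re: "Re (?D z) = (\<Sum>j<m. Re (g (z j))) - real m * expectation (\<lambda>x. Re (g x))"
    and Im: "Im (?D z) = (\<Sum>j<m. Im (g (z j))) - real m * expectation (\<lambda>x. Im (g x))" for z
    using int by (simp_all add: integral_Re integral_Im)
  have "{z \<in> space ?N. t \<le> cmod (?D z)} \<subseteq> ?R \<union> ?I"
  proof
    fix z assume "z \<in> {z \<in> space ?N. t \<le> cmod (?D z)}"
    then have "z \<in> space ?N" "t \<le> \<bar>Re (?D z)\<bar> + \<bar>Im (?D z)\<bar>"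
      using cmod_le[of "?D z"] by auto
    then show "z \<in> ?R \<union> ?I" unfolding Re Im by auto
  qed
  moreover have [measurable]: "?R \<in> sets ?N" "?I \<in> sets ?N" by measurable
  ultimately have "P.prob {z \<in> space ?N. t \<le> cmod (?D z)} \<le> P.prob ?R + P.prob ?I"
    by (intro order_trans[OF P.finite_measure_mono measure_Un_le]) auto
  also have "\<dots> \<le> real m * expectation (\<lambda>x. (Re (g x))\<^sup>2) / (t / 2)\<^sup>2 + real m * expectation (\<lambda>x. (Im (g x))\<^sup>2) / (t / 2)\<^sup>2"
    using t RI by (intro add_mono prob_sum_deviation_real[where B = B]) auto
  also have "\<dots> = 4 * real m * expectation (\<lambda>x. (Re (g x))\<^sup>2 + (Im (g x))\<^sup>2) / t\<^sup>2"
    using intR intI by (simp add: power_divide algebra_simps add_divide_distrib)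
  finally show ?thesis by (simp add: cmod_power2)
qed

lemma prob_sum_ge:
  fixes h :: "'a \<Rightarrow> real" and m :: nat
  assumes h [measurable]: "h \<in> borel_measurable M" and b: "\<And>x. 0 \<le> h x" "\<And>x. h x \<le> B" and t: "0 < t"
  shows "measure (PiM {..<m} (\<lambda>_. M)) {z \<in> space (PiM {..<m} (\<lambda>_. M)). t \<le> (\<Sum>j<m. h (z j))}
     \<le> real m * expectation h / t"
proof -
  let ?N = "PiM {..<m} (\<lambda>_. M)"
  interpret P: prob_space ?N by (rule prob_space_PiM_lessThan)
  have ic: "integrable ?N (\<lambda>z. h (z j))" if "j < m" for j
    using b that by (intro integrable_PiM_component[where B = B]) auto
  then have "P.prob {z \<in> space ?N. t \<le> (\<Sum>j<m. h (z j))} \<le> (\<integral>z. (\<Sum>j<m. h (z j)) \<partial>?N) / t"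
    using t b by (intro integral_Markov_inequality_measure[where A = "{}"]) (auto intro!: sum_nonneg)
  also have "(\<integral>z. (\<Sum>j<m. h (z j)) \<partial>?N) = real m * expectation h"
    using ic by (simp add: Bochner_Integration.integral_sum integral_PiM_component)
  finally show ?thesis .
qed

lemma prob_exists_component:
  fixes m :: nat
  assumes A: "A \<in> events"
  shows "measure (PiM {..<m} (\<lambda>_. M)) {z \<in> space (PiM {..<m} (\<lambda>_. M)). \<exists>j<m. z j \<in> A} \<le> real m * prob A"
proof -
  let ?N = "PiM {..<m} (\<lambda>_. M)"
  interpret P: prob_space ?N by (rule prob_space_PiM_lessThan)
  have ev: "{z \<in> space ?N. z j \<in> A} \<in> sets ?N" if "j < m" for j
  proof -
    have "(\<lambda>z. z j) -` A \<inter> space ?N \<in> sets ?N"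
      using that A by (intro measurable_sets[OF measurable_component_singleton]) auto
    then show ?thesis by (simp add: vimage_def Int_def conj_commute)
  qed
  have pr: "P.prob {z \<in> space ?N. z j \<in> A} = prob A" if "j < m" for j
  proof -
    have "P.prob {z \<in> space ?N. z j \<in> A} = (\<integral>z. indicator A (z j) \<partial>?N)"
    proof -
      have "(\<integral>z. indicator A (z j) \<partial>?N) = (\<integral>z. indicat_real {z \<in> space ?N. z j \<in> A} z \<partial>?N)"
        by (intro Bochner_Integration.integral_cong) (auto simp: indicator_def)
      then show ?thesis using ev[OF that] by (simp add: Int_absorb1)
    qed
    also have "\<dots> = expectation (indicat_real A)"
      using A that by (intro integral_PiM_component) auto
    finally show ?thesis using A sets.sets_into_space[OF A] by (simp add: Int_absorb1)
  qed
  have "{z \<in> space ?N. \<exists>j<m. z j \<in> A} = (\<Union>j<m. {z \<in> space ?N. z j \<in> A})" by auto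
  also have "P.prob \<dots> \<le> (\<Sum>j<m. P.prob {z \<in> space ?N. z j \<in> A})"
    using ev by (intro P.finite_measure_subadditive_finite) auto
  finally show ?thesis using pr by simp
qed

end

text \<open>The first condition makes truncated and full kernels agree on the sample, the second
  bounds the Lipschitz constant of the logarithmic derivative near \<open>w\<close>, and the third
  keeps its value at \<open>w\<close> close to the mean.\<close>

definition typical_sample :: "(real ^ 3) measure \<Rightarrow> complex \<Rightarrow> real \<Rightarrow> real \<Rightarrow> nat \<Rightarrow> (nat \<Rightarrow> real ^ 3) \<Rightarrow> bool" where
  "typical_sample \<mu> w \<tau> t m z \<longleftrightarrow>
     (\<forall>j<m. z j = zero_pt \<or> \<tau> \<le> cmod (w - wcoord (z j))) \<and>
     (\<Sum>j<m. (cmod (recip_far w \<tau> (z j)))\<^sup>2) < t\<^sup>2 \<and>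
     cmod ((\<Sum>j<m. recip_far w \<tau> (z j)) - of_nat m * (\<integral>x. recip_far w \<tau> x \<partial>\<mu>)) < t"

context bounded_density
begin

lemma typical_sample_sets:
  "{z \<in> space (PiM {..<m} (\<lambda>_. \<mu>)). \<not> typical_sample \<mu> w \<tau> t m z} \<in> sets (PiM {..<m} (\<lambda>_. \<mu>))"
  unfolding typical_sample_def by measurable

text \<open>With truncation at \<open>K / N\<close>, a close sample has probability at most
  \<open>N * O(N^-2)\<close>. The truncated second moment is \<open>O(N powr \<kappa>)\<close>, so
  Markov and Chebyshev at scale \<open>\<eta> * N\<close> both give
  \<open>N * O(N powr \<kappa>) / N^2\<close>.\<close>

lemma prob_not_typical_sample:
  assumes \<kappa>: "0 < \<kappa>" "\<kappa> < 1" and K: "0 < K" and \<eta>: "0 < \<eta>"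
  obtains C where "C > 0"
    "\<And>N m w. 1 \<le> N \<Longrightarrow> m \<le> N \<Longrightarrow>
      measure (PiM {..<m} (\<lambda>_. \<mu>)) {z \<in> space (PiM {..<m} (\<lambda>_. \<mu>)). \<not> typical_sample \<mu> w (K / N) (\<eta> * N) m z}
        \<le> C * real N powr (\<kappa> - 1)"
proof -
  obtain C1 where C1: "C1 > 0"
    "\<And>w t. 0 \<le> t \<Longrightarrow> prob {z \<in> space \<mu>. z \<noteq> zero_pt \<and> cmod (w - wcoord z) < t} \<le> C1 * t\<^sup>2"
    using prob_close by blast
  obtain M where M: "M > 0"
    "\<And>w \<tau>. 0 < \<tau> \<Longrightarrow> (\<integral>z. (cmod (recip_far w \<tau> z))\<^sup>2 \<partial>\<mu>) \<le> M * \<tau> powr - \<kappa>"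
    by (rule recip_far_moments[OF \<kappa>], rule that)
  \<comment> \<open>The first term comes from close samples; 5 is 1 from Markov's inequality plus 4
    from Chebyshev's.\<close>
  define C where "C = C1 * K\<^sup>2 + 5 * M * K powr - \<kappa> / \<eta>\<^sup>2"
  have "C > 0" using C1 M K \<eta> by (auto simp: C_def intro!: add_pos_nonneg)
  then show thesis
  proof (rule that)
    fix N m :: nat and w
    assume N: "1 \<le> N" and m: "m \<le> N"
    define \<tau> where "\<tau> = K / N"
    define t where "t = \<eta> * N"
    have \<tau>: "0 < \<tau>" and t: "0 < t" using N K \<eta> by (auto simp: \<tau>_def t_def)
    let ?N = "PiM {..<m} (\<lambda>_. \<mu>)"
    interpret P: prob_space ?N by (rule prob_space_PiM_lessThan)
    let ?A = "{z \<in> space \<mu>. z \<noteq> zero_pt \<and> cmod (w - wcoord z) < \<tau>}"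
    let ?B1 = "{z \<in> space ?N. \<exists>j<m. z j \<in> ?A}"
    let ?B2 = "{z \<in> space ?N. t\<^sup>2 \<le> (\<Sum>j<m. (cmod (recip_far w \<tau> (z j)))\<^sup>2)}"
    let ?B3 = "{z \<in> space ?N. t \<le> cmod ((\<Sum>j<m. recip_far w \<tau> (z j)) - of_nat m * (\<integral>x. recip_far w \<tau> x \<partial>\<mu>))}"
    define E where "E = (\<integral>z. (cmod (recip_far w \<tau> z))\<^sup>2 \<partial>\<mu>)"
    have E0: "0 \<le> E" unfolding E_def by simp
    have E: "E \<le> M * \<tau> powr - \<kappa>" unfolding E_def by (rule M(2)[OF \<tau>])
    have A: "?A \<in> sets \<mu>" by measurable
    have "?B1 \<in> sets ?N" "?B2 \<in> sets ?N" "?B3 \<in> sets ?N" using A by measurable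
    moreover have "{z \<in> space ?N. \<not> typical_sample \<mu> w \<tau> t m z} \<subseteq> ?B1 \<union> (?B2 \<union> ?B3)"
    proof
      fix z assume "z \<in> {z \<in> space ?N. \<not> typical_sample \<mu> w \<tau> t m z}"
      moreover have "z j \<in> S2" if "j < m" "z \<in> space ?N" for j
        using that by (auto simp: space_PiM)
      ultimately show "z \<in> ?B1 \<union> (?B2 \<union> ?B3)" unfolding typical_sample_def space_\<mu> by fastforce
    qed
    ultimately have "P.prob {z \<in> space ?N. \<not> typical_sample \<mu> w \<tau> t m z} \<le> P.prob ?B1 + (P.prob ?B2 + P.prob ?B3)"
      by (intro order_trans[OF P.finite_measure_mono order_trans[OF measure_Un_le add_left_mono[OF measure_Un_le]]]) auto
    also have "\<dots> \<le> real m * prob ?A + (real m * E / t\<^sup>2 + 4 * real m * E / t\<^sup>2)"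
    proof (intro add_mono)
      show "P.prob ?B1 \<le> real m * prob ?A" by (rule prob_exists_component[OF A])
      have "(cmod (recip_far w \<tau> x))\<^sup>2 \<le> (1 / \<tau>)\<^sup>2" for x
        using cmod_recip_far_le[OF \<tau>, of w x] by (intro power_mono) auto
      then show "P.prob ?B2 \<le> real m * E / t\<^sup>2"
        unfolding E_def using t by (intro prob_sum_ge[where B = "(1 / \<tau>)\<^sup>2"]) auto
      show "P.prob ?B3 \<le> 4 * real m * E / t\<^sup>2"
        unfolding E_def using cmod_recip_far_le[OF \<tau>] t by (intro prob_sum_deviation[where B = "1 / \<tau>"]) auto
    qed
    also have "\<dots> = real m * prob ?A + 5 * real m * E / t\<^sup>2"
      by (simp add: add_divide_distrib[symmetric])
    also have "\<dots> \<le> real N * (C1 * \<tau>\<^sup>2) + 5 * real N * (M * \<tau> powr - \<kappa>) / t\<^sup>2"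
      using m t C1(1) C1(2)[of \<tau> w] M(1) E E0 \<tau>
      by (intro add_mono mult_mono divide_right_mono) auto
    also have "\<dots> \<le> C * real N powr (\<kappa> - 1)"
    proof -
      have N0: "real N > 0" using N by simp
      have "real N * (C1 * \<tau>\<^sup>2) = C1 * K\<^sup>2 * (1 / real N)"
        using N0 by (simp add: \<tau>_def power2_eq_square)
      also have "1 / real N = real N powr - 1" using N0 by (simp add: powr_minus_divide)
      also have "real N powr - 1 \<le> real N powr (\<kappa> - 1)" using N \<kappa> by (intro powr_mono) auto
      finally have 1: "real N * (C1 * \<tau>\<^sup>2) \<le> C1 * K\<^sup>2 * real N powr (\<kappa> - 1)"
        using C1(1) by (simp add: mult_left_mono)
      have "\<tau> powr - \<kappa> = K powr - \<kappa> / real N powr - \<kappa>"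
        using N0 K by (simp add: \<tau>_def powr_divide del: powr_minus)
      also have "real N powr - \<kappa> = inverse (real N powr \<kappa>)" by (rule powr_minus)
      finally have "\<tau> powr - \<kappa> = K powr - \<kappa> * real N powr \<kappa>"
        by (simp only: divide_inverse inverse_inverse_eq)
      moreover have "real N powr (\<kappa> - 1) = real N powr \<kappa> / real N"
        using N0 by (simp add: powr_diff)
      ultimately have 2: "5 * real N * (M * \<tau> powr - \<kappa>) / t\<^sup>2 = 5 * M * K powr - \<kappa> / \<eta>\<^sup>2 * real N powr (\<kappa> - 1)"
        using N0 \<eta> by (simp add: t_def power2_eq_square)
      show ?thesis using 1 unfolding 2 C_def by (simp add: distrib_right)
    qed
    finally show "P.prob {z \<in> space ?N. \<not> typical_sample \<mu> w (K / N) (\<eta> * N) m z} \<le> C * real N powr (\<kappa> - 1)"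
      unfolding \<tau>_def t_def .
  qed
qed

end

section \<open>Unique critical points\<close>

text \<open>Off \<open>zero_pt\<close> the maps \<open>wcoord\<close> and \<open>inv_stereo\<close>
  are mutually inverse, and the separate clause of \<open>is_critical_pt\<close> at
  \<open>zero_pt\<close> does not arise on \<open>G\<close>.\<close>

lemma unique_critical_pt_iff:
  assumes G: "\<And>x. x \<in> G \<Longrightarrow> x \<in> S2 \<and> x \<noteq> zero_pt \<and> wcoord x \<noteq> 0"
  shows "(\<exists>!x. x \<in> G \<and> is_critical_pt p x) \<longleftrightarrow>
    (\<exists>!w. inv_stereo w \<in> G \<and> deriv (in_wcoord p) w = 0)"
proof -
  have crit: "is_critical_pt p x \<longleftrightarrow> deriv (in_wcoord p) (wcoord x) = 0" if "x \<in> G" for x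
    using G[OF that] wcoord_eq_0_iff[of x] by (simp add: is_critical_pt_def)
  have inv: "inv_stereo (wcoord x) = x" if "x \<in> G" for x
    using G[OF that] by (simp add: inv_stereo_wcoord)
  show ?thesis
  proof
    assume "\<exists>!x. x \<in> G \<and> is_critical_pt p x"
    then obtain x where x: "x \<in> G" "is_critical_pt p x"
      "\<And>y. y \<in> G \<Longrightarrow> is_critical_pt p y \<Longrightarrow> y = x" by blast
    show "\<exists>!w. inv_stereo w \<in> G \<and> deriv (in_wcoord p) w = 0"
    proof (rule ex1I[of _ "wcoord x"])
      show "inv_stereo (wcoord x) \<in> G \<and> deriv (in_wcoord p) (wcoord x) = 0"
        using x(1,2) crit inv by simp
      fix w assume "inv_stereo w \<in> G \<and> deriv (in_wcoord p) w = 0"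
      then have "inv_stereo w = x" using crit[of "inv_stereo w"] x(3)[of "inv_stereo w"] by simp
      then show "w = wcoord x" by auto
    qed
  next
    assume "\<exists>!w. inv_stereo w \<in> G \<and> deriv (in_wcoord p) w = 0"
    then obtain w where w: "inv_stereo w \<in> G" "deriv (in_wcoord p) w = 0"
      "\<And>v. inv_stereo v \<in> G \<Longrightarrow> deriv (in_wcoord p) v = 0 \<Longrightarrow> v = w" by blast
    show "\<exists>!x. x \<in> G \<and> is_critical_pt p x"
    proof (rule ex1I[of _ "inv_stereo w"])
      show "inv_stereo w \<in> G \<and> is_critical_pt p (inv_stereo w)" using w(1,2) crit[OF w(1)] by simp
      fix x assume x: "x \<in> G \<and> is_critical_pt p x"
      then have "wcoord x = w" using crit[of x] inv[of x] w(3)[of "wcoord x"] by simp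
      then show "x = inv_stereo w" using inv[of x] x by simp
    qed
  qed
qed

lemma eventually_powr_neg_le:
  assumes "0 < p" "0 < e"
  shows "\<forall>\<^sub>F N in sequentially. C * real N powr - p \<le> e"
proof -
  have "((\<lambda>N. real N powr - p) \<longlongrightarrow> 0) sequentially"
    using assms by (intro tendsto_neg_powr filterlim_real_sequentially) auto
  then have "((\<lambda>N. C * real N powr - p) \<longlongrightarrow> C * 0) sequentially" by (intro tendsto_mult_left)
  then have "\<forall>\<^sub>F N in sequentially. C * real N powr - p < e"
    using assms by (intro order_tendstoD) auto
  then show ?thesis by eventually_elim simp
qed

section \<open>Location of the averaged critical points and the deterministic argument\<close>

context bounded_density
begin

text \<open>
  The equation says \<open>1 / (w\<^sub>0 - \<xi>) = N / w\<^sub>0 - (N - 1) \<phi> w\<^sub>0\<close>, and the left side has modulus between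
  \<open>N / b\<close> and \<open>N / a\<close>.
\<close>

lemma avg_critical_pt_compact:
  assumes "0 < a" "0 < b"
  obtains c A where "0 < c" "1 \<le> A" "\<And>N \<xi> x. 1 \<le> N \<Longrightarrow> is_avg_critical_pt \<mu> a b N \<xi> x \<Longrightarrow>
    c \<le> cmod (wcoord x) \<and> 1 + (cmod (wcoord x))\<^sup>2 \<le> A\<^sup>2"
proof -
  obtain M where M: "M > 0" "\<And>w. cmod (\<phi> \<mu> w) \<le> M" using \<phi>_bounded by blast
  obtain R where R: "R > 0" "\<And>w. R \<le> cmod w \<Longrightarrow> cmod (\<phi> \<mu> w) < 1 / (2 * b)"
    using \<phi>_tendsto_0[of "1 / (2 * b)"] assms by auto
  \<comment> \<open>The lower bound \<open>c\<close> comes from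
    \<open>N / |w| \<le> N / a + N * M\<close>. For the upper one, beyond \<open>R\<close> the mean
    field supplies at most half of \<open>1 / b\<close>, so \<open>1 / |w|\<close> supplies the
    other half and \<open>|w| \<le> 2 * b\<close>.\<close>
  define c where "c = 1 / (1 / a + M)"
  define A where "A = 1 + R + 2 * b"
  have "0 < c" using assms M by (simp add: c_def add_pos_pos)
  then show thesis
  proof
    show "1 \<le> A" using assms R by (simp add: A_def)
    fix N :: nat and \<xi> x
    assume N: "1 \<le> N" and x: "is_avg_critical_pt \<mu> a b N \<xi> x"
    define w where "w = wcoord x"
    define d where "d = w - wcoord \<xi>"
    have lin: "p = q + x \<and> q = p - x" if "- p + q + x = 0" for p q x :: complex
    proof -
      have "p = p + (- p + q + x)" using that by simp
      then have "p = q + x" by simp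
      then show ?thesis by simp
    qed
    have N0: "real N > 0" using N by simp
    have w0: "w \<noteq> 0" using x wcoord_eq_0_iff[of x] by (auto simp: is_avg_critical_pt_def w_def)
    have eq: "- (of_nat N / w) + 1 / d + (of_nat N - 1) * \<phi> \<mu> w = 0"
      and d: "a / N \<le> cmod d" "cmod d \<le> b / N"
      using x by (auto simp: is_avg_critical_pt_def w_def d_def)
    have d0: "cmod d > 0" using d(1) assms N0 by (meson divide_pos_pos less_le_trans)
    have d1: "real N / b \<le> 1 / cmod d" "1 / cmod d \<le> real N / a"
      using d d0 assms N0 by (simp_all add: field_simps)
    have nphi: "cmod ((of_nat N - 1) * \<phi> \<mu> w) \<le> real N * cmod (\<phi> \<mu> w)"
    proof -
      have "of_nat N - 1 = (of_nat (N - 1) :: complex)" using N by (simp add: of_nat_diff)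
      then have "cmod (of_nat N - 1) \<le> real N" by (simp del: of_nat_diff)
      then show ?thesis by (simp add: norm_mult mult_right_mono)
    qed
    have "of_nat N / w = 1 / d + (of_nat N - 1) * \<phi> \<mu> w"
      using lin[OF eq] by blast
    then have "cmod (of_nat N / w) \<le> cmod (1 / d) + cmod ((of_nat N - 1) * \<phi> \<mu> w)"
      by (metis norm_triangle_ineq)
    then have "real N / cmod w \<le> real N / a + real N * M"
      using d1 nphi mult_left_mono[OF M(2)[of w], of "real N"] by (simp add: norm_divide)
    also have "\<dots> = real N / c" by (simp add: c_def distrib_left)
    finally have 1: "c \<le> cmod w"
      using N0 w0 \<open>0 < c\<close> by (simp add: field_simps)
    have "1 / d = of_nat N / w - (of_nat N - 1) * \<phi> \<mu> w"
      using lin[OF eq] by blast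
    then have "cmod (1 / d) \<le> cmod (of_nat N / w) + cmod ((of_nat N - 1) * \<phi> \<mu> w)"
      by (metis norm_triangle_ineq4)
    then have "real N * (1 / b) \<le> real N * (1 / cmod w + cmod (\<phi> \<mu> w))"
      using d1 nphi by (simp add: norm_divide distrib_left)
    then have 2: "1 / b \<le> 1 / cmod w + cmod (\<phi> \<mu> w)" using N0 by (simp only: mult_le_cancel_left_pos)
    have "cmod w \<le> R + 2 * b"
    proof (cases "R \<le> cmod w")
      case True
      then have "cmod (\<phi> \<mu> w) < 1 / (2 * b)" by (rule R(2))
      moreover have "1 / b = 1 / (2 * b) + 1 / (2 * b)" by simp
      ultimately have "1 / (2 * b) \<le> 1 / cmod w" using 2 by linarith
      then show ?thesis using w0 assms R by (simp add: field_simps)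
    qed (use assms in simp)
    then have "(cmod w)\<^sup>2 \<le> (R + 2 * b)\<^sup>2" by (intro power_mono) auto
    moreover have "1 + (R + 2 * b)\<^sup>2 \<le> A\<^sup>2" using R assms by (simp add: A_def power2_eq_square algebra_simps)
    ultimately show "c \<le> cmod (wcoord x) \<and> 1 + (cmod (wcoord x))\<^sup>2 \<le> A\<^sup>2"
      using 1 by (simp add: w_def)
  qed
qed


text \<open>The deterministic half: all randomness is in \<open>typical_sample\<close>. Distances
  are of order \<open>1 / N\<close> and kernel sums of order \<open>N\<close>, so the powers of
  \<open>N\<close> cancel in the contraction conditions and leave smallness conditions on
  \<open>\<eta>\<close> alone.\<close>

lemma typical_imp_unique_critical:
  fixes X :: "(real ^ 3) set" and m N :: nat and a b c r s A \<rho> \<eta> :: real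
  assumes N: "1 \<le> N" and X: "finite X" "card X + m = N" "\<xi> \<in> X" "\<And>x. x \<in> X \<Longrightarrow> x \<noteq> zero_pt"
    and s: "0 < s"
    and sep: "\<And>x y. x \<in> X \<Longrightarrow> y \<in> X \<Longrightarrow> x \<noteq> y \<Longrightarrow> s < cmod (wcoord x - wcoord y)"
    and x0: "is_avg_critical_pt \<mu> a b N \<xi> x\<^sub>0" and ab: "0 < a" "0 < b"
    and c: "0 < c" "c \<le> cmod (wcoord x\<^sub>0)" and A: "1 \<le> A" "1 + (cmod (wcoord x\<^sub>0))\<^sup>2 \<le> A\<^sup>2"
    and r: "0 < r" and \<rho>: "\<rho> = r * A\<^sup>2" and \<eta>: "0 < \<eta>" "\<eta> \<le> 1"
    and \<eta>1: "\<eta> * (b * (b + \<rho>) * (4 + 12 * \<rho>)) \<le> r / 8" "\<eta> * (b * (4 + 12 * (2 * \<rho> + b))) \<le> 1 / 2"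
    and large: "r / N \<le> 1" "r / N * A \<le> 1" "2 * \<rho> / N \<le> c" "b / N \<le> s / 2" "2 * \<rho> / N \<le> s / 2"
    and sepsum: "8 * sqrt (card X) / s \<le> \<eta> * N"
    and far: "cmod (\<phi> \<mu> (wcoord x\<^sub>0) - (\<integral>x. recip_far (wcoord x\<^sub>0) (2 * \<rho> / N) x \<partial>\<mu>)) \<le> \<eta>"
    and cardX: "card X * cmod (\<phi> \<mu> (wcoord x\<^sub>0)) \<le> \<eta> * N" and Nc: "N / c\<^sup>2 \<le> (\<eta> * N)\<^sup>2"
    and ts: "typical_sample \<mu> (wcoord x\<^sub>0) (2 * \<rho> / N) (\<eta> * N) m \<zeta>"
  shows "\<exists>!x. x \<in> geodesic_disk x\<^sub>0 (r / N) \<and> is_critical_pt (poly_with_zeros X m \<zeta>) x"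
proof -
  define w\<^sub>0 where "w\<^sub>0 = wcoord x\<^sub>0"
  define u where "u = wcoord \<xi>"
  define D where "D = {w. inv_stereo w \<in> geodesic_disk x\<^sub>0 (r / N)}"
  define H where "H w = - (of_nat N / w) + (\<Sum>z\<in>X - {\<xi>}. recip w z) + (\<Sum>j<m. recip w (\<zeta> j))" for w
  have N0: "real N > 0" using N by simp
  have \<rho>0: "0 < \<rho>" using r A by (simp add: \<rho>)
  have "1 \<le> A\<^sup>2" using A(1) by simp
  then have r\<rho>: "r / 4 \<le> \<rho>" using r mult_left_mono[of 1 "A\<^sup>2" r] unfolding \<rho> by linarith
  have x0': "x\<^sub>0 \<in> S2" "x\<^sub>0 \<noteq> zero_pt" using x0 by (auto simp: is_avg_critical_pt_def)
  have w0: "cmod w\<^sub>0 \<ge> c" "w\<^sub>0 \<noteq> 0" using c by (auto simp: w\<^sub>0_def)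
  have d: "cmod (w\<^sub>0 - u) \<le> b / N" "w\<^sub>0 \<noteq> u"
    using x0 ab N0 by (auto simp: is_avg_critical_pt_def w\<^sub>0_def u_def divide_le_0_iff)
  have eq: "- (of_nat N / w\<^sub>0) + 1 / (w\<^sub>0 - u) + (of_nat N - 1) * \<phi> \<mu> w\<^sub>0 = 0"
    using x0 by (auto simp: is_avg_critical_pt_def w\<^sub>0_def u_def)
  have disk: "x \<in> S2 \<and> x \<noteq> zero_pt \<and> cmod (wcoord x - w\<^sub>0) < \<rho> / N" if "x \<in> geodesic_disk x\<^sub>0 (r / N)" for x
    using geodesic_disk_wcoord[OF x0', of A "r / N" x] A large(1,2) r N0 that by (simp add: w\<^sub>0_def \<rho>)
  have D2: "D \<subseteq> ball w\<^sub>0 (\<rho> / N)"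
  proof
    fix w assume "w \<in> D"
    then have "cmod (w - w\<^sub>0) < \<rho> / N" using disk[of "inv_stereo w"] by (simp add: D_def)
    then show "w \<in> ball w\<^sub>0 (\<rho> / N)" by (simp add: dist_norm norm_minus_commute)
  qed
  have D1: "ball w\<^sub>0 (r / 4 / N) \<subseteq> D"
    using ball_subset_geodesic_disk[OF x0', of "r / N"] r N0 large(1)
    by (auto simp: D_def w\<^sub>0_def dist_norm norm_minus_commute)
  have nz: "w \<noteq> 0" if "w \<in> ball w\<^sub>0 (\<rho> / N)" for w
  proof
    assume "w = 0"
    then have "cmod w\<^sub>0 < \<rho> / N" using that by simp
    also have "\<rho> / N \<le> 2 * \<rho> / N" using \<rho>0 by (simp add: divide_right_mono)
    finally show False using large(3) w0(1) by simp
  qed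
  have zX: "s / 2 \<le> cmod (w\<^sub>0 - wcoord z)" "2 * (\<rho> / N) \<le> cmod (w\<^sub>0 - wcoord z)"
    if z: "z \<in> X - {\<xi>}" for z
  proof -
    have "s < cmod (wcoord z - u)" using sep[of z \<xi>] z X(3) by (auto simp: u_def)
    also have "\<dots> \<le> cmod (w\<^sub>0 - u) + cmod (w\<^sub>0 - wcoord z)"
      using norm_triangle_ineq4[of "w\<^sub>0 - u" "w\<^sub>0 - wcoord z"] by simp
    finally show 1: "s / 2 \<le> cmod (w\<^sub>0 - wcoord z)" using d(1) large(4) by linarith
    then show "2 * (\<rho> / N) \<le> cmod (w\<^sub>0 - wcoord z)" using large(5) by simp
  qed
  have ts': "\<zeta> j = zero_pt \<or> 2 * (\<rho> / N) \<le> cmod (w\<^sub>0 - wcoord (\<zeta> j))" if "j < m" for j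
    using ts that by (simp add: typical_sample_def w\<^sub>0_def)
  \<comment> \<open>At \<open>zero_pt\<close> the convention \<open>wcoord zero_pt = 0\<close> may
    trigger the truncation, but both kernels are 0 there.\<close>
  have rf: "recip_far w\<^sub>0 (2 * \<rho> / N) (\<zeta> j) = recip w\<^sub>0 (\<zeta> j)" if "j < m" for j
    using ts'[OF that] by (auto simp: recip_far_def recip_def)
  have t2: "(\<Sum>j<m. (cmod (recip w\<^sub>0 (\<zeta> j)))\<^sup>2) < (\<eta> * N)\<^sup>2"
    and t3: "cmod ((\<Sum>j<m. recip w\<^sub>0 (\<zeta> j)) - of_nat m * (\<integral>x. recip_far w\<^sub>0 (2 * \<rho> / N) x \<partial>\<mu>)) < \<eta> * N"
    using ts rf by (simp_all add: typical_sample_def w\<^sub>0_def)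
  have S1: "(\<Sum>z\<in>X - {\<xi>}. cmod (recip w\<^sub>0 z)) \<le> \<eta> * N"
  proof -
    have "(\<Sum>z\<in>X - {\<xi>}. cmod (recip w\<^sub>0 z)) = (\<Sum>z\<in>X - {\<xi>}. 1 / cmod (w\<^sub>0 - wcoord z))"
      using X(4) by (intro sum.cong) (auto simp: cmod_recip)
    also have "\<dots> \<le> 8 * sqrt (card (X - {\<xi>})) / s"
      using X(1) s sep zX(1) by (intro sum_inverse_separated_le) auto
    also have "\<dots> \<le> 8 * sqrt (card X) / s"
      using s card_mono[OF X(1), of "X - {\<xi>}"] by (intro divide_right_mono) auto
    finally show ?thesis using sepsum by linarith
  qed
  \<comment> \<open>A sum of squares of nonnegative numbers is at most the square of their
    sum.\<close>
  have S2: "(\<Sum>z\<in>X - {\<xi>}. (cmod (recip w\<^sub>0 z))\<^sup>2) \<le> (\<eta> * N)\<^sup>2"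
  proof -
    have "(\<Sum>z\<in>X - {\<xi>}. (cmod (recip w\<^sub>0 z))\<^sup>2) \<le> (\<Sum>z\<in>X - {\<xi>}. cmod (recip w\<^sub>0 z) * (\<Sum>z\<in>X - {\<xi>}. cmod (recip w\<^sub>0 z)))"
      unfolding power2_eq_square using X(1) by (intro sum_mono mult_left_mono member_le_sum) auto
    also have "\<dots> = (\<Sum>z\<in>X - {\<xi>}. cmod (recip w\<^sub>0 z))\<^sup>2"
      by (simp add: power2_eq_square sum_distrib_right)
    also have "\<dots> \<le> (\<eta> * N)\<^sup>2" using S1 by (intro power_mono sum_nonneg) auto
    finally show ?thesis .
  qed
  have H0: "cmod (H w\<^sub>0 + 1 / (w\<^sub>0 - u)) \<le> 4 * (\<eta> * N)"
  proof -
    define F where "F = (\<integral>x. recip_far w\<^sub>0 (2 * \<rho> / N) x \<partial>\<mu>)"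
    have "1 \<le> card X" using X(1,3) by (simp add: Suc_le_eq card_gt_0_iff) blast
    have Nm: "of_nat N = (of_nat (card X) + of_nat m :: complex)" using X(2) by auto
    \<comment> \<open>The last bracket is the equation of the averaged critical point and vanishes.
      Four errors of size \<open>\<eta> * N\<close> remain: the other points of \<open>X\<close>,
      the fluctuation of the sample, the truncation bias, and the \<open>card X - 1\<close> samples
      by which \<open>m\<close> falls short of \<open>N - 1\<close>.\<close>
    have "H w\<^sub>0 + 1 / (w\<^sub>0 - u) = (\<Sum>z\<in>X - {\<xi>}. recip w\<^sub>0 z) + ((\<Sum>j<m. recip w\<^sub>0 (\<zeta> j)) - of_nat m * F)
        - of_nat m * (\<phi> \<mu> w\<^sub>0 - F) - (of_nat (card X) - 1) * \<phi> \<mu> w\<^sub>0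
        + (- (of_nat N / w\<^sub>0) + 1 / (w\<^sub>0 - u) + (of_nat N - 1) * \<phi> \<mu> w\<^sub>0)"
      unfolding H_def Nm by (simp add: algebra_simps)
    also have "\<dots> = (\<Sum>z\<in>X - {\<xi>}. recip w\<^sub>0 z) + ((\<Sum>j<m. recip w\<^sub>0 (\<zeta> j)) - of_nat m * F)
        - of_nat m * (\<phi> \<mu> w\<^sub>0 - F) - (of_nat (card X) - 1) * \<phi> \<mu> w\<^sub>0" unfolding eq by simp
    also have "cmod \<dots> \<le> cmod (\<Sum>z\<in>X - {\<xi>}. recip w\<^sub>0 z) + cmod ((\<Sum>j<m. recip w\<^sub>0 (\<zeta> j)) - of_nat m * F)
        + cmod (of_nat m * (\<phi> \<mu> w\<^sub>0 - F)) + cmod ((of_nat (card X) - 1) * \<phi> \<mu> w\<^sub>0)"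
      by (intro order_trans[OF norm_triangle_ineq4] add_mono order_trans[OF norm_triangle_ineq] order_refl)
    also have "\<dots> \<le> \<eta> * N + \<eta> * N + \<eta> * N + \<eta> * N"
    proof (intro add_mono)
      show "cmod (\<Sum>z\<in>X - {\<xi>}. recip w\<^sub>0 z) \<le> \<eta> * N" using S1 norm_sum order_trans by blast
      show "cmod ((\<Sum>j<m. recip w\<^sub>0 (\<zeta> j)) - of_nat m * F) \<le> \<eta> * N" using t3 by (simp add: F_def)
      have "real m * cmod (\<phi> \<mu> w\<^sub>0 - F) \<le> real N * \<eta>"
        using far X(2) by (intro mult_mono) (auto simp: F_def w\<^sub>0_def)
      then show "cmod (of_nat m * (\<phi> \<mu> w\<^sub>0 - F)) \<le> \<eta> * N" by (simp add: norm_mult mult.commute)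
      have "of_nat (card X) - 1 = (of_nat (card X - 1) :: complex)" using \<open>1 \<le> card X\<close> by (simp add: of_nat_diff)
      then have "cmod (of_nat (card X) - 1) \<le> real (card X)" by (simp del: of_nat_diff)
      then have "cmod ((of_nat (card X) - 1) * \<phi> \<mu> w\<^sub>0) \<le> card X * cmod (\<phi> \<mu> w\<^sub>0)"
        unfolding norm_mult by (rule mult_right_mono) simp
      then show "cmod ((of_nat (card X) - 1) * \<phi> \<mu> w\<^sub>0) \<le> \<eta> * N" using cardX by (simp add: w\<^sub>0_def)
    qed
    finally show ?thesis by simp
  qed
  have HL: "cmod (H v - H v') \<le> 12 * (\<eta> * N)\<^sup>2 * cmod (v - v')"
    if v: "v \<in> ball w\<^sub>0 (\<rho> / N)" and v': "v' \<in> ball w\<^sub>0 (\<rho> / N)" for v v'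
  proof -
    let ?t = "\<rho> / N"
    have vt: "cmod (v - w\<^sub>0) \<le> ?t" "cmod (v' - w\<^sub>0) \<le> ?t"
      using v v' by (auto simp: dist_norm norm_minus_commute)
    have t0: "?t > 0" using \<rho>0 N0 by simp
    have 1: "cmod (1 / v - 1 / v') \<le> 4 * cmod (v - v') * (1 / c\<^sup>2)"
    proof -
      have "2 * ?t \<le> cmod w\<^sub>0" using large(3) w0(1) by simp
      then have "cmod (1 / v - 1 / v') \<le> 4 * cmod (v - v') * (1 / cmod w\<^sub>0)\<^sup>2"
        using inverse_diff_le[of v w\<^sub>0 0 v'] vt w0(2) by simp
      also have "\<dots> \<le> 4 * cmod (v - v') * (1 / c)\<^sup>2"
        using w0(1) c(1) by (intro mult_left_mono power_mono divide_left_mono mult_pos_pos) auto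
      finally show ?thesis by (simp add: power_divide)
    qed
    have "H v - H v' = - of_nat N * (1 / v - 1 / v') + (\<Sum>z\<in>X - {\<xi>}. recip v z - recip v' z)
        + (\<Sum>j<m. recip v (\<zeta> j) - recip v' (\<zeta> j))"
      by (simp add: H_def sum_subtractf algebra_simps)
    then have "cmod (H v - H v') \<le> cmod (- of_nat N * (1 / v - 1 / v')) + cmod (\<Sum>z\<in>X - {\<xi>}. recip v z - recip v' z)
        + cmod (\<Sum>j<m. recip v (\<zeta> j) - recip v' (\<zeta> j))"
      by (simp only:) (intro order_trans[OF norm_triangle_ineq] add_mono order_refl norm_triangle_ineq)
    also have "\<dots> \<le> real N * (4 * cmod (v - v') * (1 / c\<^sup>2))
        + (\<Sum>z\<in>X - {\<xi>}. 4 * cmod (v - v') * (cmod (recip w\<^sub>0 z))\<^sup>2)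
        + (\<Sum>j<m. 4 * cmod (v - v') * (cmod (recip w\<^sub>0 (\<zeta> j)))\<^sup>2)"
    proof (intro add_mono order_trans[OF norm_sum] sum_mono)
      show "cmod (- of_nat N * (1 / v - 1 / v')) \<le> real N * (4 * cmod (v - v') * (1 / c\<^sup>2))"
        using mult_left_mono[OF 1, of "real N"] unfolding norm_mult by simp
      show "cmod (recip v z - recip v' z) \<le> 4 * cmod (v - v') * (cmod (recip w\<^sub>0 z))\<^sup>2" if "z \<in> X - {\<xi>}" for z
        using zX[OF that] t0 s by (intro recip_diff_le[OF _ vt]) auto
      show "cmod (recip v (\<zeta> j) - recip v' (\<zeta> j)) \<le> 4 * cmod (v - v') * (cmod (recip w\<^sub>0 (\<zeta> j)))\<^sup>2"
        if "j \<in> {..<m}" for j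
        using ts'[of j] that t0 by (intro recip_diff_le[OF _ vt]) auto
    qed
    \<comment> \<open>Three sources, each bounded by \<open>(\<eta> * N)^2\<close>: the pole at
      \<open>w = 0\<close>, the prescribed zeros and the samples.\<close>
    also have "\<dots> = 4 * cmod (v - v') * (N / c\<^sup>2 + (\<Sum>z\<in>X - {\<xi>}. (cmod (recip w\<^sub>0 z))\<^sup>2)
        + (\<Sum>j<m. (cmod (recip w\<^sub>0 (\<zeta> j)))\<^sup>2))"
      by (simp add: sum_distrib_left distrib_left)
    also have "\<dots> \<le> 4 * cmod (v - v') * ((\<eta> * N)\<^sup>2 + (\<eta> * N)\<^sup>2 + (\<eta> * N)\<^sup>2)"
      using Nc S2 t2 by (intro mult_left_mono add_mono) auto
    finally show ?thesis by (simp add: mult_ac)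
  qed
  have "\<exists>!w. w \<in> D \<and> 1 + (w - u) * H w = 0"
  \<comment> \<open>Parameters: \<open>b / N\<close> for the distance to \<open>\<xi>\<close>, radii
    \<open>r / (4 * N)\<close> and \<open>\<rho> / N\<close>, error \<open>4 * \<eta> * N\<close>
    and Lipschitz constant \<open>12 * (\<eta> * N)^2\<close>.\<close>
  proof (rule contraction_unique_zero[OF D1 D2 _ _ d(2,1) H0 HL])
    show "0 < r / 4 / N" using r N0 by simp
    show "r / 4 / N \<le> \<rho> / N" using r\<rho> N0 by (intro divide_right_mono) auto
    \<comment> \<open>Makes both conditions linear in \<open>\<eta>\<close>.\<close>
    have \<eta>2: "\<eta>\<^sup>2 \<le> \<eta>" using \<eta> by (simp add: power2_eq_square mult_left_le)
    have "b / N * (b / N + \<rho> / N) * (4 * (\<eta> * N) + 12 * (\<eta> * N)\<^sup>2 * (\<rho> / N))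
        = b * (b + \<rho>) * (4 * \<eta> + 12 * \<eta>\<^sup>2 * \<rho>) / N"
      using N0 by (simp add: power2_eq_square field_simps)
    also have "\<dots> \<le> b * (b + \<rho>) * (4 * \<eta> + 12 * \<eta> * \<rho>) / N"
      using \<eta>2 ab \<rho>0 N0 by (intro divide_right_mono mult_left_mono add_mono mult_right_mono) auto
    also have "\<dots> = \<eta> * (b * (b + \<rho>) * (4 + 12 * \<rho>)) / N" by (simp add: algebra_simps)
    also have "\<dots> \<le> r / 8 / N" using \<eta>1(1) N0 by (intro divide_right_mono) auto
    finally show "b / N * (b / N + \<rho> / N) * (4 * (\<eta> * N) + 12 * (\<eta> * N)\<^sup>2 * (\<rho> / N)) \<le> r / 4 / N / 2" by simp
    have "b / N * (4 * (\<eta> * N) + 12 * (\<eta> * N)\<^sup>2 * (\<rho> / N) + (b / N + \<rho> / N) * (12 * (\<eta> * N)\<^sup>2))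
        = b * (4 * \<eta> + 12 * \<eta>\<^sup>2 * (2 * \<rho> + b))"
      using N0 by (simp add: power2_eq_square field_simps)
    also have "\<dots> \<le> b * (4 * \<eta> + 12 * \<eta> * (2 * \<rho> + b))"
      using \<eta>2 ab \<rho>0 by (intro mult_left_mono add_mono mult_right_mono) auto
    also have "\<dots> = \<eta> * (b * (4 + 12 * (2 * \<rho> + b)))" by (simp add: algebra_simps)
    also note \<eta>1(2)
    finally show "b / N * (4 * (\<eta> * N) + 12 * (\<eta> * N)\<^sup>2 * (\<rho> / N) + (b / N + \<rho> / N) * (12 * (\<eta> * N)\<^sup>2)) \<le> 1 / 2" .
    show "0 \<le> 12 * (\<eta> * real N)\<^sup>2" by (intro mult_nonneg_nonneg zero_le_power2) simp
  qed
  moreover have "w \<in> D \<and> 1 + (w - u) * H w = 0 \<longleftrightarrow>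
      inv_stereo w \<in> geodesic_disk x\<^sub>0 (r / N) \<and> deriv (in_wcoord (poly_with_zeros X m \<zeta>)) w = 0" for w
  proof -
    \<comment> \<open>Every zero other than \<open>\<xi>\<close> and \<open>zero_pt\<close> is at
      least \<open>2 * \<rho> / N\<close> from the centre, hence outside \<open>D\<close>, so the
      logarithmic form of the equation is valid throughout \<open>D\<close>.\<close>
    have "deriv (in_wcoord (poly_with_zeros X m \<zeta>)) w = 0 \<longleftrightarrow> 1 + (w - u) * H w = 0" if "w \<in> D"
    proof -
      have wb: "w \<in> ball w\<^sub>0 (\<rho> / N)" using D2 that by blast
      then have dw: "cmod (w\<^sub>0 - w) < \<rho> / N" by (simp add: dist_norm)
      have "0 < \<rho> / N" using \<rho>0 N0 by simp
      then have "\<rho> / N < 2 * (\<rho> / N)" by linarith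
      then have far: "w \<noteq> wcoord z" if "2 * (\<rho> / N) \<le> cmod (w\<^sub>0 - wcoord z)" for z
        using dw that by auto
      show ?thesis unfolding H_def u_def X(2)[symmetric]
        using zX(2) ts' far X nz[OF wb] by (intro deriv_poly_with_zeros) blast+
    qed
    then show ?thesis by (auto simp: D_def)
  qed
  ultimately have "\<exists>!w. inv_stereo w \<in> geodesic_disk x\<^sub>0 (r / N) \<and> deriv (in_wcoord (poly_with_zeros X m \<zeta>)) w = 0"
    by simp
  moreover have "x \<in> S2 \<and> x \<noteq> zero_pt \<and> wcoord x \<noteq> 0" if "x \<in> geodesic_disk x\<^sub>0 (r / N)" for x
    using disk[OF that] nz[of "wcoord x"] by (simp add: dist_norm norm_minus_commute)
  ultimately show ?thesis by (subst unique_critical_pt_iff) auto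
qed

end

text \<open>\<open>measure\<close> is 0 on sets that are not measurable, so the event has to be
  shown measurable before its probability can be bounded below by monotonicity.\<close>

lemma (in bounded_density) unique_critical_event_sets:
  fixes X :: "(real ^ 3) set" and m :: nat and G :: "'i \<Rightarrow> (real ^ 3) set"
  assumes I: "finite I"
    and G: "\<And>i. i \<in> I \<Longrightarrow> open {w. inv_stereo w \<in> G i}"
      "\<And>i x. i \<in> I \<Longrightarrow> x \<in> G i \<Longrightarrow> x \<in> S2 \<and> x \<noteq> zero_pt \<and> wcoord x \<noteq> 0"
  shows "{\<zeta> \<in> space (PiM {..<m} (\<lambda>_. \<mu>)). \<forall>i\<in>I. \<exists>!x. x \<in> G i \<and> is_critical_pt (poly_with_zeros X m \<zeta>) x}
    \<in> sets (PiM {..<m} (\<lambda>_. \<mu>))"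
proof (rule sets.sets_Collect_finite_All[OF _ I])
  fix i assume i: "i \<in> I"
  have "0 \<notin> {w. inv_stereo w \<in> G i}" using G(2)[OF i, of "inv_stereo 0"] by auto
  from unique_critical_measurable[OF G(1)[OF i] this, of m X]
  show "{\<zeta> \<in> space (PiM {..<m} (\<lambda>_. \<mu>)). \<exists>!x. x \<in> G i \<and> is_critical_pt (poly_with_zeros X m \<zeta>) x}
    \<in> sets (PiM {..<m} (\<lambda>_. \<mu>))"
    by (simp add: unique_critical_pt_iff[OF G(2)[OF i]])
qed

text \<open>\<open>C\<close> is chosen before \<open>n\<close> and \<open>\<Xi>\<close>, so one
  constant serves all configurations; it may depend on \<open>\<mu>\<close>, \<open>a\<close> and
  \<open>b\<close>. The latter two make precise the order \<open>1 / N\<close> of the distance from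
  \<open>\<xi>\<close> to its averaged critical point.\<close>

theorem theorem2:
  fixes \<mu> :: "(real ^ 3) measure" and \<alpha> \<delta> \<epsilon> r a b :: real
  assumes "prob_space \<mu>" and "has_bounded_density \<mu>"
    and "0 \<le> \<alpha>" "\<alpha> < 1" and "0 < \<delta>" "\<delta> < 1 - \<alpha>"
    and "0 < \<epsilon>" "\<epsilon> < 1" and "0 < r" and "0 < a" "a < b"
  shows "\<exists>C>0. \<forall>(n :: nat \<Rightarrow> nat) (\<Xi> :: nat \<Rightarrow> (real ^ 3) set).
    (\<forall>N\<ge>1. 1 \<le> n N \<and> real (n N) \<le> real N powr \<alpha> \<and>
       finite (\<Xi> N) \<and> card (\<Xi> N) = n N \<and> \<Xi> N \<subseteq> S2 - S_exc \<mu>) \<longrightarrow>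
    (\<forall>N\<ge>1. \<forall>\<xi>\<^sub>1\<in>\<Xi> N. \<forall>\<xi>\<^sub>2\<in>\<Xi> N. \<xi>\<^sub>1 \<noteq> \<xi>\<^sub>2 \<longrightarrow>
       cmod (wcoord \<xi>\<^sub>1 - wcoord \<xi>\<^sub>2) > real N powr (- 1 / 2 + \<epsilon> / 2)) \<longrightarrow>
    (\<forall>N\<ge>1. (\<forall>\<xi>\<in>\<Xi> N. avg_critical_pt_defined \<mu> a b N \<xi>) \<longrightarrow>
       (\<forall>\<xi>\<in>\<Xi> N. \<xi> \<notin> geodesic_circle (avg_critical_pt \<mu> a b N \<xi>) (r / real N))) \<longrightarrow>
    (\<forall>N\<ge>1. (\<forall>\<xi>\<in>\<Xi> N. avg_critical_pt_defined \<mu> a b N \<xi>) \<longrightarrow>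
       measure (PiM {..<N - n N} (\<lambda>_. \<mu>))
         {\<zeta> \<in> space (PiM {..<N - n N} (\<lambda>_. \<mu>)).
            \<forall>\<xi>\<in>\<Xi> N. \<exists>!x. x \<in> geodesic_disk (avg_critical_pt \<mu> a b N \<xi>) (r / real N) \<and>
               is_critical_pt (poly_with_zeros (\<Xi> N) (N - n N) \<zeta>) x}
       \<ge> 1 - C * real N powr (- \<delta>))"
proof -
  interpret prob_space \<mu> by fact
  interpret bounded_density \<mu> by unfold_locales fact
  \<comment> \<open>Chosen so that \<open>\<alpha> + (\<kappa> - 1) = - \<delta>\<close>, the
    exponent left by the union bound.\<close>
  define \<kappa> where "\<kappa> = 1 - \<alpha> - \<delta>"
  have \<kappa>: "0 < \<kappa>" "\<kappa> < 1" using assms by (auto simp: \<kappa>_def)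
  have b: "0 < b" using assms by simp
  obtain c A where cA: "0 < c" "1 \<le> A" "\<And>N \<xi> x. 1 \<le> N \<Longrightarrow> is_avg_critical_pt \<mu> a b N \<xi> x \<Longrightarrow>
    c \<le> cmod (wcoord x) \<and> 1 + (cmod (wcoord x))\<^sup>2 \<le> A\<^sup>2"
    by (rule avg_critical_pt_compact[OF \<open>0 < a\<close> b], rule that)
  obtain M0 where M0: "M0 > 0" "\<And>w. cmod (\<phi> \<mu> w) \<le> M0" using \<phi>_bounded by blast
  obtain M1 where M1: "M1 > 0"
    "\<And>w \<tau>. 0 < \<tau> \<Longrightarrow> cmod (\<phi> \<mu> w - (\<integral>z. recip_far w \<tau> z \<partial>\<mu>)) \<le> M1 * \<tau> powr (1 - \<kappa>)"
    by (rule recip_far_moments[OF \<kappa>], rule that)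
  define \<rho> where "\<rho> = r * A\<^sup>2"
  have \<rho>: "0 < \<rho>" using assms cA by (simp add: \<rho>_def)
  then have \<rho>2: "0 < 2 * \<rho>" by simp
  \<comment> \<open>\<open>k1\<close> and \<open>k2\<close> are the coefficients of
    \<open>\<eta>\<close> in the two contraction conditions; \<open>\<eta>\<close> is then the
    largest value up to 1 that meets both.\<close>
  define k1 where "k1 = b * (b + \<rho>) * (4 + 12 * \<rho>)"
  define k2 where "k2 = b * (4 + 12 * (2 * \<rho> + b))"
  have k: "k1 > 0" "k2 > 0" using b \<rho> by (auto simp: k1_def k2_def intro!: mult_pos_pos add_pos_pos)
  define \<eta> where "\<eta> = min 1 (min (r / 8 / k1) (1 / 2 / k2))"
  have \<eta>: "0 < \<eta>" "\<eta> \<le> 1" using k assms by (auto simp: \<eta>_def)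
  have "\<eta> \<le> r / 8 / k1" "\<eta> \<le> 1 / 2 / k2" by (auto simp: \<eta>_def)
  then have \<eta>k: "\<eta> * k1 \<le> r / 8" "\<eta> * k2 \<le> 1 / 2" using k by (simp_all add: field_simps)
  obtain C where C: "C > 0"
    "\<And>N m w. 1 \<le> N \<Longrightarrow> m \<le> N \<Longrightarrow>
      measure (PiM {..<m} (\<lambda>_. \<mu>)) {z \<in> space (PiM {..<m} (\<lambda>_. \<mu>)). \<not> typical_sample \<mu> w (2 * \<rho> / real N) (\<eta> * real N) m z}
        \<le> C * real N powr (\<kappa> - 1)"
    by (rule prob_not_typical_sample[OF \<kappa> \<rho>2 \<eta>(1)], rule that)
  \<comment> \<open>Each largeness condition bounds a constant times a negative power of
    \<open>N\<close>. The exponent \<open>1 / 2 + \<epsilon> / 2\<close> is that of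
    \<open>N * s\<close> for the separation \<open>s\<close>, and
    \<open>1 / 2 + \<epsilon> / 2 - \<alpha> / 2\<close> is positive since
    \<open>\<alpha> < 1\<close>.\<close>
  have ev: "\<forall>\<^sub>F N in sequentially.
      r * real N powr - 1 \<le> 1 \<and> (r * A) * real N powr - 1 \<le> 1 \<and> (2 * \<rho>) * real N powr - 1 \<le> c \<and>
      b * real N powr - (1 / 2 + \<epsilon> / 2) \<le> 1 / 2 \<and> (2 * \<rho>) * real N powr - (1 / 2 + \<epsilon> / 2) \<le> 1 / 2 \<and>
      8 * real N powr - (1 / 2 + \<epsilon> / 2 - \<alpha> / 2) \<le> \<eta> \<and>
      (M1 * (2 * \<rho>) powr (1 - \<kappa>)) * real N powr - (1 - \<kappa>) \<le> \<eta> \<and>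
      M0 * real N powr - (1 - \<alpha>) \<le> \<eta> \<and> (1 / c\<^sup>2) * real N powr - 1 \<le> \<eta>\<^sup>2"
    using assms \<kappa> \<eta> cA(1) by (intro eventually_conj eventually_powr_neg_le) auto
  then obtain N0 where N0: "\<And>N. N \<ge> N0 \<Longrightarrow>
      r * real N powr - 1 \<le> 1 \<and> (r * A) * real N powr - 1 \<le> 1 \<and> (2 * \<rho>) * real N powr - 1 \<le> c \<and>
      b * real N powr - (1 / 2 + \<epsilon> / 2) \<le> 1 / 2 \<and> (2 * \<rho>) * real N powr - (1 / 2 + \<epsilon> / 2) \<le> 1 / 2 \<and>
      8 * real N powr - (1 / 2 + \<epsilon> / 2 - \<alpha> / 2) \<le> \<eta> \<and>
      (M1 * (2 * \<rho>) powr (1 - \<kappa>)) * real N powr - (1 - \<kappa>) \<le> \<eta> \<and>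
      M0 * real N powr - (1 - \<alpha>) \<le> \<eta> \<and> (1 / c\<^sup>2) * real N powr - 1 \<le> \<eta>\<^sup>2"
    unfolding eventually_sequentially by blast
  \<comment> \<open>Stated for a single \<open>N\<close> and a single set \<open>X\<close>, so that
    the constants are independent of the sequences.\<close>
  have main: "1 - (C + real N0 powr \<delta>) * real N powr (- \<delta>) \<le>
      measure (PiM {..<N - card X} (\<lambda>_. \<mu>))
         {\<zeta> \<in> space (PiM {..<N - card X} (\<lambda>_. \<mu>)).
            \<forall>\<xi>\<in>X. \<exists>!x. x \<in> geodesic_disk (avg_critical_pt \<mu> a b N \<xi>) (r / real N) \<and>
               is_critical_pt (poly_with_zeros X (N - card X) \<zeta>) x}"
    if N: "1 \<le> N" and n: "1 \<le> card X" "real (card X) \<le> real N powr \<alpha>" and X: "finite X" "X \<subseteq> S2 - S_exc \<mu>"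
      and sep: "\<And>x y. x \<in> X \<Longrightarrow> y \<in> X \<Longrightarrow> x \<noteq> y \<Longrightarrow> real N powr (- 1 / 2 + \<epsilon> / 2) < cmod (wcoord x - wcoord y)"
      and defd: "\<forall>\<xi>\<in>X. avg_critical_pt_defined \<mu> a b N \<xi>"
    for N and X :: "(real ^ 3) set"
  proof (cases "N0 \<le> N")
    \<comment> \<open>For the finitely many small \<open>N\<close> the summand
      \<open>real N0 powr \<delta>\<close> makes the claimed lower bound at most 0.\<close>
    case False
    then have "real N powr \<delta> \<le> real N0 powr \<delta>" using assms by (intro powr_mono2) auto
    then have "1 \<le> real N0 powr \<delta> * real N powr - \<delta>"
      using N by (simp add: powr_minus field_simps)
    also have "\<dots> \<le> (C + real N0 powr \<delta>) * real N powr - \<delta>" using C(1) by (intro mult_right_mono) auto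
    finally have "1 - (C + real N0 powr \<delta>) * real N powr (- \<delta>) \<le> 0" by simp
    then show ?thesis using measure_nonneg order_trans by blast
  next
    case True
    have Np: "real N > 0" using N by simp
    have inv: "real N powr - 1 = 1 / real N" using Np by (simp add: powr_minus_divide)
    note L = N0[OF True, unfolded inv]
    define s where "s = real N powr (- 1 / 2 + \<epsilon> / 2)"
    have s: "0 < s" using Np by (simp add: s_def)
    have sN: "real N powr - (1 / 2 + \<epsilon> / 2) * s = 1 / real N"
      unfolding s_def powr_add[symmetric] inv[symmetric] by simp
    have large: "r / N \<le> 1" "r / N * A \<le> 1" "2 * \<rho> / N \<le> c" using L by simp_all
    have large': "x / N \<le> s / 2" if "x * real N powr - (1 / 2 + \<epsilon> / 2) \<le> 1 / 2" for x
    proof -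
      have "x / N = (x * real N powr - (1 / 2 + \<epsilon> / 2)) * s" using sN by (simp add: mult.assoc)
      also have "\<dots> \<le> 1 / 2 * s" using that s by (intro mult_right_mono) auto
      finally show ?thesis by simp
    qed
    have sepsum: "8 * sqrt (card X) / s \<le> \<eta> * N"
    proof -
      have "sqrt (card X) \<le> sqrt (real N powr \<alpha>)" using n by simp
      also have "\<dots> = real N powr (\<alpha> / 2)" using Np by (simp add: powr_half_sqrt[symmetric] powr_powr)
      finally have "8 * sqrt (card X) / s \<le> 8 * real N powr (\<alpha> / 2) / s"
        using s by (intro divide_right_mono) auto
      also have "\<dots> = 8 * (real N powr (\<alpha> / 2) / s)" by simp
      also have "real N powr (\<alpha> / 2) / s = real N powr - (1 / 2 + \<epsilon> / 2 - \<alpha> / 2) * real N powr 1"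
        unfolding s_def powr_diff[symmetric] powr_add[symmetric] by (rule arg_cong[of _ _ "\<lambda>x. real N powr x"]) simp
      also have "8 * \<dots> = (8 * real N powr - (1 / 2 + \<epsilon> / 2 - \<alpha> / 2)) * N" using Np by simp
      also have "\<dots> \<le> \<eta> * N" using L by (intro mult_right_mono) auto
      finally show ?thesis .
    qed
    have far: "cmod (\<phi> \<mu> w - (\<integral>x. recip_far w (2 * \<rho> / N) x \<partial>\<mu>)) \<le> \<eta>" for w
    proof -
      have "0 < 2 * \<rho> / N" using \<rho> Np by simp
      from M1(2)[OF this, of w]
      have "cmod (\<phi> \<mu> w - (\<integral>x. recip_far w (2 * \<rho> / N) x \<partial>\<mu>)) \<le> M1 * (2 * \<rho> / N) powr (1 - \<kappa>)" .
      also have "(2 * \<rho> / N) powr (1 - \<kappa>) = (2 * \<rho>) powr (1 - \<kappa>) * real N powr - (1 - \<kappa>)"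
        using \<rho> Np unfolding powr_minus by (subst powr_divide) (auto simp: divide_inverse)
      finally show ?thesis using L by (simp add: mult.assoc)
    qed
    \<comment> \<open>Bounds the effect of prescribing rather than sampling the points of
      \<open>X\<close>: at most \<open>M0 * N powr \<alpha>\<close>, which is
      \<open>o(N)\<close>.\<close>
    have cardX: "card X * cmod (\<phi> \<mu> w) \<le> \<eta> * N" for w
    proof -
      have "card X * cmod (\<phi> \<mu> w) \<le> real N powr \<alpha> * M0" using n M0 by (intro mult_mono) auto
      also have "real N powr \<alpha> = real N powr - (1 - \<alpha>) * real N powr 1" unfolding powr_add[symmetric] by simp
      also have "\<dots> * M0 = (M0 * real N powr - (1 - \<alpha>)) * N" using Np by simp
      also have "\<dots> \<le> \<eta> * N" using L by (intro mult_right_mono) auto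
      finally show ?thesis .
    qed
    have Nc: "N / c\<^sup>2 \<le> (\<eta> * N)\<^sup>2"
    proof -
      have "N / c\<^sup>2 = (1 / c\<^sup>2 * (1 / N)) * (real N)\<^sup>2" using Np by (simp add: power2_eq_square)
      also have "\<dots> \<le> \<eta>\<^sup>2 * (real N)\<^sup>2" using L by (intro mult_right_mono) auto
      finally show ?thesis by (simp add: power_mult_distrib)
    qed
    define m where "m = N - card X"
    have "real N powr \<alpha> \<le> real N powr 1" using N assms by (intro powr_mono) auto
    then have "card X \<le> N" using n(2) Np by simp
    then have m: "card X + m = N" "m \<le> N" by (auto simp: m_def)
    have nz: "x \<noteq> zero_pt" if "x \<in> X" for x using X(2) that by (auto simp: S_exc_def)
    let ?x = "avg_critical_pt \<mu> a b N"
    have avg: "is_avg_critical_pt \<mu> a b N \<xi> (?x \<xi>)" if "\<xi> \<in> X" for \<xi>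
      using defd that theI'[of "is_avg_critical_pt \<mu> a b N \<xi>"]
      unfolding avg_critical_pt_defined_def avg_critical_pt_def by blast
    let ?N = "PiM {..<m} (\<lambda>_. \<mu>)"
    interpret P: prob_space ?N by (rule prob_space_PiM_lessThan)
    let ?crit = "\<lambda>\<xi> \<zeta>. \<exists>!x. x \<in> geodesic_disk (?x \<xi>) (r / N) \<and> is_critical_pt (poly_with_zeros X m \<zeta>) x"
    let ?E = "{\<zeta> \<in> space ?N. \<forall>\<xi>\<in>X. ?crit \<xi> \<zeta>}"
    define Bad where "Bad \<xi> = {\<zeta> \<in> space ?N. \<not> typical_sample \<mu> (wcoord (?x \<xi>)) (2 * \<rho> / real N) (\<eta> * real N) m \<zeta>}" for \<xi>
    have Bad: "Bad \<xi> \<in> sets ?N" "P.prob (Bad \<xi>) \<le> C * real N powr (\<kappa> - 1)" for \<xi>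
      unfolding Bad_def using typical_sample_sets C(2)[OF N m(2)] by auto
    have crit: "?crit \<xi> \<zeta>" if "\<xi> \<in> X" "\<zeta> \<in> space ?N" "\<zeta> \<notin> Bad \<xi>" for \<xi> \<zeta>
    proof (rule typical_imp_unique_critical[OF N X(1) m(1) that(1) nz s _ avg[OF that(1)] \<open>0 < a\<close> b cA(1) _ cA(2) _
          \<open>0 < r\<close> \<rho>_def \<eta> \<eta>k[unfolded k1_def k2_def] large _ _ sepsum far cardX Nc])
      show "c \<le> cmod (wcoord (?x \<xi>))" "1 + (cmod (wcoord (?x \<xi>)))\<^sup>2 \<le> A\<^sup>2"
        using cA(3)[OF N avg[OF that(1)]] by auto
      show "b / N \<le> s / 2" "2 * \<rho> / N \<le> s / 2" using L large'[of b] large'[of "2 * \<rho>"] by blast+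
      show "typical_sample \<mu> (wcoord (?x \<xi>)) (2 * \<rho> / real N) (\<eta> * real N) m \<zeta>"
        using that by (simp add: Bad_def)
    qed (use sep in \<open>auto simp: s_def\<close>)
    have "?E \<in> sets ?N"
    proof (rule unique_critical_event_sets[OF X(1)])
      fix \<xi> assume \<xi>: "\<xi> \<in> X"
      have x0: "?x \<xi> \<in> S2" "?x \<xi> \<noteq> zero_pt" using avg[OF \<xi>] by (auto simp: is_avg_critical_pt_def)
      have "r / N \<le> pi" using large(1) pi_gt3 by linarith
      then show "open {w. inv_stereo w \<in> geodesic_disk (?x \<xi>) (r / N)}"
        using x0 \<open>0 < r\<close> Np by (intro open_wcoord_geodesic_disk) auto
      fix x assume x: "x \<in> geodesic_disk (?x \<xi>) (r / N)"
      have w: "c \<le> cmod (wcoord (?x \<xi>))" "1 + (cmod (wcoord (?x \<xi>)))\<^sup>2 \<le> A\<^sup>2"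
        using cA(3)[OF N avg[OF \<xi>]] by auto
      have *: "x \<in> S2 \<and> x \<noteq> zero_pt \<and> cmod (wcoord x - wcoord (?x \<xi>)) < r / N * A\<^sup>2"
        by (rule geodesic_disk_wcoord[OF x0 _ w(2) _ large(1,2) x]) (use cA(2) \<open>0 < r\<close> Np in simp_all)
      have "0 < \<rho> / N" using \<rho> Np by simp
      then have "\<rho> / N < c" using large(3) by (simp only: times_divide_eq_right[symmetric])
      moreover have "r / N * A\<^sup>2 = \<rho> / N" by (simp add: \<rho>_def)
      ultimately have less: "r / N * A\<^sup>2 < c" by (simp only:)
      have "wcoord x \<noteq> 0"
      proof
        assume "wcoord x = 0"
        then have "cmod (wcoord (?x \<xi>)) < r / N * A\<^sup>2" using * by (simp only: diff_0 norm_minus_cancel)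
        with less w(1) show False by linarith
      qed
      with * show "x \<in> S2 \<and> x \<noteq> zero_pt \<and> wcoord x \<noteq> 0" by (simp only: simp_thms)
    qed
    \<comment> \<open>Outside the union of the bad events every \<open>\<xi>\<close> has its unique
      critical point.\<close>
    have "space ?N - (\<Union>\<xi>\<in>X. Bad \<xi>) \<subseteq> ?E"
    proof
      fix \<zeta> assume \<zeta>: "\<zeta> \<in> space ?N - (\<Union>\<xi>\<in>X. Bad \<xi>)"
      have sp: "\<zeta> \<in> space ?N" using \<zeta> by (rule DiffD1)
      have "\<zeta> \<notin> Bad \<xi>" if "\<xi> \<in> X" for \<xi> using \<zeta> that by blast
      then have "\<forall>\<xi>\<in>X. ?crit \<xi> \<zeta>" by (intro ballI crit sp)
      with sp show "\<zeta> \<in> ?E" by (intro CollectI conjI)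
    qed
    then have "P.prob (space ?N - (\<Union>\<xi>\<in>X. Bad \<xi>)) \<le> P.prob ?E"
      using \<open>?E \<in> sets ?N\<close> by (rule P.finite_measure_mono)
    moreover have "P.prob (space ?N - (\<Union>\<xi>\<in>X. Bad \<xi>)) = 1 - P.prob (\<Union>\<xi>\<in>X. Bad \<xi>)"
      by (rule P.prob_compl) (intro sets.finite_UN X(1) Bad(1))
    moreover have "P.prob (\<Union>\<xi>\<in>X. Bad \<xi>) \<le> (\<Sum>\<xi>\<in>X. P.prob (Bad \<xi>))"
      by (rule P.finite_measure_subadditive_finite[OF X(1)]) (use Bad(1) in blast)
    moreover have "(\<Sum>\<xi>\<in>X. P.prob (Bad \<xi>)) \<le> real (card X) * (C * real N powr (\<kappa> - 1))"
      by (rule sum_bounded_above) (rule Bad(2))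
    \<comment> \<open>The union bound: at most \<open>N powr \<alpha>\<close> bad events, and the
      exponents add up to \<open>- \<delta>\<close>.\<close>
    moreover have "real (card X) * (C * real N powr (\<kappa> - 1)) \<le> C * real N powr - \<delta>"
    proof -
      have "real (card X) * (C * real N powr (\<kappa> - 1)) \<le> real N powr \<alpha> * (C * real N powr (\<kappa> - 1))"
        using n C(1) by (intro mult_right_mono) auto
      also have "\<dots> = C * (real N powr \<alpha> * real N powr (\<kappa> - 1))" by (simp only: mult.left_commute)
      also have "real N powr \<alpha> * real N powr (\<kappa> - 1) = real N powr - \<delta>"
        unfolding powr_add[symmetric] by (simp add: \<kappa>_def)
      finally show ?thesis .
    qed
    moreover have "C * real N powr - \<delta> \<le> (C + real N0 powr \<delta>) * real N powr - \<delta>"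
      by (intro mult_right_mono) auto
    ultimately have "1 - (C + real N0 powr \<delta>) * real N powr - \<delta> \<le> P.prob ?E" by linarith
    then show ?thesis unfolding m_def .
  qed
  show ?thesis
  proof (intro exI[of _ "C + real N0 powr \<delta>"] conjI allI impI)
    show "C + real N0 powr \<delta> > 0" using C(1) by (simp add: add_pos_nonneg)
    fix n :: "nat \<Rightarrow> nat" and \<Xi> :: "nat \<Rightarrow> (real ^ 3) set" and N :: nat
    assume 1: "\<forall>N\<ge>1. 1 \<le> n N \<and> real (n N) \<le> real N powr \<alpha> \<and>
       finite (\<Xi> N) \<and> card (\<Xi> N) = n N \<and> \<Xi> N \<subseteq> S2 - S_exc \<mu>"
      and 2: "\<forall>N\<ge>1. \<forall>\<xi>\<^sub>1\<in>\<Xi> N. \<forall>\<xi>\<^sub>2\<in>\<Xi> N. \<xi>\<^sub>1 \<noteq> \<xi>\<^sub>2 \<longrightarrow>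
       cmod (wcoord \<xi>\<^sub>1 - wcoord \<xi>\<^sub>2) > real N powr (- 1 / 2 + \<epsilon> / 2)"
      and N: "1 \<le> N" and 3: "\<forall>\<xi>\<in>\<Xi> N. avg_critical_pt_defined \<mu> a b N \<xi>"
    have n: "1 \<le> n N" "real (n N) \<le> real N powr \<alpha>" "finite (\<Xi> N)" "card (\<Xi> N) = n N" "\<Xi> N \<subseteq> S2 - S_exc \<mu>"
      using 1 N by blast+
    have 2: "\<And>x y. x \<in> \<Xi> N \<Longrightarrow> y \<in> \<Xi> N \<Longrightarrow> x \<noteq> y \<Longrightarrow> real N powr (- 1 / 2 + \<epsilon> / 2) < cmod (wcoord x - wcoord y)"
      using 2 N by blast
    show "measure (PiM {..<N - n N} (\<lambda>_. \<mu>))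
         {\<zeta> \<in> space (PiM {..<N - n N} (\<lambda>_. \<mu>)).
            \<forall>\<xi>\<in>\<Xi> N. \<exists>!x. x \<in> geodesic_disk (avg_critical_pt \<mu> a b N \<xi>) (r / real N) \<and>
               is_critical_pt (poly_with_zeros (\<Xi> N) (N - n N) \<zeta>) x}
       \<ge> 1 - (C + real N0 powr \<delta>) * real N powr (- \<delta>)"
      using main[OF N _ _ n(3,5) 2 3] n unfolding n(4) by blast
  qed
qed

end
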